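(* Let $d\in\mathbb{N}$, let $\Omega\subseteq\mathbb{R}^d$ be measurable, and let $T=(e^{-tH})_{t\ge 0}$ be a selfadjoint positivity preserving $C_0$-semigroup on $L_2(\Omega)$, with generator $-H$, that is dominated by the free heat semigroup. Assume that $H$ has compact resolvent. Let $\varphi$ be an eigenfunction of $H$ with eigenvalue $\lambda$. Then $$\|\varphi\|_1^2\le c_d\,C_\varepsilon^d\,\lambda^{-d/2}\,N_{(1+\varepsilon)\lambda}(H)\,\|\varphi\|_2^2\qquad\text{for all }\varepsilon>0,$$ where $c_d=35^{d+1}d^{d/2}$ and $C_\varepsilon=\varepsilon^{-1/2}\ln\bigl(3+\frac{3}{\varepsilon}\bigr)$.
   Context: Functions on $\Omega$ are extended by $0$ to $\mathbb{R}^d$, so $L_2(\Omega)\subseteq L_2(\mathbb{R}^d)$. The semigroup $T$ being dominated by the free heat semigroup means $0\le T(t)f\le e^{t\Delta}f$ for all $t\ge0$ and all $0\le f\in L_2(\Omega)$, where $(e^{t\Delta})_{t\ge0}$ is the heat semigroup on $L_2(\mathbb{R}^d)$, with convolution kernel $k_t(x)=(4\pi t)^{-d/2}\exp(-|x|^2/(4t))$. $N_t(H)$ is the number of eigenvalues of $H$ that are $\le t$, counted with multiplicity. $\|\cdot\|_p$ is the norm of $L_p(\Omega)$ with respect to Lebesgue measure; in particular the assertion includes $\varphi\in L_1(\Omega)$. *)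

theory Defs
  imports "HOL-Analysis.Analysis" "HOL-Library.Complex_Order"
begin

section \<open>The complex Hilbert space of square-integrable functions\<close>

text \<open>
  The type \<open>'a L2\<close> is $L_2$ of the whole Euclidean space, with complex scalars: square-integrable
  Lebesgue measurable functions modulo equality almost everywhere. The subspace of those functions
  that vanish almost everywhere outside \<open>\<Omega>\<close> plays the role of $L_2(\Omega)$ (extension by $0$).
\<close>

definition square_integrable :: "('a::euclidean_space \<Rightarrow> complex) \<Rightarrow> bool" where
  "square_integrable f \<longleftrightarrow>
     f \<in> borel_measurable lebesgue \<and> integrable lebesgue (\<lambda>x. (cmod (f x))\<^sup>2)"

definition L2_rel :: "('a::euclidean_space \<Rightarrow> complex) \<Rightarrow> ('a \<Rightarrow> complex) \<Rightarrow> bool" where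
  "L2_rel f g \<longleftrightarrow>
     square_integrable f \<and> square_integrable g \<and> (AE x in lebesgue. f x = g x)"

lemma square_integrable_0: "square_integrable (\<lambda>x::'a::euclidean_space. 0)"
  by (simp add: square_integrable_def)

lemma square_integrable_cmult:
  "square_integrable f \<Longrightarrow> square_integrable (\<lambda>x. c * f x)"
  by (auto simp: square_integrable_def norm_mult power_mult_distrib)

lemma square_integrable_add:
  assumes f: "square_integrable f" and g: "square_integrable g"
  shows "square_integrable (\<lambda>x. f x + g x)"
proof -
  have [measurable]: "f \<in> borel_measurable lebesgue" "g \<in> borel_measurable lebesgue"
    using f g by (auto simp: square_integrable_def)
  have le: "(cmod (a + b))\<^sup>2 \<le> 2 * (cmod a)\<^sup>2 + 2 * (cmod b)\<^sup>2" for a b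
  proof -
    have "(cmod (a + b))\<^sup>2 \<le> (cmod a + cmod b)\<^sup>2"
      by (intro power_mono norm_triangle_ineq) auto
    also have "\<dots> \<le> 2 * (cmod a)\<^sup>2 + 2 * (cmod b)\<^sup>2"
      using zero_le_power2[of "cmod a - cmod b"] by (simp add: power2_eq_square algebra_simps)
    finally show ?thesis .
  qed
  have "integrable lebesgue (\<lambda>x. (cmod (f x + g x))\<^sup>2)"
  proof (rule Bochner_Integration.integrable_bound)
    show "integrable lebesgue (\<lambda>x. 2 * (cmod (f x))\<^sup>2 + 2 * (cmod (g x))\<^sup>2)"
      using f g by (auto simp: square_integrable_def)
  qed (use le in auto)
  then show ?thesis
    by (auto simp: square_integrable_def)
qed

lemma integrable_mult_cnj:
  assumes f: "square_integrable f" and g: "square_integrable g"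
  shows "integrable lebesgue (\<lambda>x. f x * cnj (g x))"
proof -
  have [measurable]: "f \<in> borel_measurable lebesgue" "g \<in> borel_measurable lebesgue"
    using f g by (auto simp: square_integrable_def)
  have [measurable]: "cnj \<in> borel_measurable borel"
    by (intro borel_measurable_continuous_onI continuous_intros)
  have le: "cmod a * cmod b \<le> (cmod a)\<^sup>2 + (cmod b)\<^sup>2" for a b
  proof -
    have "2 * (cmod a * cmod b) \<le> (cmod a)\<^sup>2 + (cmod b)\<^sup>2"
      using zero_le_power2[of "cmod a - cmod b"] by (simp add: power2_eq_square algebra_simps)
    moreover have "0 \<le> cmod a * cmod b" by simp
    ultimately show ?thesis by linarith
  qed
  show ?thesis
  proof (rule Bochner_Integration.integrable_bound)
    show "integrable lebesgue (\<lambda>x. (cmod (f x))\<^sup>2 + (cmod (g x))\<^sup>2)"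
      using f g by (auto simp: square_integrable_def)
  qed (use le in \<open>auto simp: norm_mult\<close>)
qed

lemma part_equivp_L2_rel: "part_equivp L2_rel"
proof (rule part_equivpI)
  show "\<exists>f. L2_rel f f"
    using square_integrable_0 by (auto simp: L2_rel_def)
  show "symp L2_rel"
    by (auto simp: symp_def L2_rel_def elim: AE_mp)
  show "transp L2_rel"
    by (auto simp: transp_def L2_rel_def elim: AE_mp)
qed

quotient_type (overloaded) 'a L2 = "'a::euclidean_space \<Rightarrow> complex" / partial: L2_rel
  morphisms rep_L2 abs_L2
  by (rule part_equivp_L2_rel)

lift_definition scaleC :: "complex \<Rightarrow> 'a::euclidean_space L2 \<Rightarrow> 'a L2" (infixr \<open>*\<^sub>C\<close> 75)
  is "\<lambda>c f x. c * f x"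
  by (auto simp: L2_rel_def square_integrable_cmult elim: AE_mp)

text \<open>The inner product is linear in its first argument.\<close>

lift_definition cinner :: "'a::euclidean_space L2 \<Rightarrow> 'a L2 \<Rightarrow> complex"
  is "\<lambda>f g. LINT x|lebesgue. f x * cnj (g x)"
proof -
  fix f f' g g' :: "'a \<Rightarrow> complex"
  assume *: "L2_rel f f'" "L2_rel g g'"
  then have "AE x in lebesgue. f x * cnj (g x) = f' x * cnj (g' x)"
    by (auto simp: L2_rel_def elim: AE_mp)
  then show "(LINT x|lebesgue. f x * cnj (g x)) = (LINT x|lebesgue. f' x * cnj (g' x))"
    using * by (intro integral_cong_AE borel_measurable_integrable integrable_mult_cnj)
      (auto simp: L2_rel_def)
qed

instantiation L2 :: (euclidean_space) ab_group_add
begin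

lift_definition zero_L2 :: "'a L2" is "\<lambda>x. 0"
  by (simp add: L2_rel_def square_integrable_0)

lift_definition plus_L2 :: "'a L2 \<Rightarrow> 'a L2 \<Rightarrow> 'a L2" is "\<lambda>f g x. f x + g x"
  by (auto simp: L2_rel_def square_integrable_add elim: AE_mp)

definition uminus_L2 :: "'a L2 \<Rightarrow> 'a L2" where "uminus_L2 f = (-1) *\<^sub>C f"

definition minus_L2 :: "'a L2 \<Rightarrow> 'a L2 \<Rightarrow> 'a L2" where "minus_L2 f g = f + (- g)"

instance
proof
  fix f g h :: "'a L2"
  show "f + g + h = f + (g + h)"
    by transfer (auto simp: L2_rel_def square_integrable_add add.assoc)
  show "f + g = g + f"
    by transfer (auto simp: L2_rel_def square_integrable_add add.commute)
  show "0 + f = f"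
    by transfer (auto simp: L2_rel_def)
  show "- f + f = 0"
    unfolding uminus_L2_def
    by transfer (auto simp: L2_rel_def square_integrable_0
        intro: square_integrable_add square_integrable_cmult)
  show "f - g = f + - g"
    by (fact minus_L2_def)
qed

end

instantiation L2 :: (euclidean_space) real_inner
begin

definition scaleR_L2 :: "real \<Rightarrow> 'a L2 \<Rightarrow> 'a L2" where
  "scaleR_L2 r f = complex_of_real r *\<^sub>C f"

definition inner_L2 :: "'a L2 \<Rightarrow> 'a L2 \<Rightarrow> real" where
  "inner_L2 f g = Re (cinner f g)"

definition norm_L2 :: "'a L2 \<Rightarrow> real" where
  "norm_L2 f = sqrt (inner f f)"

definition sgn_L2 :: "'a L2 \<Rightarrow> 'a L2" where
  "sgn_L2 f = inverse (norm f) *\<^sub>R f"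

definition dist_L2 :: "'a L2 \<Rightarrow> 'a L2 \<Rightarrow> real" where
  "dist_L2 f g = norm (f - g)"

definition uniformity_L2 :: "('a L2 \<times> 'a L2) filter" where
  "uniformity_L2 = (INF e\<in>{0<..}. principal {(f, g). dist f g < e})"

definition open_L2 :: "'a L2 set \<Rightarrow> bool" where
  "open_L2 S \<longleftrightarrow> (\<forall>f\<in>S. \<forall>\<^sub>F (f', g) in uniformity. f' = f \<longrightarrow> g \<in> S)"

instance
proof
  fix a b :: real and f g h :: "'a L2"
  show "a *\<^sub>R (f + g) = a *\<^sub>R f + a *\<^sub>R g"
    unfolding scaleR_L2_def
    by transfer (auto simp: L2_rel_def ring_distribs
        intro: square_integrable_add square_integrable_cmult)
  show "(a + b) *\<^sub>R f = a *\<^sub>R f + b *\<^sub>R f"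
    unfolding scaleR_L2_def
    by transfer (auto simp: L2_rel_def ring_distribs
        intro: square_integrable_add square_integrable_cmult)
  show "a *\<^sub>R b *\<^sub>R f = (a * b) *\<^sub>R f"
    unfolding scaleR_L2_def
    by transfer (auto simp: L2_rel_def mult.assoc intro: square_integrable_cmult)
  show "1 *\<^sub>R f = f"
    unfolding scaleR_L2_def
    by transfer (auto simp: L2_rel_def)
  show "dist f g = norm (f - g)"
    by (fact dist_L2_def)
  show "sgn f = inverse (norm f) *\<^sub>R f"
    by (fact sgn_L2_def)
  show "(uniformity :: ('a L2 \<times> 'a L2) filter)
      = (INF e\<in>{0<..}. principal {(x, y). dist x y < e})"
    by (fact uniformity_L2_def)
  show "open U \<longleftrightarrow> (\<forall>x\<in>U. \<forall>\<^sub>F (x', y) in uniformity. x' = x \<longrightarrow> y \<in> U)" for U :: "'a L2 set"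
    by (fact open_L2_def)
  show "inner f g = inner g f"
    unfolding inner_L2_def
  proof transfer
    fix f g :: "'a \<Rightarrow> complex"
    have "(LINT x|lebesgue. g x * cnj (f x)) = (LINT x|lebesgue. cnj (f x * cnj (g x)))"
      by (simp add: mult.commute)
    also have "\<dots> = cnj (LINT x|lebesgue. f x * cnj (g x))"
      by (rule Bochner_Integration.integral_cnj)
    finally show "Re (LINT x|lebesgue. f x * cnj (g x)) = Re (LINT x|lebesgue. g x * cnj (f x))"
      by simp
  qed
  show "inner (f + g) h = inner f h + inner g h"
    unfolding inner_L2_def
    by transfer (auto simp: L2_rel_def ring_distribs integrable_mult_cnj)
  show "inner (a *\<^sub>R f) g = a * inner f g"
    unfolding inner_L2_def scaleR_L2_def
    by transfer (auto simp: mult.assoc)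
  have self: "Re (cinner f f) \<ge> 0 \<and> (Re (cinner f f) = 0 \<longleftrightarrow> f = 0)"
  proof transfer
    fix f :: "'a \<Rightarrow> complex"
    assume "L2_rel f f"
    then have sq: "square_integrable f"
      by (simp add: L2_rel_def)
    have "(LINT x|lebesgue. f x * cnj (f x))
        = (LINT x|lebesgue. complex_of_real ((cmod (f x))\<^sup>2))"
      by (rule arg_cong[where f = "integral\<^sup>L lebesgue"])
        (auto simp: fun_eq_iff complex_norm_square[symmetric] simp del: of_real_power)
    then have eq: "Re (LINT x|lebesgue. f x * cnj (f x)) = (LINT x|lebesgue. (cmod (f x))\<^sup>2)"
      by (simp del: of_real_power)
    have "(LINT x|lebesgue. (cmod (f x))\<^sup>2) = 0 \<longleftrightarrow> (AE x in lebesgue. (cmod (f x))\<^sup>2 = 0)"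
      using sq by (intro integral_nonneg_eq_0_iff_AE) (auto simp: square_integrable_def)
    then show "Re (LINT x|lebesgue. f x * cnj (f x)) \<ge> 0 \<and>
        (Re (LINT x|lebesgue. f x * cnj (f x)) = 0 \<longleftrightarrow> L2_rel f (\<lambda>x. 0))"
      using sq eq by (auto simp: L2_rel_def square_integrable_0)
  qed
  then show "0 \<le> inner f f" and "inner f f = 0 \<longleftrightarrow> f = 0"
    by (auto simp: inner_L2_def)
  show "norm f = sqrt (inner f f)"
    by (fact norm_L2_def)
qed

end

interpretation complex_L2: vector_space "scaleC :: complex \<Rightarrow> 'a::euclidean_space L2 \<Rightarrow> 'a L2"
proof
  fix a b :: complex and f g :: "'a L2"
  show "a *\<^sub>C (f + g) = a *\<^sub>C f + a *\<^sub>C g"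
    by transfer (auto simp: L2_rel_def ring_distribs
        intro: square_integrable_add square_integrable_cmult)
  show "(a + b) *\<^sub>C f = a *\<^sub>C f + b *\<^sub>C f"
    by transfer (auto simp: L2_rel_def ring_distribs
        intro: square_integrable_add square_integrable_cmult)
  show "a *\<^sub>C b *\<^sub>C f = (a * b) *\<^sub>C f"
    by transfer (auto simp: L2_rel_def mult.assoc intro: square_integrable_cmult)
  show "1 *\<^sub>C f = f"
    by transfer (auto simp: L2_rel_def)
qed

text \<open>The order of \<open>Complex_Order\<close> makes \<open>0 \<le> f\<close> mean: real-valued and nonnegative a.e.\<close>

instantiation L2 :: (euclidean_space) order
begin

lift_definition less_eq_L2 :: "'a L2 \<Rightarrow> 'a L2 \<Rightarrow> bool"
  is "\<lambda>f g. AE x in lebesgue. f x \<le> g x"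
proof -
  fix f f' g g' :: "'a \<Rightarrow> complex"
  assume "L2_rel f f'" "L2_rel g g'"
  then have "AE x in lebesgue. f x = f' x" "AE x in lebesgue. g x = g' x"
    by (auto simp: L2_rel_def)
  then have "AE x in lebesgue. (f x \<le> g x) = (f' x \<le> g' x)"
    by eventually_elim simp
  then show "(AE x in lebesgue. f x \<le> g x) = (AE x in lebesgue. f' x \<le> g' x)"
    by (rule eventually_subst)
qed

definition less_L2 :: "'a L2 \<Rightarrow> 'a L2 \<Rightarrow> bool" where
  "less_L2 f g \<longleftrightarrow> f \<le> g \<and> \<not> g \<le> f"

instance
proof
  fix f g h :: "'a L2"
  show "f < g \<longleftrightarrow> f \<le> g \<and> \<not> g \<le> f"
    by (fact less_L2_def)
  show "f \<le> f"
    by transfer simp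
  show "f \<le> g \<Longrightarrow> g \<le> h \<Longrightarrow> f \<le> h"
    by transfer (auto elim!: AE_mp intro: order.trans)
  show "f \<le> g \<Longrightarrow> g \<le> f \<Longrightarrow> f = g"
    by transfer (auto simp: L2_rel_def elim!: AE_mp)
qed

end

definition L2_on :: "'a::euclidean_space set \<Rightarrow> 'a L2 set" where
  "L2_on \<Omega> = {f. AE x in lebesgue. x \<notin> \<Omega> \<longrightarrow> rep_L2 f x = 0}"


section \<open>Operators and semigroups on a closed subspace\<close>

text \<open>
  Everything below is relative to a closed complex subspace \<open>V\<close>, which will be \<open>L2_on \<Omega>\<close>; the values
  of an operator outside \<open>V\<close> are irrelevant. Unbounded operators are given by their graphs.
\<close>

definition bounded_operator_on ::
    "'a::euclidean_space L2 set \<Rightarrow> ('a L2 \<Rightarrow> 'a L2) \<Rightarrow> bool" where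
  "bounded_operator_on V S \<longleftrightarrow>
     (\<forall>f\<in>V. S f \<in> V) \<and>
     (\<forall>f\<in>V. \<forall>g\<in>V. S (f + g) = S f + S g) \<and>
     (\<forall>c. \<forall>f\<in>V. S (c *\<^sub>C f) = c *\<^sub>C S f) \<and>
     (\<exists>K. \<forall>f\<in>V. norm (S f) \<le> K * norm f)"

definition C0_semigroup_on ::
    "'a::euclidean_space L2 set \<Rightarrow> (real \<Rightarrow> 'a L2 \<Rightarrow> 'a L2) \<Rightarrow> bool" where
  "C0_semigroup_on V T \<longleftrightarrow>
     (\<forall>t\<ge>0. bounded_operator_on V (T t)) \<and>
     (\<forall>f\<in>V. T 0 f = f) \<and>
     (\<forall>s\<ge>0. \<forall>t\<ge>0. \<forall>f\<in>V. T (s + t) f = T s (T t f)) \<and>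
     (\<forall>f\<in>V. ((\<lambda>t. T t f) \<longlongrightarrow> f) (at_right 0))"

definition generator_on ::
    "'a::euclidean_space L2 set \<Rightarrow> (real \<Rightarrow> 'a L2 \<Rightarrow> 'a L2) \<Rightarrow> ('a L2 \<times> 'a L2) set" where
  "generator_on V T = {(f, g). f \<in> V \<and> ((\<lambda>t. (T t f - f) /\<^sub>R t) \<longlongrightarrow> g) (at_right 0)}"

definition selfadjoint_semigroup_on ::
    "'a::euclidean_space L2 set \<Rightarrow> (real \<Rightarrow> 'a L2 \<Rightarrow> 'a L2) \<Rightarrow> bool" where
  "selfadjoint_semigroup_on V T \<longleftrightarrow>
     (\<forall>t\<ge>0. \<forall>f\<in>V. \<forall>g\<in>V. cinner (T t f) g = cinner f (T t g))"

definition positivity_preserving_on ::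
    "'a::euclidean_space L2 set \<Rightarrow> (real \<Rightarrow> 'a L2 \<Rightarrow> 'a L2) \<Rightarrow> bool" where
  "positivity_preserving_on V T \<longleftrightarrow> (\<forall>t\<ge>0. \<forall>f\<in>V. 0 \<le> f \<longrightarrow> 0 \<le> T t f)"

text \<open>
  \<open>R\<close> is the resolvent $(\mu - H)^{-1}$: for every \<open>f \<in> V\<close>, the equation $(\mu - H) g = f$ has the
  unique solution \<open>g = R f\<close> in the domain of \<open>H\<close>.
\<close>

definition is_resolvent_on ::
    "'a::euclidean_space L2 set \<Rightarrow> ('a L2 \<times> 'a L2) set \<Rightarrow> complex \<Rightarrow> ('a L2 \<Rightarrow> 'a L2) \<Rightarrow> bool" where
  "is_resolvent_on V H \<mu> R \<longleftrightarrow>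
     bounded_operator_on V R \<and>
     (\<forall>f\<in>V. \<forall>g. (\<exists>h. (g, h) \<in> H \<and> \<mu> *\<^sub>C g - h = f) \<longleftrightarrow> g = R f)"

definition compact_resolvent_on ::
    "'a::euclidean_space L2 set \<Rightarrow> ('a L2 \<times> 'a L2) set \<Rightarrow> bool" where
  "compact_resolvent_on V H \<longleftrightarrow>
     (\<exists>\<mu> R. is_resolvent_on V H \<mu> R \<and> compact (closure (R ` {f \<in> V. norm f \<le> 1})))"

definition eigenspace :: "('a::euclidean_space L2 \<times> 'a L2) set \<Rightarrow> real \<Rightarrow> 'a L2 set" where
  "eigenspace H \<mu> = {f. (f, complex_of_real \<mu> *\<^sub>C f) \<in> H}"

definition eigenfunction ::
    "('a::euclidean_space L2 \<times> 'a L2) set \<Rightarrow> real \<Rightarrow> 'a L2 \<Rightarrow> bool" where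
  "eigenfunction H \<mu> f \<longleftrightarrow> f \<in> eigenspace H \<mu> \<and> f \<noteq> 0"

text \<open>
  The multiplicity of an eigenvalue is the complex dimension of its eigenspace. Both the library's
  \<open>dim\<close> and the sum take the value \<open>0\<close> in infinite situations. If \<open>H\<close> is selfadjoint, bounded
  below and has compact resolvent, then the index set and all the eigenspaces are finite (respectively
  finite-dimensional), so this convention is never used.
\<close>

definition eigenvalue_count :: "('a::euclidean_space L2 \<times> 'a L2) set \<Rightarrow> real \<Rightarrow> nat" where
  "eigenvalue_count H t =
     (\<Sum>\<mu> | \<mu> \<le> t \<and> (\<exists>f. eigenfunction H \<mu> f). complex_L2.dim (eigenspace H \<mu>))"


section \<open>The free heat semigroup\<close>

definition heat_kernel :: "real \<Rightarrow> 'a::euclidean_space \<Rightarrow> real" where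
  "heat_kernel t x =
     (4 * pi * t) powr (- (real DIM('a) / 2)) * exp (- (norm x)\<^sup>2 / (4 * t))"

definition heat_semigroup ::
    "real \<Rightarrow> ('a::euclidean_space \<Rightarrow> complex) \<Rightarrow> 'a \<Rightarrow> complex" where
  "heat_semigroup t f x =
     (if t = 0 then f x
      else LINT y|lebesgue. complex_of_real (heat_kernel t (x - y)) * f y)"

definition dominated_by_heat_semigroup_on ::
    "'a::euclidean_space L2 set \<Rightarrow> (real \<Rightarrow> 'a L2 \<Rightarrow> 'a L2) \<Rightarrow> bool" where
  "dominated_by_heat_semigroup_on V T \<longleftrightarrow>
     (\<forall>t\<ge>0. \<forall>f\<in>V. 0 \<le> f \<longrightarrow>
        0 \<le> T t f \<and> (AE x in lebesgue. rep_L2 (T t f) x \<le> heat_semigroup t (rep_L2 f) x))"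

end

theory Submission
  imports Defs "HOL-Probability.Distributions"
begin

text \<open>
  Space is cut into cells of side $l \sim \sqrt{d/(\varepsilon\lambda)}$ by smooth product cutoffs
  $\chi_k$. Call a cell $k$ resonant if the energy form at $\chi_k\varphi$ is below
  $(1+\varepsilon)\lambda\,\|\chi_k\varphi\|_2^2$. Resonant cells of one colour modulo 3 are
  separated, so by the min-max principle there are at most $N_{(1+\varepsilon)\lambda}(H)$ of them.
  On the other cells, domination by the heat semigroup yields the localisation formula
  $\varepsilon\lambda\,\|\chi_k\varphi\|_2^2 \le \int |\nabla\chi_k|^2 |\varphi|^2$. Summing this
  against weights that grow exponentially in the distance to the resonant cells, the gradient terms
  are absorbed, whence $\sum_k w_k \|\chi_k\varphi\|_2^2 \le 5\,\|\varphi\|_2^2$; the bound on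
  $\|\varphi\|_1$ is then the Cauchy-Schwarz inequality, because $\sum_k 1/w_k$ is controlled by
  the number of resonant cells.
\<close>

section \<open>The Hilbert space\<close>

text \<open>The quadratic form of H is never introduced. Its value at \<open>f\<close> is replaced
  by \<open>((norm f)\<^sup>2 - Re (cinner (T t f) f)) / t\<close> at the times 2^-n, which does not
  decrease with n; so the localised pieces of the eigenfunction need not be shown to lie in a form
  domain. The price is that every formula carries an error that must be o(t). This is why fourth
  moments of the heat kernel, of order t^2, are needed, both for the Taylor remainder of the cutoffs
  and for the coupling of separated cells. The spectral facts are drawn from T as well: H T(s) is
  bounded for s > 0, so the compact resolvent makes T(s) compact. The constants hang together.
  Raised cosines tolerate weights of neighbouring cells that differ by a factor 9, at the cost of a
  factor 5/3 in the gradient bound. The cell side makes that bound at most 4/5 of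
  \<epsilon>\<lambda>; the remaining fifth produces the factor 5. Decay by 1/9 per step sums to 5/4
  in each coordinate, the colours contribute 3 and the support of a cutoff 2l, and (2l * 5/4 * 3)^d
  is the power of 35.\<close>

lemma square_integrable_rep: "square_integrable (rep_L2 f)"
  using Quotient3_rep_reflp[OF Quotient3_L2, of f] by (simp add: L2_rel_def)

lemma rep_L2_measurable [measurable]: "rep_L2 f \<in> borel_measurable lebesgue"
  using square_integrable_rep[of f] by (simp add: square_integrable_def)

lemma integrable_cmod_rep_sq: "integrable lebesgue (\<lambda>x. (cmod (rep_L2 f x))\<^sup>2)"
  using square_integrable_rep[of f] by (simp add: square_integrable_def)

lemma L2_rel_rep_abs:
  assumes "square_integrable f"
  shows "L2_rel (rep_L2 (abs_L2 f)) f"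
  using rep_abs_rsp_left[OF Quotient3_L2, of f f] assms by (simp add: L2_rel_def)

lemma rep_abs_AE: "square_integrable f \<Longrightarrow> AE x in lebesgue. rep_L2 (abs_L2 f) x = f x"
  using L2_rel_rep_abs by (auto simp: L2_rel_def)

lemma L2_eqI:
  assumes "AE x in lebesgue. rep_L2 f x = rep_L2 g x"
  shows "f = g"
  using assms square_integrable_rep[of f] square_integrable_rep[of g]
  by (metis L2_rel_def Quotient3_L2 Quotient3_rel_rep)

lemma rep_add_AE: "AE x in lebesgue. rep_L2 (f + g) x = rep_L2 f x + rep_L2 g x"
  unfolding plus_L2_def map_fun_def comp_def id_def
  by (intro rep_abs_AE square_integrable_add square_integrable_rep)

lemma rep_scaleC_AE: "AE x in lebesgue. rep_L2 (c *\<^sub>C f) x = c * rep_L2 f x"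
  unfolding scaleC_def map_fun_def comp_def id_def
  by (intro rep_abs_AE square_integrable_cmult square_integrable_rep)

lemma rep_zero_AE: "AE x in lebesgue. rep_L2 0 x = 0"
  unfolding zero_L2_def
  by (intro rep_abs_AE square_integrable_0)

lemma rep_scaleR_AE: "AE x in lebesgue. rep_L2 (c *\<^sub>R f) x = of_real c * rep_L2 f x"
  unfolding scaleR_L2_def by (rule rep_scaleC_AE)

lemma rep_diff_AE: "AE x in lebesgue. rep_L2 (f - g) x = rep_L2 f x - rep_L2 g x"
  using rep_add_AE[of f "- g"] rep_scaleC_AE[of "-1" g, folded uminus_L2_def]
  unfolding minus_L2_def by eventually_elim simp

lemma cinner_eq: "cinner f g = (LINT x|lebesgue. rep_L2 f x * cnj (rep_L2 g x))"
  by (simp add: cinner_def)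

lemma integrable_rep_mult_cnj: "integrable lebesgue (\<lambda>x. rep_L2 f x * cnj (rep_L2 g x))"
  by (intro integrable_mult_cnj square_integrable_rep)

lemma cinner_commute: "cinner g f = cnj (cinner f g)"
proof -
  have "cinner g f = (LINT x|lebesgue. cnj (rep_L2 f x * cnj (rep_L2 g x)))"
    unfolding cinner_eq by (simp add: mult.commute)
  then show ?thesis
    unfolding cinner_eq by (simp only: Bochner_Integration.integral_cnj)
qed

lemma cinner_add_left: "cinner (f + g) h = cinner f h + cinner g h"
proof -
  have "cinner (f + g) h = (LINT x|lebesgue. rep_L2 f x * cnj (rep_L2 h x)
      + rep_L2 g x * cnj (rep_L2 h x))"
    unfolding cinner_eq
    by (intro integral_cong_AE borel_measurable_integrable integrable_rep_mult_cnj
        Bochner_Integration.integrable_add)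
      (use rep_add_AE[of f g] in \<open>auto simp: ring_distribs\<close>)
  then show ?thesis
    unfolding cinner_eq by (simp add: integrable_rep_mult_cnj)
qed

lemma cinner_scaleC_left: "cinner (c *\<^sub>C f) h = c * cinner f h"
proof -
  have "cinner (c *\<^sub>C f) h = (LINT x|lebesgue. c * (rep_L2 f x * cnj (rep_L2 h x)))"
    unfolding cinner_eq
    by (intro integral_cong_AE borel_measurable_integrable integrable_rep_mult_cnj
        integrable_mult_right)
      (use rep_scaleC_AE[of c f] in \<open>auto simp: ring_distribs\<close>)
  then show ?thesis
    unfolding cinner_eq by simp
qed

lemma cinner_add_right: "cinner h (f + g) = cinner h f + cinner h g"
  by (metis cinner_commute cinner_add_left complex_cnj_add)

lemma cinner_scaleC_right: "cinner h (c *\<^sub>C f) = cnj c * cinner h f"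
  by (metis cinner_commute cinner_scaleC_left complex_cnj_mult)

lemma cinner_zero_left [simp]: "cinner 0 h = 0"
  using cinner_scaleC_left[of 0 0 h] by simp

lemma cinner_zero_right [simp]: "cinner h 0 = 0"
  using cinner_scaleC_right[of h 0 0] by simp

lemma cinner_minus_left: "cinner (- f) h = - cinner f h"
  using cinner_scaleC_left[of "-1" f h, folded uminus_L2_def] by simp

lemma cinner_diff_left: "cinner (f - g) h = cinner f h - cinner g h"
  unfolding minus_L2_def[of f] cinner_add_left cinner_minus_left by simp

lemma cinner_sum_left: "cinner (sum f A) h = (\<Sum>a\<in>A. cinner (f a) h)"
  by (induction A rule: infinite_finite_induct) (auto simp: cinner_add_left)

lemma cinner_sum_right: "cinner h (sum f A) = (\<Sum>a\<in>A. cinner h (f a))"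
  by (induction A rule: infinite_finite_induct) (auto simp: cinner_add_right)

lemma scaleR_scaleC_L2: "(r *\<^sub>R f :: 'a::euclidean_space L2) = of_real r *\<^sub>C f"
  by (simp add: scaleR_L2_def)

lemma norm_sq_eq: "(norm f)\<^sup>2 = (LINT x|lebesgue. (cmod (rep_L2 f x))\<^sup>2)"
proof -
  have "(norm f)\<^sup>2 = Re (cinner f f)"
    by (simp add: power2_norm_eq_inner inner_L2_def)
  also have "\<dots> = Re (LINT x|lebesgue. complex_of_real ((cmod (rep_L2 f x))\<^sup>2))"
    unfolding cinner_eq
    by (rule arg_cong[where f = "\<lambda>g. Re (integral\<^sup>L lebesgue g)"])
      (auto simp: fun_eq_iff complex_norm_square[symmetric] simp del: of_real_power)
  finally show ?thesis
    by (simp del: of_real_power)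
qed

lemma cinner_self: "cinner f f = of_real ((norm f)\<^sup>2)"
proof -
  have "cinner f f = (LINT x|lebesgue. complex_of_real ((cmod (rep_L2 f x))\<^sup>2))"
    unfolding cinner_eq
    by (rule arg_cong[where f = "integral\<^sup>L lebesgue"])
      (auto simp: fun_eq_iff complex_norm_square[symmetric] simp del: of_real_power)
  then show ?thesis
    by (simp add: norm_sq_eq del: of_real_power)
qed

lemma nn_integral_rep_sq:
  "(\<integral>\<^sup>+ x. ennreal ((cmod (rep_L2 f x))\<^sup>2) \<partial>lebesgue) = ennreal ((norm f)\<^sup>2)"
  unfolding norm_sq_eq by (intro nn_integral_eq_integral integrable_cmod_rep_sq) auto

lemma norm_scaleC [simp]: "norm (c *\<^sub>C f) = cmod c * norm f"
proof -
  have "(norm (c *\<^sub>C f))\<^sup>2 = Re (cinner (c *\<^sub>C f) (c *\<^sub>C f))"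
    by (simp add: cinner_self)
  also have "\<dots> = Re (c * cnj c * cinner f f)"
    by (simp only: cinner_scaleC_left cinner_scaleC_right mult.assoc mult.left_commute)
  also have "\<dots> = (cmod c * norm f)\<^sup>2"
    unfolding complex_norm_square[symmetric] cinner_self
    by (simp add: power_mult_distrib flip: of_real_power of_real_mult)
  finally show ?thesis
    by (simp add: power2_eq_iff_nonneg)
qed

text \<open>The real Cauchy-Schwarz inequality, applied after \<open>f\<close> has been turned by
  the unimodular phase \<open>c\<close> that makes the complex product real and nonnegative.\<close>

lemma norm_cinner_le: "cmod (cinner f g) \<le> norm f * norm g"
proof (cases "cinner f g = 0")
  case False
  define z where "z = cinner f g"
  define c where "c = cnj z / of_real (cmod z)"
  have z: "z \<noteq> 0" using False by (simp add: z_def)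
  have c: "cmod c = 1" using z by (simp add: c_def norm_divide)
  have "cnj z * z = of_real (cmod z) * of_real (cmod z)"
    using complex_norm_square[of z] by (simp add: power2_eq_square mult.commute)
  then have "c * z = of_real (cmod z)"
    using z by (simp add: c_def field_simps)
  then have "cinner (c *\<^sub>C f) g = of_real (cmod (cinner f g))"
    by (simp add: cinner_scaleC_left z_def)
  then have "cmod (cinner f g) = inner (c *\<^sub>C f) g"
    by (simp add: inner_L2_def)
  also have "\<dots> \<le> norm (c *\<^sub>C f) * norm g"
    by (rule norm_cauchy_schwarz)
  finally show ?thesis using c by simp
qed simp

lemma norm_diff_sq: "(norm (f - g))\<^sup>2 = (norm f)\<^sup>2 - 2 * Re (cinner f g) + (norm g)\<^sup>2"
  for f g :: "'a::euclidean_space L2"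
  by (simp add: power2_norm_eq_inner inner_diff_left inner_diff_right inner_commute flip: inner_L2_def)

lemma tendsto_cinner:
  fixes f g :: "'b \<Rightarrow> 'a::euclidean_space L2"
  assumes "(f \<longlongrightarrow> a) F" "(g \<longlongrightarrow> b) F"
  shows "((\<lambda>x. cinner (f x) (g x)) \<longlongrightarrow> cinner a b) F"
proof -
  have "bounded_bilinear (cinner :: 'a L2 \<Rightarrow> 'a L2 \<Rightarrow> complex)"
    by standard
      (auto simp: cinner_add_left cinner_add_right scaleR_scaleC_L2 cinner_scaleC_left
        cinner_scaleC_right scaleR_conv_of_real intro!: exI[of _ 1] norm_cinner_le)
  then show ?thesis using assms by (rule bounded_bilinear.tendsto)
qed

section \<open>Multiplication operators, the modulus, and functions supported in \<Omega>\<close>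

definition bounded_measurable :: "('a::euclidean_space \<Rightarrow> real) \<Rightarrow> bool" where
  "bounded_measurable \<eta> \<longleftrightarrow> \<eta> \<in> borel_measurable lebesgue \<and> (\<exists>B. \<forall>x. \<bar>\<eta> x\<bar> \<le> B)"

definition mult_L2 :: "('a::euclidean_space \<Rightarrow> real) \<Rightarrow> 'a L2 \<Rightarrow> 'a L2" where
  "mult_L2 \<eta> f = abs_L2 (\<lambda>x. of_real (\<eta> x) * rep_L2 f x)"

definition modulus_L2 :: "'a::euclidean_space L2 \<Rightarrow> 'a L2" where
  "modulus_L2 f = abs_L2 (\<lambda>x. of_real (cmod (rep_L2 f x)))"

lemma bounded_measurable_power2:
  assumes "bounded_measurable \<eta>"
  shows "bounded_measurable (\<lambda>x. (\<eta> x - s)\<^sup>2)"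
proof -
  obtain B where B: "\<And>x. \<bar>\<eta> x\<bar> \<le> B" and [measurable]: "\<eta> \<in> borel_measurable lebesgue"
    using assms by (auto simp: bounded_measurable_def)
  have "\<bar>(\<eta> x - s)\<^sup>2\<bar> \<le> (B + \<bar>s\<bar>)\<^sup>2" for x
  proof -
    have "\<bar>\<eta> x - s\<bar> \<le> B + \<bar>s\<bar>" using B[of x] by linarith
    then show ?thesis by (metis abs_ge_zero abs_power2 power2_abs power_mono)
  qed
  then show ?thesis unfolding bounded_measurable_def by auto
qed

lemma square_integrable_mult:
  assumes "bounded_measurable \<eta>" "square_integrable f"
  shows "square_integrable (\<lambda>x. of_real (\<eta> x) * f x)"
proof -
  obtain B where B: "\<And>x. \<bar>\<eta> x\<bar> \<le> B" and [measurable]: "\<eta> \<in> borel_measurable lebesgue"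
    using assms by (auto simp: bounded_measurable_def)
  have [measurable]: "f \<in> borel_measurable lebesgue"
    using assms by (auto simp: square_integrable_def)
  have "integrable lebesgue (\<lambda>x. (cmod (of_real (\<eta> x) * f x))\<^sup>2)"
  proof (rule Bochner_Integration.integrable_bound)
    show "integrable lebesgue (\<lambda>x. B\<^sup>2 * (cmod (f x))\<^sup>2)"
      using assms by (auto simp: square_integrable_def)
    show "AE x in lebesgue. norm ((cmod (of_real (\<eta> x) * f x))\<^sup>2) \<le> norm (B\<^sup>2 * (cmod (f x))\<^sup>2)"
    proof (rule AE_I2)
      fix x
      have "(\<eta> x)\<^sup>2 \<le> B\<^sup>2" by (rule abs_le_square_iff[THEN iffD1]) (use B[of x] in auto)
      then show "norm ((cmod (of_real (\<eta> x) * f x))\<^sup>2) \<le> norm (B\<^sup>2 * (cmod (f x))\<^sup>2)"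
        by (auto simp: norm_mult power_mult_distrib intro: mult_right_mono)
    qed
  qed measurable
  then show ?thesis by (auto simp: square_integrable_def)
qed

lemma rep_mult_AE:
  "bounded_measurable \<eta> \<Longrightarrow> AE x in lebesgue. rep_L2 (mult_L2 \<eta> f) x = of_real (\<eta> x) * rep_L2 f x"
  unfolding mult_L2_def by (intro rep_abs_AE square_integrable_mult square_integrable_rep)

lemma rep_modulus_AE: "AE x in lebesgue. rep_L2 (modulus_L2 f) x = of_real (cmod (rep_L2 f x))"
  unfolding modulus_L2_def
  by (intro rep_abs_AE) (auto simp: square_integrable_def integrable_cmod_rep_sq)

lemma L2_on_mult:
  assumes "bounded_measurable \<eta>" "f \<in> L2_on \<Omega>"
  shows "mult_L2 \<eta> f \<in> L2_on \<Omega>"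
  using assms(2) rep_mult_AE[OF assms(1), of f] unfolding L2_on_def mem_Collect_eq
  by eventually_elim auto

lemma L2_on_modulus:
  assumes "f \<in> L2_on \<Omega>"
  shows "modulus_L2 f \<in> L2_on \<Omega>"
  using assms rep_modulus_AE[of f] unfolding L2_on_def mem_Collect_eq
  by eventually_elim auto

lemma L2_on_add: "f \<in> L2_on \<Omega> \<Longrightarrow> g \<in> L2_on \<Omega> \<Longrightarrow> f + g \<in> L2_on \<Omega>"
  using rep_add_AE[of f g] unfolding L2_on_def mem_Collect_eq
  by (auto elim!: AE_mp)

lemma L2_on_scaleC: "f \<in> L2_on \<Omega> \<Longrightarrow> c *\<^sub>C f \<in> L2_on \<Omega>"
  using rep_scaleC_AE[of c f] unfolding L2_on_def mem_Collect_eq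
  by (auto elim!: AE_mp)

lemma L2_on_scaleR: "f \<in> L2_on \<Omega> \<Longrightarrow> r *\<^sub>R f \<in> L2_on \<Omega>"
  by (simp add: scaleR_scaleC_L2 L2_on_scaleC)

lemma L2_on_zero: "0 \<in> L2_on \<Omega>"
  using rep_zero_AE unfolding L2_on_def mem_Collect_eq by (auto elim!: AE_mp)

lemma L2_on_diff: "f \<in> L2_on \<Omega> \<Longrightarrow> g \<in> L2_on \<Omega> \<Longrightarrow> f - g \<in> L2_on \<Omega>"
  using L2_on_scaleC[of g \<Omega> "-1", folded uminus_L2_def] unfolding minus_L2_def[of f]
      by (intro L2_on_add)

lemma L2_on_sum: "(\<And>a. a \<in> A \<Longrightarrow> f a \<in> L2_on \<Omega>) \<Longrightarrow> sum f A \<in> L2_on \<Omega>"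
  by (induction A rule: infinite_finite_induct) (auto simp: L2_on_add L2_on_zero)

lemma bounded_linear_mult_L2:
  assumes "bounded_measurable \<eta>"
  shows "bounded_linear (mult_L2 \<eta>)"
proof -
  obtain B where B: "\<And>x. \<bar>\<eta> x\<bar> \<le> B" and [measurable]: "\<eta> \<in> borel_measurable lebesgue"
    using assms by (auto simp: bounded_measurable_def)
  have B0: "0 \<le> B" using B[of 0] by auto
  note m = rep_mult_AE[OF assms]
  show ?thesis
  proof (rule bounded_linear_intro[of _ B])
    fix f g :: "'a L2" and r :: real
    show "mult_L2 \<eta> (f + g) = mult_L2 \<eta> f + mult_L2 \<eta> g"
      by (rule L2_eqI) (use m[of f] m[of g] m[of "f + g"] rep_add_AE[of f g]
          rep_add_AE[of "mult_L2 \<eta> f" "mult_L2 \<eta> g"] in \<open>eventually_elim, simp add: ring_distribs\<close>)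
    show "mult_L2 \<eta> (r *\<^sub>R f) = r *\<^sub>R mult_L2 \<eta> f"
      by (rule L2_eqI) (use m[of f] m[of "r *\<^sub>R f"] rep_scaleR_AE[of r f]
          rep_scaleR_AE[of r "mult_L2 \<eta> f"] in \<open>eventually_elim, simp\<close>)
    have "(norm (mult_L2 \<eta> f))\<^sup>2 \<le> (LINT x|lebesgue. B\<^sup>2 * (cmod (rep_L2 f x))\<^sup>2)"
      unfolding norm_sq_eq
    proof (rule integral_mono_AE)
      show "AE x in lebesgue. (cmod (rep_L2 (mult_L2 \<eta> f) x))\<^sup>2 \<le> B\<^sup>2 * (cmod (rep_L2 f x))\<^sup>2"
        using m[of f]
      proof eventually_elim
        case (elim x)
        have "(\<eta> x)\<^sup>2 \<le> B\<^sup>2" by (rule abs_le_square_iff[THEN iffD1]) (use B[of x] in auto)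
        then show ?case by (auto simp: elim norm_mult power_mult_distrib intro: mult_right_mono)
      qed
    qed (auto simp: integrable_cmod_rep_sq)
    also have "\<dots> = (norm f * B)\<^sup>2"
      by (simp add: norm_sq_eq power_mult_distrib)
    finally show "norm (mult_L2 \<eta> f) \<le> norm f * B"
      by (rule power2_le_imp_le) (use B0 in simp)
  qed
qed

text \<open>This is the projection onto \<open>L2_on \<Omega>\<close>. Being a bounded operator on
  the whole space, it commutes with limits and integrals; closedness of the subspace follows, and
  later orbit integrals are kept inside it.\<close>

lemma mult_L2_indicator:
  assumes "\<Omega> \<in> sets lebesgue"
  shows "bounded_measurable (indicator \<Omega>)"
    and "mult_L2 (indicator \<Omega>) f \<in> L2_on \<Omega>"
    and "f \<in> L2_on \<Omega> \<Longrightarrow> mult_L2 (indicator \<Omega>) f = f"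
proof -
  show b: "bounded_measurable (indicator \<Omega>)"
    using assms by (auto simp: bounded_measurable_def indicator_def intro!: exI[of _ 1])
  show "mult_L2 (indicator \<Omega>) f \<in> L2_on \<Omega>"
    using rep_mult_AE[OF b, of f] unfolding L2_on_def mem_Collect_eq by eventually_elim auto
  assume "f \<in> L2_on \<Omega>"
  then have f: "AE x in lebesgue. x \<notin> \<Omega> \<longrightarrow> rep_L2 f x = 0" by (simp add: L2_on_def)
  show "mult_L2 (indicator \<Omega>) f = f"
    by (rule L2_eqI) (use rep_mult_AE[OF b, of f] f in \<open>eventually_elim, auto simp: indicator_def\<close>)
qed

lemma L2_on_closed:
  assumes "\<Omega> \<in> sets lebesgue" "\<And>n. X n \<in> L2_on \<Omega>" "(X \<longlongrightarrow> f) F" "F \<noteq> bot"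
  shows "f \<in> L2_on \<Omega>"
proof -
  have "((\<lambda>n. mult_L2 (indicator \<Omega>) (X n)) \<longlongrightarrow> mult_L2 (indicator \<Omega>) f) F"
    by (rule bounded_linear.tendsto[OF bounded_linear_mult_L2 assms(3)])
      (rule mult_L2_indicator(1)[OF assms(1)])
  then have "(X \<longlongrightarrow> mult_L2 (indicator \<Omega>) f) F"
    by (simp add: mult_L2_indicator(3)[OF assms(1) assms(2)])
  then have "f = mult_L2 (indicator \<Omega>) f"
    by (rule tendsto_unique[OF assms(4,3)])
  then show ?thesis using mult_L2_indicator(2)[OF assms(1), of f] by simp
qed

section \<open>The heat kernel\<close>

lemma borel_lebesgueI: "f \<in> borel_measurable borel \<Longrightarrow> f \<in> borel_measurable lebesgue"
  by (rule measurable_completion) simp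

lemma heat_kernel_nonneg: "0 \<le> heat_kernel t x"
  by (simp add: heat_kernel_def)

lemma heat_kernel_measurable [measurable]: "heat_kernel t \<in> borel_measurable borel"
  unfolding heat_kernel_def by measurable

lemma heat_kernel_minus [simp]: "heat_kernel t (- x) = heat_kernel t x"
  by (simp add: heat_kernel_def)

lemma heat_kernel_le:
  fixes x :: "'a::euclidean_space"
  assumes "0 < t"
  shows "heat_kernel t x \<le> (4 * pi * t) powr (- (real DIM('a) / 2))"
proof -
  have "exp (- (norm x)\<^sup>2 / (4 * t)) \<le> 1" using assms by simp
  then show ?thesis unfolding heat_kernel_def
    using mult_left_mono[of "exp (- (norm x)\<^sup>2 / (4 * t))" 1 "(4 * pi * t) powr (- (real DIM('a) / 2))"]
        by simp
qed

lemma norm_sq_Basis: "(norm x)\<^sup>2 = (\<Sum>b\<in>Basis. (x \<bullet> b)\<^sup>2)"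
  by (metis (no_types, lifting) euclidean_inner power2_eq_square power2_norm_eq_inner sum.cong)

text \<open>The kernel is the product over the coordinates of centred normal densities of variance
  \<open>2 * t\<close>, each of mass 1.\<close>

lemma nn_integral_heat_kernel:
  assumes t: "0 < t"
  shows "(\<integral>\<^sup>+ x. ennreal (heat_kernel t (x::'a::euclidean_space)) \<partial>lborel) = 1"
proof -
  define s where "s = sqrt (2 * t)"
  have s: "0 < s" "2 * s\<^sup>2 = 4 * t" using t by (auto simp: s_def)
  have eq: "ennreal (heat_kernel t x) = (\<Prod>b\<in>Basis. ennreal (normal_density 0 s (x \<bullet> b)))" for x :: 'a
  proof -
    have "(\<Prod>b\<in>(Basis::'a set). normal_density 0 s (x \<bullet> b))
        = (1 / sqrt (4 * pi * t)) ^ DIM('a) * exp (- (norm x)\<^sup>2 / (4 * t))"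
      unfolding normal_density_def prod.distrib
      by (simp add: s(2) sum_negf norm_sq_Basis flip: exp_sum sum_divide_distrib)
        (use s in \<open>simp add: power2_eq_square mult.assoc\<close>)
    also have "(1 / sqrt (4 * pi * t)) ^ DIM('a) = (4 * pi * t) powr (- (real DIM('a) / 2))"
    proof -
      define c where "c = 4 * pi * t"
      have c: "0 < c" using t by (simp add: c_def)
      have "1 / sqrt c = c powr (- (1 / 2))"
        using c powr_half_sqrt[of c] by (simp only: powr_minus_divide)
      then have "(1 / sqrt c) ^ DIM('a) = (c powr (- (1 / 2))) powr real DIM('a)"
        using c by (subst powr_realpow) auto
      also have "\<dots> = c powr (- (real DIM('a) / 2))"
        by (simp only: powr_powr) simp
      finally show ?thesis by (simp only: c_def)
    qed
    finally have "heat_kernel t x = (\<Prod>b\<in>Basis. normal_density 0 s (x \<bullet> b))"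
      unfolding heat_kernel_def by simp
    then show ?thesis
      by (simp only: prod_ennreal normal_density_nonneg)
  qed
  show ?thesis unfolding eq
    by (subst nn_integral_lborel_prod) (use s in \<open>auto simp: nn_integral_eq_integral\<close>)
qed

lemma nn_integral_lebesgue_shift:
  fixes f :: "'a::euclidean_space \<Rightarrow> ennreal"
  assumes [measurable]: "f \<in> borel_measurable borel"
  shows "(\<integral>\<^sup>+ x. f (c + x) \<partial>lebesgue) = (\<integral>\<^sup>+ x. f x \<partial>lebesgue)"
proof -
  have "(\<integral>\<^sup>+ x. f x \<partial>lborel) = (\<integral>\<^sup>+ x. f x \<partial>distr lborel borel ((+) c))"
    by (simp add: lborel_distr_plus)
  also have "\<dots> = (\<integral>\<^sup>+ x. f (c + x) \<partial>lborel)"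
    by (subst nn_integral_distr) auto
  finally show ?thesis by (simp add: nn_integral_completion)
qed

lemma nn_integral_lebesgue_reflect:
  fixes f :: "'a::euclidean_space \<Rightarrow> ennreal"
  assumes [measurable]: "f \<in> borel_measurable borel"
  shows "(\<integral>\<^sup>+ x. f (c - x) \<partial>lebesgue) = (\<integral>\<^sup>+ x. f x \<partial>lebesgue)"
proof -
  have "lborel = distr lborel borel (\<lambda>x::'a. c + (-1) *\<^sub>R x)"
    by (subst lborel_affine[of "-1" c]) (auto simp: density_1)
  then have "(\<integral>\<^sup>+ x. f x \<partial>lborel) = (\<integral>\<^sup>+ x. f x \<partial>distr lborel borel (\<lambda>x. c + (-1) *\<^sub>R x))"
    by simp
  also have "\<dots> = (\<integral>\<^sup>+ x. f (c - x) \<partial>lborel)"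
    by (subst nn_integral_distr) auto
  finally show ?thesis by (simp add: nn_integral_completion)
qed

text \<open>Completing the square: the exponential factor moves the Gaussian by \<open>2 * t\<close>
  times \<open>g\<close> and leaves the constant on the right. The moments needed later are bounded
  through this Laplace transform.\<close>

lemma nn_integral_heat_kernel_exp:
  fixes g :: "'a::euclidean_space"
  assumes t: "0 < t"
  shows "(\<integral>\<^sup>+ z. ennreal (heat_kernel t z * exp (g \<bullet> z)) \<partial>lebesgue) = ennreal (exp (t * (norm g)\<^sup>2))"
proof -
  have eq: "heat_kernel t z * exp (g \<bullet> z)
      = exp (t * (norm g)\<^sup>2) * heat_kernel t (- (2 * t) *\<^sub>R g + z)" for z
  proof -
    have n: "(norm (- (2 * t) *\<^sub>R g + z))\<^sup>2 = 4 * t\<^sup>2 * (norm g)\<^sup>2 - 4 * t * (g \<bullet> z) + (norm z)\<^sup>2"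
      unfolding power2_norm_eq_inner
      by (simp add: inner_add_left inner_add_right inner_commute power2_eq_square algebra_simps)
    have "- (norm z)\<^sup>2 / (4 * t) + g \<bullet> z
        = t * (norm g)\<^sup>2 + - (norm (- (2 * t) *\<^sub>R g + z))\<^sup>2 / (4 * t)"
      unfolding n using t by (simp add: field_simps power2_eq_square)
    then show ?thesis unfolding heat_kernel_def
      by (simp add: exp_add[symmetric] del: of_real_add)
  qed
  have "(\<integral>\<^sup>+ z. ennreal (heat_kernel t z * exp (g \<bullet> z)) \<partial>lebesgue)
      = ennreal (exp (t * (norm g)\<^sup>2)) * (\<integral>\<^sup>+ z. ennreal (heat_kernel t (- (2 * t) *\<^sub>R g
          + z)) \<partial>lebesgue)"
    unfolding eq nn_integral_completion by (subst nn_integral_cmult[symmetric]) (auto simp: ennreal_mult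
        heat_kernel_nonneg)
  also have "(\<integral>\<^sup>+ z. ennreal (heat_kernel t (- (2 * t) *\<^sub>R g + z)) \<partial>lebesgue)
      = (\<integral>\<^sup>+ z. ennreal (heat_kernel t z) \<partial>(lebesgue::'a measure))"
    by (rule nn_integral_lebesgue_shift) measurable
  also have "\<dots> = 1"
    using nn_integral_heat_kernel[OF t, where 'a='a] by (simp add: nn_integral_completion)
  finally show ?thesis by simp
qed

lemma nn_integral_heat_kernel_lebesgue:
  "0 < t \<Longrightarrow> (\<integral>\<^sup>+ z. ennreal (heat_kernel t z) \<partial>(lebesgue::'a::euclidean_space measure)) = 1"
  using nn_integral_heat_kernel_exp[of t "0::'a"] by simp

text \<open>Two monotonicity arguments starting at 0, then evenness. Doubled, it reads
  \<open>2 + x\<^sup>2 \<le> exp x + exp (- x)\<close> and bounds second moments by Laplace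
  transforms.\<close>

lemma cosh_sub_1_ge: "x\<^sup>2 / 2 \<le> cosh x - (1::real)"
proof -
  have sinh_ge: "y \<le> sinh y" if "0 \<le> y" for y :: real
  proof -
    have "(\<lambda>y. sinh y - y) 0 \<le> (\<lambda>y. sinh y - y) y"
      by (rule DERIV_nonneg_imp_nondecreasing[OF that])
        (auto intro!: exI derivative_eq_intros simp: cosh_real_ge_1)
    then show ?thesis by simp
  qed
  have pos: "y\<^sup>2 / 2 \<le> cosh y - 1" if "0 \<le> y" for y :: real
  proof -
    have "(\<lambda>y. cosh y - 1 - y\<^sup>2 / 2) 0 \<le> (\<lambda>y. cosh y - 1 - y\<^sup>2 / 2) y"
      by (rule DERIV_nonneg_imp_nondecreasing[OF that])
        (auto intro!: exI derivative_eq_intros simp: sinh_ge)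
    then show ?thesis by simp
  qed
  show ?thesis
    using pos[of "\<bar>x\<bar>"] by (cases "0 \<le> x") auto
qed

text \<open>One term of the exponential series, with 24 = 4!; the second exponential covers negative
  arguments.\<close>

lemma exp_ge_pow4: "x ^ 4 \<le> 24 * (exp x + exp (- x))" for x :: real
proof -
  have *: "y ^ 4 \<le> 24 * exp y" if "0 \<le> y" for y :: real
  proof -
    have "(\<Sum>k\<in>{4}. inverse (fact k) * y ^ k) \<le> (\<Sum>k. inverse (fact k) * y ^ k)"
      using that summable_exp[of y] by (intro sum_le_suminf) auto
    also have "\<dots> = exp y"
      by (simp add: exp_def divide_inverse scaleR_conv_of_real)
    finally show ?thesis by (simp add: fact_numeral field_simps)
  qed
  show ?thesis
  proof (cases "0 \<le> x")
    case True
    then show ?thesis using *[of x] exp_ge_zero[of "- x"] by (simp add: algebra_simps add_increasing2)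
  next
    case False
    then show ?thesis using *[of "- x"] exp_ge_zero[of x] by (simp add: algebra_simps add_increasing)
  qed
qed

text \<open>The exact value is \<open>2 * t * (norm g)\<^sup>2\<close>, and the bound agrees with it
  to first order in \<open>t\<close>. This sharp leading term is what fixes the constant of the
  gradient term in the localisation formula.\<close>

lemma nn_integral_heat_kernel_inner_sq:
  fixes g :: "'a::euclidean_space"
  assumes t: "0 < t"
  shows "(\<integral>\<^sup>+ z. ennreal (heat_kernel t z * (g \<bullet> z)\<^sup>2) \<partial>lebesgue)
      \<le> ennreal (2 * (exp (t * (norm g)\<^sup>2) - 1))"
proof -
  let ?I = "\<integral>\<^sup>+ z. ennreal (heat_kernel t z * (g \<bullet> z)\<^sup>2) \<partial>lebesgue"
  \<comment> \<open>The mass 1 of the kernel is added twice on the left, so that no subtraction of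
    extended reals occurs.\<close>
  have "2 + ?I = (\<integral>\<^sup>+ z. ennreal (2 * heat_kernel t z + heat_kernel t z * (g \<bullet> z)\<^sup>2) \<partial>lebesgue)"
    using nn_integral_heat_kernel_lebesgue[OF t, where 'a='a]
    unfolding nn_integral_completion
    by (simp add: nn_integral_add nn_integral_cmult ennreal_mult heat_kernel_nonneg)
  also have "\<dots> \<le> (\<integral>\<^sup>+ z. ennreal (heat_kernel t z * exp (g \<bullet> z)
      + heat_kernel t z * exp ((- g) \<bullet> z)) \<partial>lebesgue)"
  proof (intro nn_integral_mono ennreal_leI)
    fix z :: 'a
    have "2 + (g \<bullet> z)\<^sup>2 \<le> exp (g \<bullet> z) + exp (- (g \<bullet> z))"
      using cosh_sub_1_ge[of "g \<bullet> z"] by (simp add: cosh_def field_simps)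
    from mult_left_mono[OF this heat_kernel_nonneg[of t z]]
    show "2 * heat_kernel t z + heat_kernel t z * (g \<bullet> z)\<^sup>2
        \<le> heat_kernel t z * exp (g \<bullet> z) + heat_kernel t z * exp ((- g) \<bullet> z)"
      by (simp add: algebra_simps)
  qed
  also have "\<dots> = (\<integral>\<^sup>+ z. ennreal (heat_kernel t z * exp (g \<bullet> z))
      + ennreal (heat_kernel t z * exp ((- g) \<bullet> z)) \<partial>lebesgue)"
    by (intro nn_integral_cong ennreal_plus mult_nonneg_nonneg heat_kernel_nonneg exp_ge_zero)
  also have "\<dots> = ennreal (exp (t * (norm g)\<^sup>2)) + ennreal (exp (t * (norm (- g))\<^sup>2))"
    unfolding nn_integral_heat_kernel_exp[OF t, symmetric]
    by (intro nn_integral_add borel_lebesgueI) measurable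
  also have "\<dots> = ennreal (2 * exp (t * (norm g)\<^sup>2))"
    by (simp flip: ennreal_plus)
  finally have "2 + ?I \<le> 2 + ennreal (2 * (exp (t * (norm g)\<^sup>2) - 1))"
    using t by (subst ennreal_numeral[symmetric], subst ennreal_plus[symmetric]) auto
  then show ?thesis by (simp add: ennreal_add_left_cancel_le)
qed

text \<open>Only the order \<open>t\<^sup>2\<close> matters. Cauchy-Schwarz reduces the norm to
  fourth powers of coordinates, and \<open>exp_ge_pow4\<close> at the scale
  \<open>1 / sqrt t\<close> reduces these to Laplace transforms that all equal e; 144 is 24 times
  the bound 6 for 2e.\<close>

lemma nn_integral_heat_kernel_norm_pow4:
  assumes t: "0 < t"
  shows "(\<integral>\<^sup>+ z. ennreal (heat_kernel t z * (norm (z::'a::euclidean_space)) ^ 4) \<partial>lebesgue)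
    \<le> ennreal (144 * real DIM('a) ^ 3 * t\<^sup>2)"
proof -
  let ?s = "1 / sqrt t"
  have s4: "?s ^ 4 = 1 / t\<^sup>2" and s2: "t * ?s\<^sup>2 = 1"
  proof -
    have "?s ^ 4 = (?s ^ 2) ^ 2" by simp
    also have "?s ^ 2 = 1 / t" using t by (simp add: power_divide)
    finally show "?s ^ 4 = 1 / t\<^sup>2" by (simp add: power_divide)
    show "t * ?s\<^sup>2 = 1" using t by (simp add: power_divide)
  qed
  have pt: "(norm z) ^ 4 \<le> (\<Sum>b\<in>Basis. 24 * real DIM('a) * t\<^sup>2 * (exp ((?s *\<^sub>R b) \<bullet> z)
      + exp ((- ?s *\<^sub>R b) \<bullet> z)))" for z :: 'a
  proof -
    have "(norm z) ^ 4 = ((norm z)\<^sup>2)\<^sup>2" by simp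
    also have "\<dots> = (\<Sum>b\<in>Basis. (z \<bullet> b)\<^sup>2)\<^sup>2"
      by (simp only: norm_sq_Basis)
    also have "\<dots> \<le> real DIM('a) * (\<Sum>b\<in>Basis. ((z \<bullet> b)\<^sup>2)\<^sup>2)"
      using sum_squared_le_sum_of_squares[of "\<lambda>b. (z \<bullet> b)\<^sup>2" Basis] by (simp add: mult.commute)
    also have "\<dots> \<le> real DIM('a) * (\<Sum>b\<in>Basis. 24 * t\<^sup>2 * (exp ((?s *\<^sub>R b) \<bullet> z)
        + exp ((- ?s *\<^sub>R b) \<bullet> z)))"
    proof (intro mult_left_mono sum_mono)
      fix b :: 'a assume "b \<in> Basis"
      have "(?s * (b \<bullet> z)) ^ 4 \<le> 24 * (exp (?s * (b \<bullet> z)) + exp (- (?s * (b \<bullet> z))))"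
        by (rule exp_ge_pow4)
      then have "(b \<bullet> z) ^ 4 \<le> t\<^sup>2 * (24 * (exp (?s * (b \<bullet> z)) + exp (- (?s * (b \<bullet> z)))))"
        using t unfolding power_mult_distrib s4 by (simp add: field_simps)
      then show "((z \<bullet> b)\<^sup>2)\<^sup>2 \<le> 24 * t\<^sup>2 * (exp ((?s *\<^sub>R b) \<bullet> z) + exp ((- ?s *\<^sub>R b) \<bullet> z))"
        by (simp add: inner_commute mult_ac)
    qed auto
    finally show ?thesis by (simp add: sum_distrib_left mult_ac)
  qed
  let ?c = "24 * real DIM('a) * t\<^sup>2"
  have "(\<integral>\<^sup>+ z. ennreal (heat_kernel t z * (norm (z::'a)) ^ 4) \<partial>lebesgue)
    \<le> (\<integral>\<^sup>+ z. (\<Sum>b\<in>(Basis::'a set). ennreal ?c * (ennreal (heat_kernel t z * exp ((?s *\<^sub>R b) \<bullet> z))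
        + ennreal (heat_kernel t z * exp ((- ?s *\<^sub>R b) \<bullet> z)))) \<partial>lebesgue)"
  proof (intro nn_integral_mono)
    fix z :: 'a
    have "heat_kernel t z * (norm z) ^ 4 \<le> heat_kernel t z * (\<Sum>b\<in>Basis. ?c * (exp ((?s *\<^sub>R b) \<bullet> z)
        + exp ((- ?s *\<^sub>R b) \<bullet> z)))"
      by (intro mult_left_mono pt heat_kernel_nonneg)
    also have "\<dots> = (\<Sum>b\<in>Basis. ?c * (heat_kernel t z * exp ((?s *\<^sub>R b) \<bullet> z)
        + heat_kernel t z * exp ((- ?s *\<^sub>R b) \<bullet> z)))"
      by (simp add: sum_distrib_left algebra_simps)
    finally show "ennreal (heat_kernel t z * (norm z) ^ 4)
        \<le> (\<Sum>b\<in>Basis. ennreal ?c * (ennreal (heat_kernel t z * exp ((?s *\<^sub>R b) \<bullet> z))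
        + ennreal (heat_kernel t z * exp ((- ?s *\<^sub>R b) \<bullet> z))))"
      by (subst (asm) ennreal_le_iff[symmetric])
        (auto simp: sum_nonneg ennreal_mult ennreal_plus heat_kernel_nonneg simp flip: sum_ennreal)
  qed
  also have "\<dots> = (\<Sum>b\<in>Basis. ennreal ?c * ((\<integral>\<^sup>+ z. ennreal (heat_kernel t z * exp ((?s *\<^sub>R (b::'a)) \<bullet> z))
      \<partial>lebesgue)
      + (\<integral>\<^sup>+ z. ennreal (heat_kernel t z * exp ((- ?s *\<^sub>R b) \<bullet> z)) \<partial>lebesgue)))"
    unfolding nn_integral_completion
    by (subst nn_integral_sum, measurable, subst nn_integral_cmult, measurable, subst nn_integral_add)
        simp_all
  also have "\<dots> = (\<Sum>b\<in>Basis. ennreal ?c * (ennreal (exp (t * (norm (?s *\<^sub>R (b::'a)))\<^sup>2))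
      + ennreal (exp (t * (norm (- ?s *\<^sub>R b))\<^sup>2))))"
    unfolding nn_integral_heat_kernel_exp[OF t] ..
  also have "\<dots> = (\<Sum>b\<in>(Basis::'a set). ennreal (?c * (exp 1 + exp 1)))"
  proof (rule sum.cong)
    fix b :: 'a assume b: "b \<in> Basis"
    have e: "t * (norm (?s *\<^sub>R b))\<^sup>2 = 1" "t * (norm (- ?s *\<^sub>R b))\<^sup>2 = 1"
      using b s2 t by auto
    show "ennreal ?c * (ennreal (exp (t * (norm (?s *\<^sub>R (b::'a)))\<^sup>2))
        + ennreal (exp (t * (norm (- ?s *\<^sub>R b))\<^sup>2)))
      = ennreal (?c * (exp 1 + exp 1))"
      unfolding e by (subst ennreal_plus[symmetric], simp, simp, subst ennreal_mult[symmetric]) auto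
  qed simp
  also have "\<dots> = ennreal (real DIM('a) * (?c * (exp 1 + exp 1)))"
    by (subst sum_ennreal) auto
  also have "\<dots> \<le> ennreal (144 * real DIM('a) ^ 3 * t\<^sup>2)"
  proof (rule ennreal_leI)
    have "real DIM('a) * (?c * (exp 1 + exp 1)) \<le> real DIM('a) * (?c * 6)"
      using exp_le by (intro mult_left_mono) auto
    also have "\<dots> = 144 * real DIM('a) ^ 2 * t\<^sup>2" by (simp add: power2_eq_square)
    also have "\<dots> \<le> 144 * real DIM('a) ^ 3 * t\<^sup>2"
      by (intro mult_right_mono mult_left_mono power_increasing) (auto simp: DIM_positive Suc_leI)
    finally show "real DIM('a) * (?c * (exp 1 + exp 1)) \<le> 144 * real DIM('a) ^ 3 * t\<^sup>2" .
  qed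
  finally show ?thesis .
qed

section \<open>Semigroups dominated by the heat semigroup\<close>

interpretation lebesgue_sf: sigma_finite_measure "lebesgue :: 'a::euclidean_space measure"
proof
  obtain A :: "nat \<Rightarrow> 'a set" where A: "range A \<subseteq> sets lborel" "(\<Union>i. A i) = space lborel"
    "\<And>i. emeasure lborel (A i) \<noteq> \<infinity>"
    using lborel.sigma_finite by blast
  then show "\<exists>A. countable A \<and> A \<subseteq> sets (lebesgue :: 'a measure) \<and> \<Union> A = space lebesgue \<and>
      (\<forall>a\<in>A. emeasure lebesgue a \<noteq> \<infinity>)"
    by (intro exI[of _ "range A"]) (auto intro!: sets_completionI_sets)
qed

interpretation lebesgue_pair: pair_sigma_finite "lebesgue :: 'a::euclidean_space measure" "lebesgue ::
    'a measure" ..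

lemma measurable_fst_lebesgue_borel [measurable]: "fst \<in> lebesgue \<Otimes>\<^sub>M lebesgue \<rightarrow>\<^sub>M borel"
  by (rule measurable_compose[OF measurable_fst]) (rule borel_lebesgueI, simp)

lemma measurable_snd_lebesgue_borel [measurable]: "snd \<in> lebesgue \<Otimes>\<^sub>M lebesgue \<rightarrow>\<^sub>M borel"
  by (rule measurable_compose[OF measurable_snd]) (rule borel_lebesgueI, simp)

lemma measurable_lebesgue_pair_diff:
  fixes m :: "'a::euclidean_space \<Rightarrow> 'b::topological_space"
  assumes [measurable]: "m \<in> borel_measurable borel"
  shows "(\<lambda>p. m (fst p - snd p)) \<in> borel_measurable (lebesgue \<Otimes>\<^sub>M lebesgue)"
  by measurable

lemma measurable_lebesgue_diff:
  fixes m :: "'a::euclidean_space \<Rightarrow> 'b::topological_space"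
  assumes [measurable]: "m \<in> borel_measurable borel"
  shows "(\<lambda>y. m (x - y)) \<in> borel_measurable lebesgue" "(\<lambda>y. m (y - x)) \<in> borel_measurable lebesgue"
  by (auto intro!: borel_lebesgueI)

text \<open>A Schur test in additive form: 2ab <= a^2 + b^2 under the kernel \<open>w\<close>, then
  Tonelli in the first term. It is used with the heat kernel (contractivity), with the kernel times
  a squared increment (localisation), and with the kernel times the fourth power of the distance
  (separated cells).\<close>

lemma nn_integral_weighted_product_le:
  fixes f g :: "'a::euclidean_space \<Rightarrow> real" and w :: "'a \<Rightarrow> 'a \<Rightarrow> ennreal"
  assumes [measurable]: "f \<in> borel_measurable lebesgue" "g \<in> borel_measurable lebesgue"
    and w: "(\<lambda>p. w (fst p) (snd p)) \<in> borel_measurable (lebesgue \<Otimes>\<^sub>M lebesgue)"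
  shows "2 * (\<integral>\<^sup>+x. \<integral>\<^sup>+y. w x y * ennreal (f y * g x) \<partial>lebesgue \<partial>lebesgue)
    \<le> (\<integral>\<^sup>+y. ennreal ((f y)\<^sup>2) * (\<integral>\<^sup>+x. w x y \<partial>lebesgue) \<partial>lebesgue)
      + (\<integral>\<^sup>+x. ennreal ((g x)\<^sup>2) * (\<integral>\<^sup>+y. w x y \<partial>lebesgue) \<partial>lebesgue)"
proof -
  have w1 [measurable]: "(\<lambda>(x, y). w x y) \<in> borel_measurable (lebesgue \<Otimes>\<^sub>M lebesgue)"
    using w by (simp add: case_prod_beta')
  have [measurable]: "w x \<in> borel_measurable lebesgue" for x
    using measurable_Pair2[OF w, of x] by simp
  have [measurable]: "(\<lambda>x. w x y) \<in> borel_measurable lebesgue" for y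
    using measurable_Pair1[OF w, of y] by simp
  have "2 * (\<integral>\<^sup>+x. \<integral>\<^sup>+y. w x y * ennreal (f y * g x) \<partial>lebesgue \<partial>lebesgue)
      = (\<integral>\<^sup>+x. \<integral>\<^sup>+y. 2 * (w x y * ennreal (f y * g x)) \<partial>lebesgue \<partial>lebesgue)"
    by (simp add: nn_integral_cmult)
  also have "\<dots> \<le> (\<integral>\<^sup>+x. \<integral>\<^sup>+y. w x y * ennreal ((f y)\<^sup>2)
      + w x y * ennreal ((g x)\<^sup>2) \<partial>lebesgue \<partial>lebesgue)"
  proof (intro nn_integral_mono)
    fix x y
    have "2 * ennreal (f y * g x) = ennreal (2 * (f y * g x))"
      by (simp add: ennreal_mult')
    also have "\<dots> \<le> ennreal ((f y)\<^sup>2 + (g x)\<^sup>2)"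
      using sum_squares_bound[of "f y" "g x"] by (intro ennreal_leI) simp
    also have "\<dots> = ennreal ((f y)\<^sup>2) + ennreal ((g x)\<^sup>2)"
      by (simp add: ennreal_plus)
    finally have "w x y * (2 * ennreal (f y * g x)) \<le> w x y * (ennreal ((f y)\<^sup>2) + ennreal ((g x)\<^sup>2))"
      by (rule mult_left_mono) simp
    then show "2 * (w x y * ennreal (f y * g x)) \<le> w x y * ennreal ((f y)\<^sup>2)
        + w x y * ennreal ((g x)\<^sup>2)"
      by (simp add: distrib_left mult.left_commute)
  qed
  also have "\<dots> = (\<integral>\<^sup>+x. \<integral>\<^sup>+y. w x y * ennreal ((f y)\<^sup>2) \<partial>lebesgue \<partial>lebesgue)
      + (\<integral>\<^sup>+x. \<integral>\<^sup>+y. w x y * ennreal ((g x)\<^sup>2) \<partial>lebesgue \<partial>lebesgue)"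
    by (simp add: nn_integral_add)
  also have "(\<integral>\<^sup>+x. \<integral>\<^sup>+y. w x y * ennreal ((f y)\<^sup>2) \<partial>lebesgue \<partial>lebesgue)
      = (\<integral>\<^sup>+y. \<integral>\<^sup>+x. w x y * ennreal ((f y)\<^sup>2) \<partial>lebesgue \<partial>lebesgue)"
    by (rule lebesgue_pair.Fubini'[symmetric]) measurable
  finally show ?thesis
    by (simp add: nn_integral_multc mult.commute)
qed

lemma ennreal_norm_integral_le:
  "ennreal (norm (integral\<^sup>L M f)) \<le> (\<integral>\<^sup>+x. ennreal (norm (f x)) \<partial>M)"
  by (cases "integrable M f") (auto simp: integral_norm_bound_ennreal not_integrable_integral_eq)

lemma complex_le_iff: "(a::complex) \<le> b \<longleftrightarrow> Re a \<le> Re b \<and> Im a = Im b"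
  by (simp add: less_eq_complex_def)

lemma L2_nonneg_iff: "0 \<le> f \<longleftrightarrow> (AE x in lebesgue. 0 \<le> rep_L2 f x)"
proof -
  have "(0 \<le> f) = (AE x in lebesgue. rep_L2 0 x \<le> rep_L2 f x)"
    by (simp add: less_eq_L2.rep_eq)
  also have "\<dots> = (AE x in lebesgue. 0 \<le> rep_L2 f x)"
    using rep_zero_AE by (intro eventually_subst) (auto elim!: AE_mp)
  finally show ?thesis .
qed

text \<open>The decisive factor is \<open>cnj a\<close>, and by continuity a dense set of factors is
  as good. A countable one allows inequalities that hold almost everywhere for each single
  \<open>c\<close> to be combined.\<close>

lemma cmod_le_if_dense:
  assumes "\<And>X::complex set. open X \<Longrightarrow> X \<noteq> {} \<Longrightarrow> \<exists>d\<in>D. d \<in> X"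
    and le: "\<And>c. c \<in> D \<Longrightarrow> Re (c * a) \<le> cmod c * b" and b: "0 \<le> b"
  shows "cmod a \<le> b"
proof -
  have "closed {c. Re (c * a) \<le> cmod c * b}"
    by (intro closed_Collect_le continuous_intros)
  then have "open (- {c. Re (c * a) \<le> cmod c * b})" by auto
  then have "- {c. Re (c * a) \<le> cmod c * b} = {}"
    using assms(1)[of "- {c. Re (c * a) \<le> cmod c * b}"] le by auto
  then have "Re (cnj a * a) \<le> cmod (cnj a) * b" by blast
  then have "cmod a * cmod a \<le> cmod a * b"
    by (simp add: cmod_def power2_eq_square)
  then show ?thesis using b by (cases "cmod a = 0") auto
qed

locale dominated_semigroup =
  fixes \<Omega> :: "'a::euclidean_space set" and T :: "real \<Rightarrow> 'a L2 \<Rightarrow> 'a L2"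
  assumes Omega [measurable]: "\<Omega> \<in> sets lebesgue"
    and C0: "C0_semigroup_on (L2_on \<Omega>) T"
    and selfadjoint: "selfadjoint_semigroup_on (L2_on \<Omega>) T"
    and dominated: "dominated_by_heat_semigroup_on (L2_on \<Omega>) T"
begin

abbreviation V :: "'a L2 set" where "V \<equiv> L2_on \<Omega>"

lemma T_in: "0 \<le> t \<Longrightarrow> f \<in> V \<Longrightarrow> T t f \<in> V"
  and T_add: "0 \<le> t \<Longrightarrow> f \<in> V \<Longrightarrow> g \<in> V \<Longrightarrow> T t (f + g) = T t f + T t g"
  and T_scaleC: "0 \<le> t \<Longrightarrow> f \<in> V \<Longrightarrow> T t (c *\<^sub>C f) = c *\<^sub>C T t f"
  and T_0: "f \<in> V \<Longrightarrow> T 0 f = f"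
  and T_T: "0 \<le> s \<Longrightarrow> 0 \<le> t \<Longrightarrow> f \<in> V \<Longrightarrow> T s (T t f) = T (s + t) f"
  and T_tendsto: "f \<in> V \<Longrightarrow> ((\<lambda>t. T t f) \<longlongrightarrow> f) (at_right 0)"
  using C0 by (auto simp: C0_semigroup_on_def bounded_operator_on_def)

lemma T_diff: "0 \<le> t \<Longrightarrow> f \<in> V \<Longrightarrow> g \<in> V \<Longrightarrow> T t (f - g) = T t f - T t g"
  using T_add[of t f "(-1) *\<^sub>C g"] T_scaleC[of t g "-1"] L2_on_scaleC[of g \<Omega> "-1"]
  unfolding minus_L2_def[of f] minus_L2_def[of "T t f"] uminus_L2_def by metis

lemma T_scaleR: "0 \<le> t \<Longrightarrow> f \<in> V \<Longrightarrow> T t (r *\<^sub>R f) = r *\<^sub>R T t f"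
  by (simp add: scaleR_scaleC_L2 T_scaleC)

lemma T_zero [simp]: "0 \<le> t \<Longrightarrow> T t 0 = 0"
  using T_scaleR[of t 0 0] by (simp add: L2_on_zero)

lemma T_sum: "0 \<le> t \<Longrightarrow> (\<And>a. a \<in> A \<Longrightarrow> f a \<in> V) \<Longrightarrow> T t (sum f A) = (\<Sum>a\<in>A. T t (f a))"
  by (induction A rule: infinite_finite_induct) (auto simp: T_add L2_on_sum)

lemma T_selfadjoint: "0 \<le> t \<Longrightarrow> f \<in> V \<Longrightarrow> g \<in> V \<Longrightarrow> cinner (T t f) g = cinner f (T t g)"
  using selfadjoint by (auto simp: selfadjoint_semigroup_on_def)

lemma T_nonneg: "0 \<le> t \<Longrightarrow> f \<in> V \<Longrightarrow> 0 \<le> f \<Longrightarrow> 0 \<le> T t f"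
  and T_le_heat: "0 \<le> t \<Longrightarrow> f \<in> V \<Longrightarrow> 0 \<le> f \<Longrightarrow> AE x in lebesgue. rep_L2 (T t f) x
      \<le> heat_semigroup t (rep_L2 f) x"
  using dominated by (auto simp: dominated_by_heat_semigroup_on_def)

text \<open>Positivity is applied to \<open>h - u\<close>. The images of \<open>h\<close> and of
  \<open>h - u\<close> are nonnegative, in particular real, which settles the imaginary
  part.\<close>

lemma T_real_bound:
  assumes t: "0 \<le> t" and V: "u \<in> V" "h \<in> V" and h: "0 \<le> h"
    and u: "AE x in lebesgue. Im (rep_L2 u x) = 0 \<and> \<bar>Re (rep_L2 u x)\<bar> \<le> Re (rep_L2 h x)"
  shows "AE x in lebesgue. Im (rep_L2 (T t u) x) = 0 \<and> Re (rep_L2 (T t u) x) \<le> Re (rep_L2 (T t h) x)"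
proof -
  have "0 \<le> h - u"
    using h u rep_diff_AE[of h u] unfolding L2_nonneg_iff
    by eventually_elim (auto simp: complex_le_iff)
  then have "0 \<le> T t h - T t u"
    using T_nonneg[of t "h - u"] t V by (simp add: T_diff L2_on_diff)
  moreover have "0 \<le> T t h" using T_nonneg t V h by simp
  ultimately show ?thesis
    using rep_diff_AE[of "T t h" "T t u"] unfolding L2_nonneg_iff
    by eventually_elim (auto simp: complex_le_iff)
qed

text \<open>For a fixed \<open>c\<close> the real part of \<open>c\<close> times \<open>f\<close> is
  a real function bounded by \<open>cmod c\<close> times the modulus of \<open>f\<close>, so the
  positivity argument for real functions applies; \<open>cmod_le_if_dense\<close> then removes
  \<open>c\<close>.\<close>

lemma cmod_T_le_modulus:
  assumes t: "0 \<le> t" and f: "f \<in> V"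
  shows "AE x in lebesgue. cmod (rep_L2 (T t f) x) \<le> Re (rep_L2 (T t (modulus_L2 f)) x)"
proof -
  define g where "g = modulus_L2 f"
  have g: "g \<in> V" using f by (simp add: g_def L2_on_modulus)
  have g0: "0 \<le> g" unfolding L2_nonneg_iff g_def
    using rep_modulus_AE[of f] by eventually_elim (simp add: complex_le_iff)
  obtain D :: "complex set" where D: "countable D" "\<And>X. open X \<Longrightarrow> X \<noteq> {} \<Longrightarrow> \<exists>d\<in>D. d \<in> X"
    using countable_dense_exists by blast
  have c: "AE x in lebesgue. Re (c * rep_L2 (T t f) x) \<le> cmod c * Re (rep_L2 (T t g) x)" for c
  proof -
    define r where "r = abs_L2 (\<lambda>x. of_real (Re (c * rep_L2 f x)))"
    define s where "s = abs_L2 (\<lambda>x. of_real (Im (c * rep_L2 f x)))"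
    define h where "h = of_real (cmod c) *\<^sub>C g"
    have sq: "square_integrable (\<lambda>x. complex_of_real (p (c * rep_L2 f x)))"
      if [measurable]: "p \<in> borel_measurable borel" and p: "\<And>z. \<bar>p z\<bar> \<le> cmod z" for p
      unfolding square_integrable_def
    proof
      show "integrable lebesgue (\<lambda>x. (cmod (complex_of_real (p (c * rep_L2 f x))))\<^sup>2)"
      proof (rule Bochner_Integration.integrable_bound)
        show "integrable lebesgue (\<lambda>x. (cmod (c * rep_L2 f x))\<^sup>2)"
          using square_integrable_cmult[OF square_integrable_rep[of f], of c]
          by (simp add: square_integrable_def)
        show "AE x in lebesgue. norm ((cmod (complex_of_real (p (c * rep_L2 f x))))\<^sup>2)
            \<le> norm ((cmod (c * rep_L2 f x))\<^sup>2)"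
        proof (rule AE_I2)
          fix x
          have "\<bar>p (c * rep_L2 f x)\<bar>\<^sup>2 \<le> (cmod (c * rep_L2 f x))\<^sup>2"
            by (intro power_mono p) simp
          then show "norm ((cmod (complex_of_real (p (c * rep_L2 f x))))\<^sup>2)
              \<le> norm ((cmod (c * rep_L2 f x))\<^sup>2)"
            by (simp only: real_norm_def norm_of_real abs_power2 power2_abs)
        qed
      qed measurable
    qed measurable
    have rep_r: "AE x in lebesgue. rep_L2 r x = of_real (Re (c * rep_L2 f x))"
      unfolding r_def by (intro rep_abs_AE sq) (auto simp: abs_Re_le_cmod simp del: times_complex.sel)
    have rep_s: "AE x in lebesgue. rep_L2 s x = of_real (Im (c * rep_L2 f x))"
      unfolding s_def by (intro rep_abs_AE sq) (auto simp: abs_Im_le_cmod simp del: times_complex.sel)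
    have rep_h: "AE x in lebesgue. rep_L2 h x = of_real (cmod (c * rep_L2 f x))"
      using rep_scaleC_AE[of "of_real (cmod c)" g] rep_modulus_AE[of f] unfolding h_def g_def
      by eventually_elim (simp add: norm_mult)
    have V: "r \<in> V" "s \<in> V" "h \<in> V"
    proof -
      show "r \<in> V"
        using f rep_r unfolding L2_on_def mem_Collect_eq by eventually_elim auto
      show "s \<in> V"
        using f rep_s unfolding L2_on_def mem_Collect_eq by eventually_elim auto
      show "h \<in> V" unfolding h_def by (intro L2_on_scaleC g)
    qed
    have h0: "0 \<le> h" unfolding L2_nonneg_iff using rep_h by eventually_elim (simp add: complex_le_iff)
    \<comment> \<open>The splitting happens before \<open>T t\<close> is applied: as
      \<open>T t r\<close> and \<open>T t s\<close> are real, the real part of \<open>c\<close>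
      times \<open>T t f\<close> is exactly \<open>T t r\<close>.\<close>
    have "c *\<^sub>C f = r + \<i> *\<^sub>C s"
      by (rule L2_eqI)
        (use rep_r rep_s rep_add_AE[of r "\<i> *\<^sub>C s"] rep_scaleC_AE[of \<i> s] rep_scaleC_AE[of c f]
          in \<open>eventually_elim, simp add: complex_eq_iff\<close>)
    then have eq: "c *\<^sub>C T t f = T t r + \<i> *\<^sub>C T t s"
      using t V f by (metis T_add T_scaleC L2_on_scaleC)
    have Th: "T t h = of_real (cmod c) *\<^sub>C T t g"
      unfolding h_def by (rule T_scaleC[OF t g])
    have "AE x in lebesgue. Im (rep_L2 (T t r) x) = 0 \<and> Re (rep_L2 (T t r) x) \<le> Re (rep_L2 (T t h) x)"
      by (rule T_real_bound[OF t V(1,3) h0])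
        (use rep_r rep_h in \<open>eventually_elim, simp add: abs_Re_le_cmod del: times_complex.sel\<close>)
    moreover have "AE x in lebesgue. Im (rep_L2 (T t s) x) = 0 \<and> Re (rep_L2 (T t s) x)
        \<le> Re (rep_L2 (T t h) x)"
      by (rule T_real_bound[OF t V(2,3) h0])
        (use rep_s rep_h in \<open>eventually_elim, simp add: abs_Im_le_cmod del: times_complex.sel\<close>)
    ultimately show ?thesis unfolding Th
      using rep_scaleC_AE[of c "T t f", unfolded eq] rep_add_AE[of "T t r" "\<i> *\<^sub>C T t s"]
        rep_scaleC_AE[of \<i> "T t s"] rep_scaleC_AE[of "of_real (cmod c)" "T t g"]
    proof eventually_elim
      case (elim x)
      then have "c * rep_L2 (T t f) x = rep_L2 (T t r) x + \<i> * rep_L2 (T t s) x" by metis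
      then have "Re (c * rep_L2 (T t f) x) = Re (rep_L2 (T t r) x)"
        using elim(2) by (simp del: times_complex.sel)
      also have "\<dots> \<le> cmod c * Re (rep_L2 (T t g) x)" using elim by simp
      finally show ?case .
    qed
  qed
  have "AE x in lebesgue. \<forall>c\<in>D. Re (c * rep_L2 (T t f) x) \<le> cmod c * Re (rep_L2 (T t g) x)"
    using c by (subst AE_ball_countable[OF D(1)]) auto
  moreover have "AE x in lebesgue. 0 \<le> rep_L2 (T t g) x"
    using T_nonneg[OF t g g0] by (simp add: L2_nonneg_iff)
  ultimately show ?thesis unfolding g_def[symmetric]
  proof eventually_elim
    case (elim x)
    show ?case by (rule cmod_le_if_dense[OF D(2)]) (use elim in \<open>auto simp: complex_le_iff\<close>)
  qed
qed

text \<open>The modulus is moved inside by \<open>cmod_T_le_modulus\<close>, and domination applies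
  to the nonnegative function obtained. All later uses of domination pass through this bound, which
  is stated with nonnegative integrals and so presupposes no integrability.\<close>

lemma cmod_T_le:
  assumes t: "0 < t" and f: "f \<in> V"
  shows "AE x in lebesgue. ennreal (cmod (rep_L2 (T t f) x))
    \<le> (\<integral>\<^sup>+y. ennreal (heat_kernel t (x - y)) * ennreal (cmod (rep_L2 f y)) \<partial>lebesgue)"
proof -
  define g where "g = modulus_L2 f"
  have g: "g \<in> V" using f by (simp add: g_def L2_on_modulus)
  have g0: "0 \<le> g" unfolding L2_nonneg_iff g_def
    using rep_modulus_AE[of f] by eventually_elim (simp add: complex_le_iff)
  have le: "AE x in lebesgue. rep_L2 (T t g) x \<le> heat_semigroup t (rep_L2 g) x"
    using t by (intro T_le_heat g g0) simp
  have t': "0 \<le> t" using t by simp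
  show ?thesis
    using cmod_T_le_modulus[OF t' f] le unfolding g_def[symmetric]
  proof eventually_elim
    case (elim x)
    have "cmod (rep_L2 (T t f) x) \<le> Re (heat_semigroup t (rep_L2 g) x)"
      using elim by (auto simp: complex_le_iff)
    also have "\<dots> \<le> cmod (LINT y|lebesgue. complex_of_real (heat_kernel t (x - y)) * rep_L2 g y)"
      using t complex_Re_le_cmod by (simp add: heat_semigroup_def)
    finally have "ennreal (cmod (rep_L2 (T t f) x)) \<le> ennreal \<dots>" by (rule ennreal_leI)
    also have "\<dots> \<le> (\<integral>\<^sup>+y. ennreal (cmod (complex_of_real (heat_kernel t (x - y)) * rep_L2 g y))
        \<partial>lebesgue)"
      by (rule ennreal_norm_integral_le)
    also have "\<dots> = (\<integral>\<^sup>+y. ennreal (heat_kernel t (x - y)) * ennreal (cmod (rep_L2 f y)) \<partial>lebesgue)"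
      by (rule nn_integral_cong_AE)
        (use rep_modulus_AE[of f] in \<open>unfold g_def, eventually_elim,
          simp add: norm_mult ennreal_mult heat_kernel_nonneg\<close>)
    finally show ?case .
  qed
qed

lemma cmod_cinner_T_le:
  assumes t: "0 < t" and f: "f \<in> V"
  shows "ennreal (cmod (cinner (T t f) g))
    \<le> (\<integral>\<^sup>+x. \<integral>\<^sup>+y. ennreal (heat_kernel t (x - y)) * ennreal (cmod (rep_L2 f y) * cmod (rep_L2 g x))
        \<partial>lebesgue \<partial>lebesgue)"
proof -
  have "ennreal (cmod (cinner (T t f) g))
      \<le> (\<integral>\<^sup>+x. ennreal (cmod (rep_L2 (T t f) x * cnj (rep_L2 g x))) \<partial>lebesgue)"
    unfolding cinner_eq by (rule ennreal_norm_integral_le)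
  also have "\<dots> \<le> (\<integral>\<^sup>+x. \<integral>\<^sup>+y. ennreal (heat_kernel t (x - y)) * ennreal (cmod (rep_L2 f y) * cmod
      (rep_L2 g x)) \<partial>lebesgue \<partial>lebesgue)"
  proof (rule nn_integral_mono_AE)
    show "AE x in lebesgue. ennreal (cmod (rep_L2 (T t f) x * cnj (rep_L2 g x)))
      \<le> (\<integral>\<^sup>+y. ennreal (heat_kernel t (x - y)) * ennreal (cmod (rep_L2 f y) * cmod (rep_L2 g x))
          \<partial>lebesgue)"
      using cmod_T_le[OF t f]
    proof eventually_elim
      case (elim x)
      have m [measurable]: "(\<lambda>y. heat_kernel t (x - y)) \<in> borel_measurable lebesgue"
        by (rule measurable_lebesgue_diff) measurable
      from mult_right_mono[OF elim, of "ennreal (cmod (rep_L2 g x))"] show ?case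
        by (simp add: norm_mult ennreal_mult nn_integral_multc mult.assoc[symmetric])
    qed
  qed
  finally show ?thesis .
qed

lemma nn_integral_heat_kernel_diff:
  fixes x y :: 'a
  assumes t: "0 < t"
  shows "(\<integral>\<^sup>+y. ennreal (heat_kernel t (x - y)) \<partial>lebesgue) = 1"
    and "(\<integral>\<^sup>+x. ennreal (heat_kernel t (x - y)) \<partial>lebesgue) = 1"
proof -
  show "(\<integral>\<^sup>+y. ennreal (heat_kernel t (x - y)) \<partial>lebesgue) = 1"
    by (subst nn_integral_lebesgue_reflect) (auto simp: nn_integral_heat_kernel_lebesgue[OF t])
  show "(\<integral>\<^sup>+x. ennreal (heat_kernel t (x - y)) \<partial>lebesgue) = 1"
    using nn_integral_lebesgue_shift[of "\<lambda>x. ennreal (heat_kernel t x)" "- y"]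
    by (simp add: nn_integral_heat_kernel_lebesgue[OF t])
qed

text \<open>The Schur test for the pair \<open>f\<close>, \<open>T t f\<close>: the heat kernel has
  mass 1 in each variable, so twice the square of \<open>norm (T t f)\<close> is at most the sum of
  the two squared norms.\<close>

lemma T_contraction:
  assumes t: "0 \<le> t" and f: "f \<in> V"
  shows "norm (T t f) \<le> norm f"
proof (cases "t = 0")
  case False
  then have t: "0 < t" using t by simp
  let ?k = "\<lambda>x y. ennreal (heat_kernel t (x - y))"
  have "ennreal (2 * (norm (T t f))\<^sup>2) = 2 * ennreal (cmod (cinner (T t f) (T t f)))"
    by (simp add: cinner_self norm_power ennreal_mult)
  also have "\<dots> \<le> 2 * (\<integral>\<^sup>+x. \<integral>\<^sup>+y. ?k x y * ennreal (cmod (rep_L2 f y) * cmod (rep_L2 (T t f) x))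
      \<partial>lebesgue \<partial>lebesgue)"
    by (intro mult_left_mono cmod_cinner_T_le t f) simp
  also have "\<dots> \<le> (\<integral>\<^sup>+y. ennreal ((cmod (rep_L2 f y))\<^sup>2) * (\<integral>\<^sup>+x. ?k x y \<partial>lebesgue) \<partial>lebesgue)
      + (\<integral>\<^sup>+x. ennreal ((cmod (rep_L2 (T t f) x))\<^sup>2) * (\<integral>\<^sup>+y. ?k x y \<partial>lebesgue) \<partial>lebesgue)"
    by (rule nn_integral_weighted_product_le)
      (auto intro!: measurable_lebesgue_pair_diff[of "\<lambda>z. ennreal (heat_kernel t z)"])
  also have "\<dots> = ennreal ((norm f)\<^sup>2 + (norm (T t f))\<^sup>2)"
    by (simp add: nn_integral_heat_kernel_diff[OF t] nn_integral_rep_sq)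
  finally have "2 * (norm (T t f))\<^sup>2 \<le> (norm f)\<^sup>2 + (norm (T t f))\<^sup>2"
    by (subst (asm) ennreal_le_iff) auto
  then have "(norm (T t f))\<^sup>2 \<le> (norm f)\<^sup>2" by simp
  then show ?thesis by (rule power2_le_imp_le) simp
qed (use f in \<open>simp add: T_0\<close>)

text \<open>As \<open>a \<le> 1 + a\<^sup>2\<close>, the product is dominated by the kernel plus its
  supremum times the squared modulus.\<close>

lemma integrable_heat_kernel_mult:
  fixes x :: 'a
  assumes t: "0 < t"
  shows "integrable lebesgue (\<lambda>y. heat_kernel t (x - y) * cmod (rep_L2 u y))"
proof (rule Bochner_Integration.integrable_bound)
  let ?K = "(4 * pi * t) powr (- (real DIM('a) / 2))"
  have [measurable]: "(\<lambda>y. heat_kernel t (x - y)) \<in> borel_measurable lebesgue"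
    by (rule measurable_lebesgue_diff) measurable
  show "(\<lambda>y. heat_kernel t (x - y) * cmod (rep_L2 u y)) \<in> borel_measurable lebesgue"
    by measurable
  have "integrable lebesgue (\<lambda>y. heat_kernel t (x - y))"
    using nn_integral_heat_kernel_diff(1)[OF t, of x]
    by (intro integrableI_nonneg) (auto simp: heat_kernel_nonneg)
  then show "integrable lebesgue (\<lambda>y. heat_kernel t (x - y) + ?K * (cmod (rep_L2 u y))\<^sup>2)"
    using integrable_cmod_rep_sq[of u] by simp
  show "AE y in lebesgue. norm (heat_kernel t (x - y) * cmod (rep_L2 u y))
      \<le> norm (heat_kernel t (x - y) + ?K * (cmod (rep_L2 u y))\<^sup>2)"
  proof (rule AE_I2)
    fix y
    let ?k = "heat_kernel t (x - y)" and ?a = "cmod (rep_L2 u y)"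
    have "2 * ?a \<le> 1 + ?a\<^sup>2" using sum_squares_bound[of 1 ?a] by simp
    then have "?a \<le> 1 + ?a\<^sup>2" using norm_ge_zero[of "rep_L2 u y"] by linarith
    then have "?k * ?a \<le> ?k * (1 + ?a\<^sup>2)" by (intro mult_left_mono heat_kernel_nonneg)
    also have "\<dots> = ?k + ?k * ?a\<^sup>2" by (simp add: algebra_simps)
    also have "\<dots> \<le> ?k + ?K * ?a\<^sup>2" by (intro add_left_mono mult_right_mono heat_kernel_le t) auto
    finally show "norm (?k * ?a) \<le> norm (?k + ?K * ?a\<^sup>2)"
      by (simp add: heat_kernel_nonneg)
  qed
qed

text \<open>Domination is applied to \<open>(\<eta> - s)\<^sup>2 u\<close> for all rational \<open>s\<close> at once; off one null set
  both sides are continuous in \<open>s\<close>, so that \<open>s = \<eta> x\<close> may be inserted. This replaces an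
  integral kernel of \<open>T t\<close>.\<close>

lemma carre_du_champ_pointwise:
  assumes t: "0 < t" and u: "u \<in> V" and \<eta>: "bounded_measurable \<eta>"
  shows "AE x in lebesgue. ennreal (cmod (rep_L2 (T t (mult_L2 (\<lambda>x. (\<eta> x)\<^sup>2) u)) x
        - 2 * of_real (\<eta> x) * rep_L2 (T t (mult_L2 \<eta> u)) x + of_real ((\<eta> x)\<^sup>2) * rep_L2 (T t u) x))
    \<le> (\<integral>\<^sup>+y. ennreal (heat_kernel t (x - y) * (\<eta> y - \<eta> x)\<^sup>2) * ennreal (cmod (rep_L2 u y)) \<partial>lebesgue)"
proof -
  obtain B where B: "\<And>x. \<bar>\<eta> x\<bar> \<le> B" and [measurable]: "\<eta> \<in> borel_measurable lebesgue"
    using \<eta> by (auto simp: bounded_measurable_def)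
  note \<eta>s = bounded_measurable_power2[OF \<eta>]
  have \<eta>2: "bounded_measurable (\<lambda>x. (\<eta> x)\<^sup>2)" using \<eta>s[of 0] by simp
  let ?a = "rep_L2 (T t (mult_L2 (\<lambda>x. (\<eta> x)\<^sup>2) u))" and ?b = "rep_L2 (T t (mult_L2 \<eta> u))" and ?c
      = "rep_L2 (T t u)"
  let ?k = "\<lambda>x y. heat_kernel t (x - y) * cmod (rep_L2 u y)"
  let ?A = "\<lambda>x. LINT y|lebesgue. ?k x y * (\<eta> y)\<^sup>2"
  let ?B = "\<lambda>x. LINT y|lebesgue. ?k x y * \<eta> y"
  let ?C = "\<lambda>x. LINT y|lebesgue. ?k x y"
  have ik: "integrable lebesgue (?k x)" for x by (rule integrable_heat_kernel_mult[OF t])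
  have ikm: "integrable lebesgue (\<lambda>y. ?k x y * h y)" if h: "bounded_measurable h" for h x
  proof -
    obtain C where C: "\<And>x. \<bar>h x\<bar> \<le> C" and [measurable]: "h \<in> borel_measurable lebesgue"
      using h by (auto simp: bounded_measurable_def)
    show ?thesis
    proof (rule Bochner_Integration.integrable_bound)
      show "integrable lebesgue (\<lambda>y. ?k x y * C)" using ik[of x] by (rule integrable_mult_left)
      show "AE y in lebesgue. norm (?k x y * h y) \<le> norm (?k x y * C)"
      proof (intro AE_I2)
        fix y show "norm (?k x y * h y) \<le> norm (?k x y * C)"
          using mult_left_mono[OF C[of y], of "\<bar>?k x y\<bar>"] C[of y] by (simp add: abs_mult)
      qed
      show "(\<lambda>y. ?k x y * h y) \<in> borel_measurable lebesgue"
        using borel_measurable_integrable[OF ik[of x]] by measurable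
    qed
  qed
  \<comment> \<open>For fixed \<open>x\<close> the heat integral is a quadratic polynomial in
    \<open>s\<close>; this is the continuity in \<open>s\<close> that is used at the end.\<close>
  have int_eq: "(\<integral>\<^sup>+y. ennreal (heat_kernel t (x - y) * (\<eta> y - s)\<^sup>2) * ennreal (cmod (rep_L2 u y))
      \<partial>lebesgue)
      = ennreal (?A x - 2 * s * ?B x + s\<^sup>2 * ?C x)" for x s
  proof -
    have "(\<integral>\<^sup>+y. ennreal (heat_kernel t (x - y) * (\<eta> y - s)\<^sup>2) * ennreal (cmod (rep_L2 u y)) \<partial>lebesgue)
        = (\<integral>\<^sup>+y. ennreal (?k x y * (\<eta> y - s)\<^sup>2) \<partial>lebesgue)"
      by (intro nn_integral_cong) (simp add: heat_kernel_nonneg mult_ac flip: ennreal_mult)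
    also have "\<dots> = ennreal (LINT y|lebesgue. ?k x y * (\<eta> y - s)\<^sup>2)"
      by (intro nn_integral_eq_integral ikm \<eta>s) (simp add: heat_kernel_nonneg)
    also have "(LINT y|lebesgue. ?k x y * (\<eta> y - s)\<^sup>2)
        = (LINT y|lebesgue. ?k x y * (\<eta> y)\<^sup>2 - (2 * s) * (?k x y * \<eta> y) + s\<^sup>2 * ?k x y)"
      by (rule arg_cong[where f = "integral\<^sup>L lebesgue"]) (auto simp: fun_eq_iff power2_eq_square
          algebra_simps)
    also have "\<dots> = ?A x - 2 * s * ?B x + s\<^sup>2 * ?C x"
      using ik[of x] ikm[OF \<eta>, of x] ikm[OF \<eta>2, of x] by simp
    finally show ?thesis .
  qed
  have s: "AE x in lebesgue. ennreal (cmod (?a x - 2 * of_real s * ?b x + of_real (s\<^sup>2) * ?c x))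
      \<le> ennreal (?A x - 2 * s * ?B x + s\<^sup>2 * ?C x)" for s
  proof -
    let ?m = "mult_L2 (\<lambda>x. (\<eta> x - s)\<^sup>2) u"
    let ?m2 = "mult_L2 (\<lambda>x. (\<eta> x)\<^sup>2) u" and ?m1 = "mult_L2 \<eta> u"
    have V: "?m2 \<in> V" "?m1 \<in> V" "?m \<in> V" by (intro L2_on_mult u \<eta> \<eta>2 \<eta>s)+
    have "?m = ?m2 - (2 * of_real s) *\<^sub>C ?m1 + of_real (s\<^sup>2) *\<^sub>C u"
    proof (rule L2_eqI)
      show "AE x in lebesgue. rep_L2 ?m x = rep_L2 (?m2 - (2 * of_real s) *\<^sub>C ?m1
          + of_real (s\<^sup>2) *\<^sub>C u) x"
        using rep_mult_AE[OF \<eta>s, of s u] rep_mult_AE[OF \<eta>, of u] rep_mult_AE[OF \<eta>2, of u]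
          rep_add_AE[of "?m2 - (2 * of_real s) *\<^sub>C ?m1" "of_real (s\<^sup>2) *\<^sub>C u"]
          rep_diff_AE[of ?m2 "(2 * of_real s) *\<^sub>C ?m1"] rep_scaleC_AE[of "2 * of_real s" ?m1]
          rep_scaleC_AE[of "of_real (s\<^sup>2)" u]
      proof eventually_elim
        case (elim x)
        show ?case unfolding elim by (simp add: power2_eq_square algebra_simps)
      qed
    qed
    then have eq: "T t ?m = T t ?m2 - (2 * of_real s) *\<^sub>C T t ?m1 + of_real (s\<^sup>2) *\<^sub>C T t u"
      using t u V by (simp add: T_add T_diff T_scaleC L2_on_scaleC L2_on_diff)
    show ?thesis
      using cmod_T_le[OF t V(3)] rep_mult_AE[OF \<eta>s, of s u]
        rep_add_AE[of "T t ?m2 - (2 * of_real s) *\<^sub>C T t ?m1" "of_real (s\<^sup>2) *\<^sub>C T t u"]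
        rep_diff_AE[of "T t ?m2" "(2 * of_real s) *\<^sub>C T t ?m1"] rep_scaleC_AE[of "2 * of_real s" "T t
            ?m1"]
        rep_scaleC_AE[of "of_real (s\<^sup>2)" "T t u"]
    proof eventually_elim
      case (elim x)
      have i: "(\<integral>\<^sup>+y. ennreal (heat_kernel t (x - y)) * ennreal (cmod (rep_L2 ?m y)) \<partial>lebesgue)
        = (\<integral>\<^sup>+y. ennreal (heat_kernel t (x - y) * (\<eta> y - s)\<^sup>2) * ennreal (cmod (rep_L2 u y)) \<partial>lebesgue)"
      proof (rule nn_integral_cong_AE)
        show "AE y in lebesgue. ennreal (heat_kernel t (x - y)) * ennreal (cmod (rep_L2 ?m y))
          = ennreal (heat_kernel t (x - y) * (\<eta> y - s)\<^sup>2) * ennreal (cmod (rep_L2 u y))"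
          using rep_mult_AE[OF \<eta>s, of s u]
        proof eventually_elim
          case (elim y)
          have "cmod (rep_L2 ?m y) = (\<eta> y - s)\<^sup>2 * cmod (rep_L2 u y)"
            unfolding elim norm_mult norm_of_real by simp
          then show ?case by (simp add: heat_kernel_nonneg ennreal_mult mult.assoc)
        qed
      qed
      have "rep_L2 (T t ?m) x = ?a x - 2 * of_real s * ?b x + of_real (s\<^sup>2) * ?c x"
        unfolding eq using elim by simp
      with elim(1) show ?case unfolding i int_eq by (simp only:)
    qed
  qed
  have "AE x in lebesgue. \<forall>s\<in>\<rat>. ennreal (cmod (?a x - 2 * of_real s * ?b x + of_real (s\<^sup>2) * ?c x))
      \<le> ennreal (?A x - 2 * s * ?B x + s\<^sup>2 * ?C x)"
    using s by (subst AE_ball_countable[OF countable_rat]) auto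
  then show ?thesis
  proof eventually_elim
    case (elim x)
    let ?S = "{s. cmod (?a x - 2 * of_real s * ?b x + of_real (s\<^sup>2) * ?c x) \<le> ?A x - 2 * s * ?B x
        + s\<^sup>2 * ?C x}"
    \<comment> \<open>\<open>ennreal\<close> cuts negative values off at 0, so the inequality
      between reals can be recovered only once the right side is known to be nonnegative.\<close>
    have nn: "0 \<le> ?A x - 2 * s * ?B x + s\<^sup>2 * ?C x" for s
    proof -
      have "?A x - 2 * s * ?B x + s\<^sup>2 * ?C x
          = (LINT y|lebesgue. ?k x y * (\<eta> y)\<^sup>2 - (2 * s) * (?k x y * \<eta> y) + s\<^sup>2 * ?k x y)"
        using ik[of x] ikm[OF \<eta>, of x] ikm[OF \<eta>2, of x] by simp
      also have "\<dots> = (LINT y|lebesgue. ?k x y * (\<eta> y - s)\<^sup>2)"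
        by (rule arg_cong[where f = "integral\<^sup>L lebesgue"]) (auto simp: fun_eq_iff power2_eq_square
            algebra_simps)
      also have "\<dots> \<ge> 0" by (rule integral_nonneg_AE) (simp add: heat_kernel_nonneg)
      finally show ?thesis .
    qed
    have cl: "closed ?S" by (intro closed_Collect_le continuous_intros)
    have "\<rat> \<subseteq> ?S" using elim nn by auto
    then have "closure \<rat> \<subseteq> ?S" using cl by (rule closure_minimal)
    then have "?S = UNIV" by (simp add: Rats_closure_real top.extremum_unique)
    then have "cmod (?a x - 2 * of_real (\<eta> x) * ?b x + of_real ((\<eta> x)\<^sup>2) * ?c x)
        \<le> ?A x - 2 * \<eta> x * ?B x + (\<eta> x)\<^sup>2 * ?C x" by blast
    then show ?case unfolding int_eq by (rule ennreal_leI)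
  qed
qed

text \<open>The IMS localisation formula at a positive time. The expression \<open>?D\<close> is the
  double commutator of \<eta> with \<open>T t\<close>, applied to \<open>u\<close>; paired with
  \<open>u\<close>, its two outer terms have equal real parts by selfadjointness. The kernel bound
  for \<open>?D\<close> and the Schur test finish the proof, and the symmetry of \<open>?w\<close>
  makes the two halves of the Schur bound equal.\<close>

lemma IMS_bound:
  assumes t: "0 < t" and u: "u \<in> V" and \<eta>: "bounded_measurable \<eta>"
  shows "ennreal (2 * \<bar>Re (cinner (T t u) (mult_L2 (\<lambda>x. (\<eta> x)\<^sup>2) u)) - Re (cinner (T t (mult_L2 \<eta> u))
      (mult_L2 \<eta> u))\<bar>)
    \<le> (\<integral>\<^sup>+x. ennreal ((cmod (rep_L2 u x))\<^sup>2)
          * (\<integral>\<^sup>+y. ennreal (heat_kernel t (x - y) * (\<eta> y - \<eta> x)\<^sup>2) \<partial>lebesgue) \<partial>lebesgue)"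
proof -
  obtain B where B: "\<And>x. \<bar>\<eta> x\<bar> \<le> B" and [measurable]: "\<eta> \<in> borel_measurable lebesgue"
    using \<eta> by (auto simp: bounded_measurable_def)
  have \<eta>2: "bounded_measurable (\<lambda>x. (\<eta> x)\<^sup>2)"
    using bounded_measurable_power2[OF \<eta>, of 0] by simp
  let ?m2 = "mult_L2 (\<lambda>x. (\<eta> x)\<^sup>2) u" and ?m1 = "mult_L2 \<eta> u"
  let ?w = "\<lambda>x y. ennreal (heat_kernel t (x - y) * (\<eta> y - \<eta> x)\<^sup>2)"
  have V: "?m2 \<in> V" "?m1 \<in> V" by (intro L2_on_mult u \<eta> \<eta>2)+
  let ?a = "rep_L2 (T t ?m2)" and ?b = "rep_L2 (T t ?m1)" and ?c = "rep_L2 (T t u)"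
  let ?D = "\<lambda>x. ?a x - 2 * of_real (\<eta> x) * ?b x + of_real ((\<eta> x)\<^sup>2) * ?c x"
  have "(LINT x|lebesgue. ?D x * cnj (rep_L2 u x))
      = (LINT x|lebesgue. ?a x * cnj (rep_L2 u x) - 2 * (?b x * cnj (rep_L2 ?m1 x))
          + ?c x * cnj (rep_L2 ?m2 x))"
  proof (rule integral_cong_AE)
    show "AE x in lebesgue. ?D x * cnj (rep_L2 u x)
        = ?a x * cnj (rep_L2 u x) - 2 * (?b x * cnj (rep_L2 ?m1 x)) + ?c x * cnj (rep_L2 ?m2 x)"
      using rep_mult_AE[OF \<eta>, of u] rep_mult_AE[OF \<eta>2, of u]
    proof eventually_elim
      case (elim x)
      show ?case unfolding elim by (simp add: algebra_simps)
    qed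
    have [measurable]: "(\<lambda>x. cnj (rep_L2 f x)) \<in> borel_measurable lebesgue" for f :: "'a L2"
      by (rule measurable_compose[OF rep_L2_measurable])
        (intro borel_measurable_continuous_onI continuous_intros)
    show "(\<lambda>x. ?D x * cnj (rep_L2 u x)) \<in> borel_measurable lebesgue"
      and "(\<lambda>x. ?a x * cnj (rep_L2 u x) - 2 * (?b x * cnj (rep_L2 ?m1 x))
          + ?c x * cnj (rep_L2 ?m2 x)) \<in> borel_measurable lebesgue"
      by measurable
  qed
  also have "\<dots> = cinner (T t ?m2) u - 2 * cinner (T t ?m1) ?m1 + cinner (T t u) ?m2"
    unfolding cinner_eq by (simp add: integrable_rep_mult_cnj)
  also have "cinner (T t ?m2) u = cnj (cinner (T t u) ?m2)"
    using T_selfadjoint[of t ?m2 u] t V u by (simp add: cinner_commute[of "?m2"])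
  finally have eq: "Re (LINT x|lebesgue. ?D x * cnj (rep_L2 u x))
      = 2 * (Re (cinner (T t u) ?m2) - Re (cinner (T t ?m1) ?m1))"
    by simp
  have wm: "(\<lambda>p. ?w (fst p) (snd p)) \<in> borel_measurable (lebesgue \<Otimes>\<^sub>M lebesgue)"
  proof -
    have [measurable]: "(\<lambda>p. heat_kernel t (fst p - snd p :: 'a)) \<in> borel_measurable (lebesgue \<Otimes>\<^sub>M
        lebesgue)"
      by (rule measurable_lebesgue_pair_diff) measurable
    show ?thesis by measurable
  qed
  have wsym: "?w x y = ?w y x" for x y
    using heat_kernel_minus[of t "x - y"] by (simp add: power2_commute)
  have "ennreal (2 * \<bar>Re (cinner (T t u) ?m2) - Re (cinner (T t ?m1) ?m1)\<bar>)
      \<le> ennreal (cmod (LINT x|lebesgue. ?D x * cnj (rep_L2 u x)))"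
    using abs_Re_le_cmod[of "LINT x|lebesgue. ?D x * cnj (rep_L2 u x)"] unfolding eq abs_mult
    by (intro ennreal_leI) (simp del: of_real_power)
  also have "\<dots> \<le> (\<integral>\<^sup>+x. ennreal (cmod (?D x * cnj (rep_L2 u x))) \<partial>lebesgue)"
    by (rule ennreal_norm_integral_le)
  also have "\<dots> \<le> (\<integral>\<^sup>+x. \<integral>\<^sup>+y. ?w x y * ennreal (cmod (rep_L2 u y) * cmod (rep_L2 u x)) \<partial>lebesgue
      \<partial>lebesgue)"
  proof (rule nn_integral_mono_AE)
    show "AE x in lebesgue. ennreal (cmod (?D x * cnj (rep_L2 u x)))
      \<le> (\<integral>\<^sup>+y. ?w x y * ennreal (cmod (rep_L2 u y) * cmod (rep_L2 u x)) \<partial>lebesgue)"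
      using carre_du_champ_pointwise[OF t u \<eta>]
    proof eventually_elim
      case (elim x)
      have m [measurable]: "(\<lambda>y. heat_kernel t (x - y)) \<in> borel_measurable lebesgue"
        by (rule measurable_lebesgue_diff) measurable
      have "ennreal (cmod (?D x * cnj (rep_L2 u x)))
          = ennreal (cmod (?D x)) * ennreal (cmod (rep_L2 u x))"
        by (simp only: norm_mult complex_mod_cnj ennreal_mult norm_ge_zero)
      also have "\<dots> \<le> (\<integral>\<^sup>+y. ?w x y * ennreal (cmod (rep_L2 u y)) \<partial>lebesgue) * ennreal (cmod (rep_L2 u
          x))"
        by (intro mult_right_mono elim) simp
      also have "\<dots> = (\<integral>\<^sup>+y. ?w x y * ennreal (cmod (rep_L2 u y) * cmod (rep_L2 u x)) \<partial>lebesgue)"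
        by (subst nn_integral_multc[symmetric]) (auto simp: ennreal_mult mult.assoc)
      finally show ?case .
    qed
  qed
  finally have le: "ennreal (2 * \<bar>Re (cinner (T t u) ?m2) - Re (cinner (T t ?m1) ?m1)\<bar>)
      \<le> (\<integral>\<^sup>+x. \<integral>\<^sup>+y. ?w x y * ennreal (cmod (rep_L2 u y) * cmod (rep_L2 u x)) \<partial>lebesgue \<partial>lebesgue)" (is
          "?L \<le> ?I") .
  have "2 * ?I \<le> (\<integral>\<^sup>+y. ennreal ((cmod (rep_L2 u y))\<^sup>2) * (\<integral>\<^sup>+x. ?w x y \<partial>lebesgue) \<partial>lebesgue)
      + (\<integral>\<^sup>+x. ennreal ((cmod (rep_L2 u x))\<^sup>2) * (\<integral>\<^sup>+y. ?w x y \<partial>lebesgue) \<partial>lebesgue)"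
    by (rule nn_integral_weighted_product_le[OF _ _ wm]) measurable
  also have "\<dots> = 2 * (\<integral>\<^sup>+x. ennreal ((cmod (rep_L2 u x))\<^sup>2) * (\<integral>\<^sup>+y. ?w x y \<partial>lebesgue) \<partial>lebesgue)"
    by (subst (1) wsym) (simp only: mult_2)
  finally have "?I \<le> (\<integral>\<^sup>+x. ennreal ((cmod (rep_L2 u x))\<^sup>2) * (\<integral>\<^sup>+y. ?w x y \<partial>lebesgue) \<partial>lebesgue)"
    by (simp add: ennreal_mult_le_mult_iff)
  with le show ?thesis by (rule order_trans)
qed

end

section \<open>Completeness of the Hilbert space and eigenfunctions\<close>

lemma summable_if_weighted_squares_bounded:
  fixes d :: "nat \<Rightarrow> real"
  assumes d: "\<And>k. 0 \<le> d k" and C: "\<And>k. 2 ^ k * (d k)\<^sup>2 \<le> C"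
  shows "summable d"
proof (rule summable_comparison_test_ev)
  have "(d 0)\<^sup>2 \<le> C" using C[of 0] by simp
  then have C0: "0 \<le> C" by (rule order_trans[OF zero_le_power2])
  show "eventually (\<lambda>k. norm (d k) \<le> sqrt C * (1 / sqrt 2) ^ k) sequentially"
  proof (intro always_eventually allI)
    fix k
    have "(d k)\<^sup>2 \<le> C / 2 ^ k" using C[of k] by (simp add: field_simps)
    also have "C / 2 ^ k = (sqrt C * (1 / sqrt 2) ^ k)\<^sup>2"
      using C0 by (simp add: power_mult_distrib power_divide flip: power_mult power_even_eq[of _ k])
        (simp add: power_mult mult.commute[of k])
    finally have "d k \<le> sqrt C * (1 / sqrt 2) ^ k"
      by (rule power2_le_imp_le) (use C0 in simp)
    then show "norm (d k) \<le> sqrt C * (1 / sqrt 2) ^ k" using d[of k] by simp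
  qed
  have "(1::real) < sqrt 2" by simp
  then have "summable (\<lambda>k. (1 / sqrt 2 :: real) ^ k)"
    by (intro summable_geometric) (simp add: divide_less_eq)
  then show "summable (\<lambda>k. sqrt C * (1 / sqrt 2) ^ k)" by (rule summable_mult)
qed

text \<open>Riesz-Fischer: a subsequence with geometrically small increments converges almost
  everywhere, and Fatou's lemma turns the pointwise limit into a limit in norm. Completeness is what
  allows orbits \<open>T s f\<close> to be integrated over time.\<close>

instance L2 :: (euclidean_space) banach
proof
  fix X :: "nat \<Rightarrow> 'a L2"
  assume "Cauchy X"
  then have "\<exists>N. \<forall>m\<ge>N. \<forall>n\<ge>N. norm (X m - X n) < (1 / 2) ^ k" for k :: nat
    by (intro CauchyD) auto
  then obtain N where N: "\<And>k m n. m \<ge> N k \<Longrightarrow> n \<ge> N k \<Longrightarrow> norm (X m - X n) < (1 / 2) ^ k"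
    by metis
  \<comment> \<open>Partial sums serve as indices because they dominate \<open>N k\<close> for every
    \<open>k \<le> j\<close>, with no monotonicity of \<open>N\<close>.\<close>
  define r where "r k = (\<Sum>i\<le>k. N i)" for k
  have rN: "N k \<le> r j" if "k \<le> j" for k j
    unfolding r_def using that by (intro member_le_sum) auto
  define F where "F k = rep_L2 (X (r k))" for k
  have [measurable]: "F k \<in> borel_measurable lebesgue" for k
    by (simp add: F_def)
  have F_diff: "(\<integral>\<^sup>+x. ennreal ((cmod (F j x - F k x))\<^sup>2) \<partial>lebesgue)
      = ennreal ((norm (X (r j) - X (r k)))\<^sup>2)" for j k
    unfolding nn_integral_rep_sq[symmetric]
    by (rule nn_integral_cong_AE) (use rep_diff_AE[of "X (r j)" "X (r k)"] in \<open>eventually_elim, simp add: F_def\<close>)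
  have F_small: "(\<integral>\<^sup>+x. ennreal ((cmod (F j x - F k x))\<^sup>2) \<partial>lebesgue) \<le> ennreal (((1 / 2) ^ k)\<^sup>2)" if "k
      \<le> j" for j k
    unfolding F_diff using N[OF rN[OF that] rN[OF order_refl]]
    by (intro ennreal_leI power_mono) auto
  \<comment> \<open>The factor 2^k is affordable against squared increments of size 4^-k, and where
    the weighted series is finite it forces the increments themselves to be summable.\<close>
  have "(\<integral>\<^sup>+x. (\<Sum>k. ennreal (2 ^ k * (cmod (F (Suc k) x - F k x))\<^sup>2)) \<partial>lebesgue)
      = (\<Sum>k. \<integral>\<^sup>+x. ennreal (2 ^ k) * ennreal ((cmod (F (Suc k) x - F k x))\<^sup>2) \<partial>lebesgue)"
    by (subst nn_integral_suminf) (auto simp: ennreal_mult)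
  also have "\<dots> \<le> (\<Sum>k. ennreal ((1 / 2) ^ k))"
  proof (intro suminf_le allI)
    fix k
    have "(\<integral>\<^sup>+x. ennreal (2 ^ k) * ennreal ((cmod (F (Suc k) x - F k x))\<^sup>2) \<partial>lebesgue)
        = ennreal (2 ^ k) * (\<integral>\<^sup>+x. ennreal ((cmod (F (Suc k) x - F k x))\<^sup>2) \<partial>lebesgue)"
      by (rule nn_integral_cmult) measurable
    also have "\<dots> \<le> ennreal (2 ^ k) * ennreal (((1 / 2) ^ k)\<^sup>2)"
      by (intro mult_left_mono F_small) auto
    also have "\<dots> = ennreal ((1 / 2) ^ k)"
      by (subst ennreal_mult[symmetric]) (auto simp: power2_eq_square power_divide)
    finally show "(\<integral>\<^sup>+x. ennreal (2 ^ k) * ennreal ((cmod (F (Suc k) x - F k x))\<^sup>2) \<partial>lebesgue)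
        \<le> ennreal ((1 / 2) ^ k)" .
  qed auto
  also have "\<dots> < \<infinity>"
    by (subst suminf_ennreal2) (auto simp: summable_geometric)
  finally have "AE x in lebesgue. (\<Sum>k. ennreal (2 ^ k * (cmod (F (Suc k) x - F k x))\<^sup>2)) \<noteq> \<infinity>"
    by (intro nn_integral_noteq_infinite) auto
  then have conv: "AE x in lebesgue. convergent (\<lambda>k. F k x)"
  proof eventually_elim
    case (elim x)
    define S where "S = (\<Sum>k. ennreal (2 ^ k * (cmod (F (Suc k) x - F k x))\<^sup>2))"
    have "2 ^ k * (cmod (F (Suc k) x - F k x))\<^sup>2 \<le> enn2real S" for k
    proof -
      have "ennreal (2 ^ k * (cmod (F (Suc k) x - F k x))\<^sup>2)
          = (\<Sum>k\<in>{k}. ennreal (2 ^ k * (cmod (F (Suc k) x - F k x))\<^sup>2))"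
        by simp
      also have "\<dots> \<le> S" unfolding S_def by (intro sum_le_suminf) auto
      finally show ?thesis
        using elim by (simp add: S_def ennreal_le_iff2 enn2real_leI flip: ennreal_le_iff)
    qed
    then have "summable (\<lambda>k. cmod (F (Suc k) x - F k x))"
      by (intro summable_if_weighted_squares_bounded) auto
    then have "summable (\<lambda>k. F (Suc k) x - F k x)"
      by (rule summable_norm_cancel)
    then have "(\<lambda>n. \<Sum>k<n. F (Suc k) x - F k x) \<longlonglongrightarrow> (\<Sum>k. F (Suc k) x - F k x)"
      by (rule summable_LIMSEQ)
    then have "(\<lambda>n. (F n x - F 0 x) + F 0 x) \<longlonglongrightarrow> (\<Sum>k. F (Suc k) x - F k x) + F 0 x"
      unfolding sum_lessThan_telescope[of "\<lambda>n. F n x"] by (intro tendsto_intros)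
    then show ?case by (auto simp: convergent_def)
  qed
  define G where "G x = lim (\<lambda>k. F k x)" for x
  have [measurable]: "G \<in> borel_measurable lebesgue"
    unfolding G_def by measurable
  have G: "(\<integral>\<^sup>+x. ennreal ((cmod (G x - F k x))\<^sup>2) \<partial>lebesgue) \<le> ennreal (((1 / 2) ^ k)\<^sup>2)" for k
  proof -
    have "(\<integral>\<^sup>+x. ennreal ((cmod (G x - F k x))\<^sup>2) \<partial>lebesgue)
        = (\<integral>\<^sup>+x. liminf (\<lambda>j. ennreal ((cmod (F j x - F k x))\<^sup>2)) \<partial>lebesgue)"
    proof (rule nn_integral_cong_AE)
      show "AE x in lebesgue. ennreal ((cmod (G x - F k x))\<^sup>2)
          = liminf (\<lambda>j. ennreal ((cmod (F j x - F k x))\<^sup>2))"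
        using conv
      proof eventually_elim
        case (elim x)
        then have "(\<lambda>j. F j x) \<longlonglongrightarrow> G x"
          unfolding G_def by (simp add: convergent_LIMSEQ_iff)
        then have "(\<lambda>j. ennreal ((cmod (F j x - F k x))\<^sup>2)) \<longlonglongrightarrow> ennreal ((cmod (G x - F k x))\<^sup>2)"
          by (intro tendsto_intros)
        then show ?case by (metis lim_imp_Liminf trivial_limit_sequentially)
      qed
    qed
    also have "\<dots> \<le> liminf (\<lambda>j. \<integral>\<^sup>+x. ennreal ((cmod (F j x - F k x))\<^sup>2) \<partial>lebesgue)"
      by (rule nn_integral_liminf) measurable
    also have "\<dots> \<le> ennreal (((1 / 2) ^ k)\<^sup>2)"
      by (rule Liminf_le) (use F_small[of k] in \<open>auto intro: eventually_sequentiallyI[of k]\<close>)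
    finally show ?thesis .
  qed
  have "square_integrable (\<lambda>x. G x - F 0 x)"
    unfolding square_integrable_def
  proof
    show "integrable lebesgue (\<lambda>x. (cmod (G x - F 0 x))\<^sup>2)"
      using G[of 0] by (intro integrableI_nonneg) (auto simp: le_less_trans)
  qed measurable
  then have "square_integrable (\<lambda>x. (G x - F 0 x) + F 0 x)"
    unfolding F_def by (intro square_integrable_add square_integrable_rep)
  then have sG: "square_integrable G" by simp
  have f: "norm (abs_L2 G - X (r k)) \<le> (1 / 2) ^ k" for k
  proof -
    have "ennreal ((norm (abs_L2 G - X (r k)))\<^sup>2) = (\<integral>\<^sup>+x. ennreal ((cmod (G x - F k x))\<^sup>2) \<partial>lebesgue)"
      unfolding nn_integral_rep_sq[symmetric]
      by (rule nn_integral_cong_AE)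
        (use rep_diff_AE[of "abs_L2 G" "X (r k)"] rep_abs_AE[OF sG] in \<open>eventually_elim, simp add: F_def\<close>)
    also have "\<dots> \<le> ennreal (((1 / 2) ^ k)\<^sup>2)" by (rule G)
    finally have "(norm (abs_L2 G - X (r k)))\<^sup>2 \<le> ((1 / 2) ^ k)\<^sup>2"
      by (subst (asm) ennreal_le_iff) auto
    then show ?thesis by (rule power2_le_imp_le) simp
  qed
  have "X \<longlonglongrightarrow> abs_L2 G"
  proof (rule LIMSEQ_I)
    fix e :: real assume "0 < e"
    then obtain k where k: "(1 / 2) ^ k < e / 2"
      using real_arch_pow_inv[of "e / 2" "1 / 2"] by auto
    have "norm (X n - abs_L2 G) < e" if "n \<ge> N k" for n
    proof -
      have "norm (X n - abs_L2 G) \<le> norm (X n - X (r k)) + norm (abs_L2 G - X (r k))"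
        using norm_triangle_ineq4[of "X n - X (r k)" "abs_L2 G - X (r k)"] by simp
      then show ?thesis using N[OF that rN[of k k]] f[of k] k by simp
    qed
    then show "\<exists>no. \<forall>n\<ge>no. norm (X n - abs_L2 G) < e" by blast
  qed
  then show "convergent X" by (auto simp: convergent_def)
qed

section \<open>Eigenfunctions of the generator under the semigroup\<close>

context dominated_semigroup
begin

definition gen :: "'a L2 \<Rightarrow> 'a L2 \<Rightarrow> bool" where
  "gen f g \<longleftrightarrow> f \<in> V \<and> ((\<lambda>t. (T t f - f) /\<^sub>R t) \<longlongrightarrow> g) (at_right 0)"

lemma gen_range: "gen f g \<Longrightarrow> g \<in> V"
proof -
  assume g: "gen f g"
  then have f: "f \<in> V" and l: "((\<lambda>t. (T t f - f) /\<^sub>R t) \<longlongrightarrow> g) (at_right 0)" by (auto simp: gen_def)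
  have "(\<lambda>n. inverse (real (Suc n))) \<longlonglongrightarrow> 0" by (rule LIMSEQ_inverse_real_of_nat)
  then have "filterlim (\<lambda>n. inverse (real (Suc n))) (at_right 0) sequentially"
    by (auto simp: filterlim_at)
  from filterlim_compose[OF l this]
  have "(\<lambda>n. (T (inverse (real (Suc n))) f - f) /\<^sub>R (inverse (real (Suc n)))) \<longlonglongrightarrow> g" .
  then show "g \<in> V"
    by (rule L2_on_closed[OF Omega, rotated]) (auto intro!: L2_on_scaleR L2_on_diff T_in f)
qed

text \<open>Telescoping for powers of two commuting contractions, \<open>T h\<close> and the scalar
  \<open>a\<close>: each step contributes at most the error of a single step.\<close>

lemma T_power_diff:
  assumes h: "0 \<le> h" and a: "\<bar>a\<bar> \<le> 1" and f: "f \<in> V"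
  shows "norm (T (real n * h) f - a ^ n *\<^sub>R f) \<le> real n * norm (T h f - a *\<^sub>R f)"
proof (induction n)
  case 0
  show ?case using f by (simp add: T_0)
next
  case (Suc n)
  have V: "T h f \<in> V" "T (real n * h) f \<in> V" "a ^ n *\<^sub>R f \<in> V" "a *\<^sub>R f \<in> V"
    using h f by (auto intro!: T_in L2_on_scaleR)
  have "T (real (Suc n) * h) f = T (real n * h) (T h f)"
    using h f by (subst T_T) (auto simp: algebra_simps)
  then have "T (real (Suc n) * h) f - a ^ Suc n *\<^sub>R f
      = T (real n * h) (T h f - a *\<^sub>R f) + a *\<^sub>R (T (real n * h) f - a ^ n *\<^sub>R f)"
    using h f V by (simp add: T_diff T_scaleR scaleR_diff_right)
  also have "norm \<dots> \<le> norm (T (real n * h) (T h f - a *\<^sub>R f))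
      + norm (a *\<^sub>R (T (real n * h) f - a ^ n *\<^sub>R f))"
    by (rule norm_triangle_ineq)
  also have "\<dots> \<le> norm (T h f - a *\<^sub>R f) + 1 * (real n * norm (T h f - a *\<^sub>R f))"
    unfolding norm_scaleR using h a V Suc.IH
    by (intro add_mono T_contraction mult_mono L2_on_diff) auto
  finally show ?case by (simp add: algebra_simps)
qed

text \<open>Contractivity makes the product of \<open>T t f - f\<close> with \<open>f\<close>
  nonpositive for every \<open>t\<close>.\<close>

lemma eigen_nonneg:
  assumes "gen f (- \<mu> *\<^sub>R f)" "f \<noteq> 0"
  shows "0 \<le> \<mu>"
proof -
  have f: "f \<in> V" and l: "((\<lambda>t. (T t f - f) /\<^sub>R t) \<longlongrightarrow> - \<mu> *\<^sub>R f) (at_right 0)"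
    using assms by (auto simp: gen_def)
  have "((\<lambda>t. inner ((T t f - f) /\<^sub>R t) f) \<longlongrightarrow> inner (- \<mu> *\<^sub>R f) f) (at_right 0)"
    by (intro tendsto_inner l tendsto_const)
  moreover have "eventually (\<lambda>t. inner ((T t f - f) /\<^sub>R t) f \<le> 0) (at_right 0)"
    using eventually_at_right_less[of "0::real"]
  proof eventually_elim
    case (elim t)
    have "inner (T t f) f \<le> norm (T t f) * norm f" by (rule norm_cauchy_schwarz)
    also have "\<dots> \<le> norm f * norm f" using elim f by (intro mult_right_mono T_contraction) auto
    also have "\<dots> = inner f f" by (simp add: power2_norm_eq_inner flip: power2_eq_square)
    finally show ?case using elim by (simp add: inner_diff_left field_simps)
  qed
  ultimately have "inner (- \<mu> *\<^sub>R f) f \<le> 0"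
    by (rule tendsto_upperbound) simp
  then have "0 \<le> \<mu> * (norm f)\<^sup>2" by (simp add: power2_norm_eq_inner)
  then show ?thesis using assms(2) by (simp add: zero_le_mult_iff)
qed

text \<open>Euler's scheme. For h = t / n the vector \<open>T h f\<close> differs from (1 - \<mu>h)
  f by o(h), and by \<open>T_power_diff\<close> n such errors still tend to 0, while (1 - \<mu>t /
  n)^n tends to the exponential. Nonnegativity of \<mu> keeps the factors in [0, 1] for large
  n.\<close>

lemma T_eigen:
  assumes g: "gen f (- \<mu> *\<^sub>R f)" and t: "0 \<le> t"
  shows "T t f = exp (- \<mu> * t) *\<^sub>R f"
proof (cases "f = 0 \<or> t = 0")
  case True
  then show ?thesis using t g by (auto simp: T_0 gen_def)
next
  case False
  then have f0: "f \<noteq> 0" and t: "0 < t" using t by auto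
  have \<mu>: "0 \<le> \<mu>" using eigen_nonneg[OF g f0] .
  have f: "f \<in> V" and l: "((\<lambda>t. (T t f - f) /\<^sub>R t) \<longlongrightarrow> - \<mu> *\<^sub>R f) (at_right 0)"
    using g by (auto simp: gen_def)
  have lim_h: "(\<lambda>n. t * inverse (real (Suc n))) \<longlonglongrightarrow> t * 0"
    by (intro tendsto_intros LIMSEQ_inverse_real_of_nat)
  then have "filterlim (\<lambda>n. t * inverse (real (Suc n))) (at_right 0) sequentially"
    using t by (auto simp: filterlim_at)
  from filterlim_compose[OF l this]
  have lim1: "(\<lambda>n. (T (t * inverse (real (Suc n))) f - f) /\<^sub>R (t * inverse (real (Suc n)))) \<longlonglongrightarrow> - \<mu> *\<^sub>R f"
      .
  define X where "X n = t * norm ((T (t * inverse (real (Suc n))) f - f) /\<^sub>R (t * inverse (real (Suc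
      n))) - (- \<mu> *\<^sub>R f))" for n
  have X: "X \<longlonglongrightarrow> t * norm (- \<mu> *\<^sub>R f - (- \<mu> *\<^sub>R f))"
    unfolding X_def by (intro tendsto_intros lim1)
  define a where "a n = 1 + (- \<mu> * t) / real (Suc n)" for n
  have "(\<lambda>n. (1 + (- \<mu> * t) / real n) ^ n) \<longlonglongrightarrow> exp (- \<mu> * t)"
    by (rule tendsto_exp_limit_sequentially)
  then have ea: "(\<lambda>n. a n ^ Suc n) \<longlonglongrightarrow> exp (- \<mu> * t)"
    unfolding a_def by (rule LIMSEQ_Suc)
  have "(\<lambda>n. X n + \<bar>a n ^ Suc n - exp (- \<mu> * t)\<bar> * norm f) \<longlonglongrightarrow> t * norm (- \<mu> *\<^sub>R f - (- \<mu> *\<^sub>R f))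
      + \<bar>exp (- \<mu> * t) - exp (- \<mu> * t)\<bar> * norm f"
    by (intro tendsto_intros X ea)
  moreover have "eventually (\<lambda>n. norm (T t f - exp (- \<mu> * t) *\<^sub>R f) \<le> X n
      + \<bar>a n ^ Suc n - exp (- \<mu> * t)\<bar> * norm f) sequentially"
  proof -
    obtain n0 where n0: "\<mu> * t \<le> real n0" using real_arch_simple by blast
    show ?thesis
    proof (rule eventually_sequentiallyI[of n0])
      fix n assume "n0 \<le> n"
      then have n: "\<mu> * t \<le> real (Suc n)" using n0 by linarith
      define h where "h = t / real (Suc n)"
      have h: "0 < h" "real (Suc n) * h = t" using t by (auto simp: h_def)
      have "0 \<le> a n" "a n \<le> 1" using n \<mu> t by (auto simp: a_def field_simps)
      then have a1: "\<bar>a n\<bar> \<le> 1" by simp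
      have ah: "a n = 1 - \<mu> * h" by (simp add: a_def h_def)
      have "norm (T t f - a n ^ Suc n *\<^sub>R f) \<le> real (Suc n) * norm (T h f - a n *\<^sub>R f)"
        using T_power_diff[of h "a n" f "Suc n"] h a1 f by simp
      also have "\<dots> = X n"
      proof -
        have "T h f - a n *\<^sub>R f = h *\<^sub>R ((T h f - f) /\<^sub>R h - (- \<mu> *\<^sub>R f))"
          unfolding ah using h by (simp add: algebra_simps)
        then show ?thesis unfolding X_def using h
          by (simp add: h_def divide_inverse del: of_nat_Suc)
      qed
      finally have 1: "norm (T t f - a n ^ Suc n *\<^sub>R f) \<le> X n" .
      have 2: "norm (a n ^ Suc n *\<^sub>R f - exp (- \<mu> * t) *\<^sub>R f) = \<bar>a n ^ Suc n - exp (- \<mu> * t)\<bar> * norm f"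
        by (simp only: scaleR_diff_left[symmetric] norm_scaleR)
      show "norm (T t f - exp (- \<mu> * t) *\<^sub>R f) \<le> X n + \<bar>a n ^ Suc n - exp (- \<mu> * t)\<bar> * norm f"
        using norm_triangle_le[OF add_mono[OF 1 eq_refl[OF 2]]] by simp
    qed
  qed
  ultimately have "norm (T t f - exp (- \<mu> * t) *\<^sub>R f) \<le> t * norm (- \<mu> *\<^sub>R f - (- \<mu> *\<^sub>R f))
      + \<bar>exp (- \<mu> * t) - exp (- \<mu> * t)\<bar> * norm f"
    by (rule tendsto_lowerbound) simp
  then show ?thesis by simp
qed

lemma gen_if_T_exp:
  assumes u: "u \<in> V" and T: "\<And>s. 0 \<le> s \<Longrightarrow> T s u = exp (- \<mu> * s) *\<^sub>R u"
  shows "gen u (- \<mu> *\<^sub>R u)"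
proof -
  have "((\<lambda>s. exp (- \<mu> * s)) has_field_derivative (- \<mu>)) (at 0)"
    by (auto intro!: derivative_eq_intros)
  then have "((\<lambda>s. (exp (- \<mu> * s) - 1) / s) \<longlongrightarrow> - \<mu>) (at 0)"
    by (simp add: has_field_derivative_iff)
  then have "((\<lambda>s. (exp (- \<mu> * s) - 1) / s) \<longlongrightarrow> - \<mu>) (at_right 0)"
    by (rule Lim_at_imp_Lim_at_within)
  then have "((\<lambda>s. ((exp (- \<mu> * s) - 1) / s) *\<^sub>R u) \<longlongrightarrow> - \<mu> *\<^sub>R u) (at_right 0)"
    by (intro tendsto_intros)
  then have "((\<lambda>t. (T t u - u) /\<^sub>R t) \<longlongrightarrow> - \<mu> *\<^sub>R u) (at_right 0)"
  proof (rule Lim_transform_eventually)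
    show "eventually (\<lambda>s. ((exp (- \<mu> * s) - 1) / s) *\<^sub>R u = (T s u - u) /\<^sub>R s) (at_right 0)"
      using eventually_at_right_less[of "0::real"]
    proof eventually_elim
      case (elim s)
      have "T s u - u = (exp (- \<mu> * s) - 1) *\<^sub>R u" using T[of s] elim by (simp add: scaleR_diff_left)
      then show ?case by (simp add: divide_inverse mult.commute)
    qed
  qed
  then show ?thesis using u by (simp add: gen_def)
qed

text \<open>An eigenfunction for 0 would be fixed by every \<open>T t\<close>. As \<open>t\<close>
  grows the supremum of the heat kernel tends to 0, and the kernel bound forces the function to
  vanish. The size of the cells presupposes a positive eigenvalue.\<close>

lemma eigen_pos:
  assumes g: "gen f (- \<mu> *\<^sub>R f)" and f0: "f \<noteq> 0"
  shows "0 < \<mu>"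
proof (rule ccontr)
  assume "\<not> 0 < \<mu>"
  then have \<mu>: "\<mu> = 0" using eigen_nonneg[OF g f0] by simp
  have f: "f \<in> V" using g by (simp add: gen_def)
  have "AE x in lebesgue. cmod (rep_L2 f x) \<le> s * (1 + (norm f)\<^sup>2)" if s: "0 < s" for s
  proof -
    have "((\<lambda>t. (4 * pi * t) powr (- (real DIM('a) / 2))) \<longlongrightarrow> 0) at_top"
    proof (rule tendsto_neg_powr)
      show "filterlim (\<lambda>t. 4 * pi * t) at_top at_top"
        by (rule filterlim_tendsto_pos_mult_at_top[OF tendsto_const _ filterlim_ident]) simp
    qed (simp add: DIM_positive)
    then have "eventually (\<lambda>t. (4 * pi * t) powr (- (real DIM('a) / 2)) < s\<^sup>2) at_top"
      by (rule order_tendstoD) (use s in simp)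
    then have "eventually (\<lambda>t. (4 * pi * t) powr (- (real DIM('a) / 2)) < s\<^sup>2 \<and> 0 < t) at_top"
      using eventually_gt_at_top[of 0] by (rule eventually_conj)
    then obtain t where tK: "(4 * pi * t) powr (- (real DIM('a) / 2)) < s\<^sup>2" and t: "0 < t"
      by (auto dest: eventually_happens simp: trivial_limit_at_top_linorder)
    have Tf: "T t f = f" using T_eigen[OF g, of t] t \<mu> by simp
    show ?thesis using cmod_T_le[OF t f] unfolding Tf
    proof eventually_elim
      case (elim x)
      have [measurable]: "(\<lambda>y. heat_kernel t (x - y)) \<in> borel_measurable lebesgue"
        by (rule measurable_lebesgue_diff) measurable
      note elim
      also have "(\<integral>\<^sup>+y. ennreal (heat_kernel t (x - y)) * ennreal (cmod (rep_L2 f y)) \<partial>lebesgue)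
          \<le> (\<integral>\<^sup>+y. ennreal s * ennreal (heat_kernel t (x - y))
              + ennreal s * ennreal ((cmod (rep_L2 f y))\<^sup>2) \<partial>lebesgue)"
      proof (intro nn_integral_mono)
        fix y
        let ?k = "heat_kernel t (x - y)" and ?a = "cmod (rep_L2 f y)"
        have k: "0 \<le> ?k" "?k \<le> s\<^sup>2" using heat_kernel_le[OF t, of "x - y"] tK
            by (auto simp: heat_kernel_nonneg)
        \<comment> \<open>Where \<open>?a \<le> s\<close> the first summand suffices; elsewhere
          \<open>?k \<le> s\<^sup>2\<close> gives
          \<open>?k * ?a \<le> s\<^sup>2 * ?a \<le> s * ?a\<^sup>2\<close>. This is why
          \<open>t\<close> was chosen to push the kernel below \<open>s\<^sup>2\<close>.\<close>
        have "?k * ?a \<le> s * ?k + s * ?a\<^sup>2"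
        proof (cases "?a \<le> s")
          case True
          then have "?k * ?a \<le> ?k * s" using k by (intro mult_left_mono)
          moreover have "0 \<le> s * ?a\<^sup>2" using s by simp
          ultimately show ?thesis by (simp add: mult.commute)
        next
          case False
          have "?k * ?a \<le> s\<^sup>2 * ?a" using k by (intro mult_right_mono) auto
          also have "\<dots> = s * (s * ?a)" by (simp add: power2_eq_square)
          also have "\<dots> \<le> s * (?a * ?a)" using False s by (intro mult_left_mono mult_right_mono) auto
          finally show ?thesis using k s by (simp add: power2_eq_square add_increasing)
        qed
        then show "ennreal ?k * ennreal ?a \<le> ennreal s * ennreal ?k + ennreal s * ennreal (?a\<^sup>2)"
          using k s by (simp add: ennreal_leI flip: ennreal_mult ennreal_plus)
      qed
      also have "\<dots> = ennreal s * 1 + ennreal s * ennreal ((norm f)\<^sup>2)"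
        unfolding nn_integral_rep_sq[symmetric] nn_integral_heat_kernel_diff(1)[OF t, of x, symmetric]
        by (subst nn_integral_add) (auto simp: nn_integral_cmult)
      also have "\<dots> = ennreal (s * (1 + (norm f)\<^sup>2))"
        using s by (simp add: distrib_left ennreal_plus ennreal_mult)
      finally show ?case using s by (subst (asm) ennreal_le_iff) auto
    qed
  qed
  then have "AE x in lebesgue. \<forall>n. cmod (rep_L2 f x) \<le> inverse (real (Suc n)) * (1 + (norm f)\<^sup>2)"
    by (subst AE_all_countable) simp
  then have "AE x in lebesgue. rep_L2 f x = rep_L2 0 x"
    using rep_zero_AE
  proof eventually_elim
    case (elim x)
    have "(\<lambda>n. inverse (real (Suc n)) * (1 + (norm f)\<^sup>2)) \<longlonglongrightarrow> 0 * (1 + (norm f)\<^sup>2)"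
      by (intro tendsto_mult LIMSEQ_inverse_real_of_nat tendsto_const)
    then have "cmod (rep_L2 f x) \<le> 0 * (1 + (norm f)\<^sup>2)"
      by (rule tendsto_lowerbound) (use elim in auto)
    then show ?case using elim by simp
  qed
  then have "f = 0" by (rule L2_eqI)
  then show False using f0 by simp
qed

end

section \<open>Compactness of the semigroup\<close>

text \<open>Gaussian elimination, by induction on the equations: an unknown \<open>p\<close> with
  nonzero coefficient in equation \<open>q\<close> is eliminated from the others and recovered at
  the end. In the min-max argument this yields a combination of trial functions orthogonal to all
  low eigenfunctions.\<close>

lemma underdetermined_system_solution:
  fixes a :: "'i \<Rightarrow> 'o \<Rightarrow> 'f::field"
  assumes "finite Q" "finite F" "card Q < card F"
  shows "\<exists>c. (\<exists>j\<in>F. c j \<noteq> 0) \<and> (\<forall>q\<in>Q. (\<Sum>j\<in>F. c j * a j q) = 0)"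
  using assms
proof (induction Q arbitrary: F a rule: finite_induct)
  case empty
  then show ?case by (auto intro!: exI[of _ "\<lambda>_. 1"] simp: card_gt_0_iff)
next
  case (insert q Q)
  show ?case
  proof (cases "\<forall>j\<in>F. a j q = 0")
    case True
    have "card Q < card F" using insert by simp
    from insert.IH[OF insert.prems(1) this, of a] True show ?thesis by auto
  next
    case False
    then obtain p where p: "p \<in> F" "a p q \<noteq> 0" by auto
    have "card Q < card (F - {p})" using insert p by simp
    from insert.IH[OF _ this, of "\<lambda>j r. a j r - a j q / a p q * a p r"] insert.prems
    obtain c where c: "\<exists>j\<in>F - {p}. c j \<noteq> 0"
      "\<And>r. r \<in> Q \<Longrightarrow> (\<Sum>j\<in>F - {p}. c j * (a j r - a j q / a p q * a p r)) = 0" by auto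
    define d where "d = (\<Sum>j\<in>F - {p}. c j * a j q) / a p q"
    define c' where "c' j = (if j = p then - d else c j)" for j
    have sum: "(\<Sum>j\<in>F. c' j * a j r) = - d * a p r + (\<Sum>j\<in>F - {p}. c j * a j r)" for r
      unfolding sum.remove[OF insert.prems(1) p(1), of "\<lambda>j. c' j * a j r"]
      by (simp add: c'_def)
    have "(\<Sum>j\<in>F. c' j * a j r) = 0" if "r \<in> Q" for r
    proof -
      have "(\<Sum>j\<in>F - {p}. c j * (a j r - a j q / a p q * a p r))
          = (\<Sum>j\<in>F - {p}. c j * a j r) - (\<Sum>j\<in>F - {p}. c j * a j q) / a p q * a p r"
        by (simp add: sum_subtractf right_diff_distrib sum_distrib_right sum_divide_distrib mult.assoc)
      then show ?thesis unfolding sum using c(2)[OF that] by (simp add: d_def)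
    qed
    moreover have "(\<Sum>j\<in>F. c' j * a j q) = 0"
      unfolding sum using p(2) by (simp add: d_def)
    moreover have "\<exists>j\<in>F. c' j \<noteq> 0" using c(1) by (auto simp: c'_def)
    ultimately show ?thesis by (intro exI[of _ c']) auto
  qed
qed

lemma has_vector_derivative_quotient:
  assumes "(f has_vector_derivative D) (at x within S)"
  shows "((\<lambda>y. (f y - f x) /\<^sub>R (y - x)) \<longlongrightarrow> D) (at x within S)"
proof -
  have "((\<lambda>y. norm (f y - f x - (y - x) *\<^sub>R D) / norm (y - x)) \<longlongrightarrow> 0) (at x within S)"
    using assms unfolding has_vector_derivative_def has_derivative_iff_norm by blast
  moreover have "eventually (\<lambda>y. norm (f y - f x - (y - x) *\<^sub>R D) / norm (y - x)
      = norm ((f y - f x) /\<^sub>R (y - x) - D)) (at x within S)"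
    unfolding eventually_at_filter
  proof (intro always_eventually allI impI)
    fix y assume "y \<noteq> x"
    then have "(f y - f x) /\<^sub>R (y - x) - D = (f y - f x - (y - x) *\<^sub>R D) /\<^sub>R (y - x)"
      by (simp add: scaleR_diff_right)
    then show "norm (f y - f x - (y - x) *\<^sub>R D) / norm (y - x) = norm ((f y - f x) /\<^sub>R (y - x) - D)"
      by (simp add: divide_inverse mult.commute abs_inverse)
  qed
  ultimately have "((\<lambda>y. norm ((f y - f x) /\<^sub>R (y - x) - D)) \<longlongrightarrow> 0) (at x within S)"
    by (rule Lim_transform_eventually)
  then show ?thesis by (simp only: tendsto_norm_zero_iff LIM_zero_iff)
qed

section \<open>Continuity of orbits, density of the domain, and smoothing\<close>

context dominated_semigroup
begin

text \<open>Contractivity transports continuity at 0: the increment from \<open>r\<close> to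
  \<open>r + h\<close> is \<open>T r\<close> applied to \<open>T h f - f\<close>. Taking
  \<open>r\<close> to be the smaller of the two times gives continuity from the left as
  well.\<close>

lemma T_continuous_on:
  assumes f: "f \<in> V"
  shows "continuous_on {0..} (\<lambda>t. T t f)"
proof (unfold continuous_on_iff, intro ballI allI impI)
  fix s e :: real assume s: "s \<in> {0..}" and e: "0 < e"
  have "eventually (\<lambda>t. dist (T t f) f < e) (at_right 0)"
    using T_tendsto[OF f] e by (simp add: tendsto_iff)
  then obtain b where b: "0 < b" "\<And>t. 0 < t \<Longrightarrow> t < b \<Longrightarrow> dist (T t f) f < e"
    unfolding eventually_at_right_field by auto
  have main: "dist (T (r + h) f) (T r f) < e" if "0 \<le> r" "0 \<le> h" "h < b" for r h
  proof (cases "h = 0")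
    case False
    have "T (r + h) f - T r f = T r (T h f - f)"
      using that f by (simp add: T_diff T_in T_T)
    then have "dist (T (r + h) f) (T r f) \<le> dist (T h f) f"
      unfolding dist_norm using that f by (auto intro!: T_contraction L2_on_diff T_in)
    then show ?thesis using b(2)[of h] that False by simp
  qed (use e in simp)
  show "\<exists>d>0. \<forall>x'\<in>{0..}. dist x' s < d \<longrightarrow> dist (T x' f) (T s f) < e"
  proof (intro exI[of _ b] conjI ballI impI b(1))
    fix x' assume x': "x' \<in> {0..}" "dist x' s < b"
    show "dist (T x' f) (T s f) < e"
    proof (cases "s \<le> x'")
      case True
      then show ?thesis using main[of s "x' - s"] s x' by (simp add: dist_real_def)
    next
      case False
      then show ?thesis using main[of x' "s - x'"] s x' by (simp add: dist_real_def dist_commute)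
    qed
  qed
qed

lemma right_derivative_integral:
  fixes h :: "real \<Rightarrow> 'b::banach"
  assumes h: "continuous_on {0..} h" and x: "0 \<le> x"
  shows "((\<lambda>r. (integral {0..x + r} h - integral {0..x} h) /\<^sub>R r) \<longlongrightarrow> h x) (at_right 0)"
proof -
  have "((\<lambda>u. integral {0..u} h) has_vector_derivative h x) (at x within {0..x + 1})"
    using h x by (intro integral_has_vector_derivative continuous_on_subset[OF h]) auto
  then have "((\<lambda>y. (integral {0..y} h - integral {0..x} h) /\<^sub>R (y - x)) \<longlongrightarrow> h x) (at x within {0..x + 1})"
    by (rule has_vector_derivative_quotient)
  moreover have "filterlim (\<lambda>r. x + r) (at x within {0..x + 1}) (at_right 0)"
    unfolding filterlim_at
  proof
    show "((\<lambda>r. x + r) \<longlongrightarrow> x) (at_right 0)" by (auto intro!: tendsto_eq_intros)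
    show "eventually (\<lambda>r. x + r \<in> {0..x + 1} \<and> x + r \<noteq> x) (at_right 0)"
      by (rule eventually_mono[OF eventually_at_right_real[OF zero_less_one]]) (use x in auto)
  qed
  ultimately have "((\<lambda>r. (integral {0..x + r} h - integral {0..x} h) /\<^sub>R (x
      + r - x)) \<longlongrightarrow> h x) (at_right 0)"
    by (rule filterlim_compose)
  then show ?thesis by simp
qed

text \<open>\<open>T r\<close> shifts the interval of integration to [r, t + r], so the difference
  quotient of the integral becomes a difference of averages near \<open>t\<close> and near 0. These
  converge to the two boundary values of the orbit.\<close>

lemma gen_average:
  assumes f: "f \<in> V" and t: "0 < t"
  defines "I \<equiv> \<lambda>u. integral {0..u} (\<lambda>s. T s f)"
  shows "gen (I t /\<^sub>R t) ((T t f - f) /\<^sub>R t)"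
proof -
  let ?h = "\<lambda>s. T s f"
  note cont = T_continuous_on[OF f]
  have int: "?h integrable_on {0..u}" for u
    by (intro integrable_continuous_interval continuous_on_subset[OF cont]) auto
  have bl: "bounded_linear (mult_L2 (indicator \<Omega>))"
    by (rule bounded_linear_mult_L2[OF mult_L2_indicator(1)[OF Omega]])
  have V: "I u \<in> V" for u
  proof -
    have "I u = integral {0..u} (mult_L2 (indicator \<Omega>) \<circ> ?h)"
      unfolding I_def
      by (intro Henstock_Kurzweil_Integration.integral_cong)
        (use f in \<open>auto simp: mult_L2_indicator(3)[OF Omega] T_in\<close>)
    also have "\<dots> = mult_L2 (indicator \<Omega>) (I u)"
      unfolding I_def by (rule integral_linear[OF int bl])
    finally show ?thesis using mult_L2_indicator(2)[OF Omega, of "I u"] by simp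
  qed
  have TI: "T r (I t) = I (t + r) - I r" if r: "0 \<le> r" for r
  proof -
    \<comment> \<open>\<open>T r\<close> is linear on \<open>V\<close> only; preceded by the
      projection it becomes a bounded operator on the whole space, which may be exchanged with the
      integral.\<close>
    define S where "S g = T r (mult_L2 (indicator \<Omega>) g)" for g
    have blS: "bounded_linear S"
    proof (rule bounded_linear_intro[of _ 1])
      fix g k :: "'a L2" and c :: real
      have P: "mult_L2 (indicator \<Omega>) g \<in> V" for g by (rule mult_L2_indicator(2)[OF Omega])
      show "S (g + k) = S g + S k"
        unfolding S_def linear_add[OF bounded_linear.linear[OF bl]] using r P by (intro T_add)
      show "S (c *\<^sub>R g) = c *\<^sub>R S g"
        unfolding S_def linear_scale[OF bounded_linear.linear[OF bl]] using r P by (intro T_scaleR)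
      have "norm (S g) \<le> norm (mult_L2 (indicator \<Omega>) g)"
        unfolding S_def using r P by (intro T_contraction)
      also have "\<dots> \<le> norm g"
      proof -
        have "(norm (mult_L2 (indicator \<Omega>) g))\<^sup>2 \<le> (norm g)\<^sup>2"
          unfolding norm_sq_eq
          by (rule integral_mono_AE)
            (use rep_mult_AE[OF mult_L2_indicator(1)[OF Omega], of g] in
              \<open>auto simp: integrable_cmod_rep_sq norm_mult indicator_def\<close>)
        then show ?thesis by (rule power2_le_imp_le) simp
      qed
      finally show "norm (S g) \<le> norm g * 1" by simp
    qed
    have "T r (I t) = S (I t)" by (simp add: S_def mult_L2_indicator(3)[OF Omega V])
    also have "\<dots> = integral {0..t} (S \<circ> ?h)"
      unfolding I_def by (rule integral_linear[OF int blS, symmetric])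
    also have "\<dots> = integral {0..t} (\<lambda>s. ?h (r + s))"
      by (intro Henstock_Kurzweil_Integration.integral_cong)
        (use f r in \<open>auto simp: S_def mult_L2_indicator(3)[OF Omega] T_in T_T\<close>)
    also have "\<dots> = I (r + t) - I (r + 0)"
    proof (rule integral_unique, rule fundamental_theorem_of_calculus)
      fix x assume x: "x \<in> {0..t}"
      have "((\<lambda>u. I u) has_vector_derivative ?h (r + x)) (at (r + x) within {0..r + t})"
        unfolding I_def using x r
        by (intro integral_has_vector_derivative continuous_on_subset[OF cont]) auto
      then have "((\<lambda>u. I u) has_vector_derivative ?h (r + x)) (at (r + x) within (\<lambda>x. r + x) ` {0..t})"
        by (rule has_vector_derivative_within_subset) (use r in auto)
      then have "((\<lambda>u. I u) \<circ> (\<lambda>x. r + x) has_vector_derivative (1 *\<^sub>R ?h (r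
          + x))) (at x within {0..t})"
        by (intro vector_diff_chain_within) (auto intro!: derivative_eq_intros)
      then show "((\<lambda>x. I (r + x)) has_vector_derivative ?h (r + x)) (at x within {0..t})"
        by (simp add: comp_def)
    qed (use t in simp)
    finally show ?thesis by (simp add: add.commute)
  qed
  have I0: "I 0 = 0" by (simp add: I_def)
  have "((\<lambda>r. ((I (t + r) - I t) /\<^sub>R r - (I (0
      + r) - I 0) /\<^sub>R r) /\<^sub>R t) \<longlongrightarrow> (?h t - ?h 0) /\<^sub>R t) (at_right 0)"
    unfolding I_def by (intro tendsto_intros right_derivative_integral cont) (use t in auto)
  then have "((\<lambda>r. (T r (I t /\<^sub>R t) - I t /\<^sub>R t) /\<^sub>R r) \<longlongrightarrow> (T t f - f) /\<^sub>R t) (at_right 0)"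
    unfolding T_0[OF f]
  proof (rule Lim_transform_eventually)
    show "eventually (\<lambda>r. ((I (t + r) - I t) /\<^sub>R r - (I (0 + r) - I 0) /\<^sub>R r) /\<^sub>R t
        = (T r (I t /\<^sub>R t) - I t /\<^sub>R t) /\<^sub>R r) (at_right 0)"
      using eventually_at_right_less[of "0::real"]
    proof eventually_elim
      case (elim r)
      then show ?case using V by (simp add: T_scaleR TI I0 scaleR_diff_right scaleR_add_right
          algebra_simps)
    qed
  qed
  then show ?thesis using V by (simp add: gen_def L2_on_scaleR)
qed

lemma gen_dense:
  assumes f: "f \<in> V" and e: "0 < e"
  shows "\<exists>d g. gen d g \<and> norm (d - f) < e"
proof -
  have "((\<lambda>r. (integral {0..0 + r} (\<lambda>s. T s f) - integral {0..0} (\<lambda>s. T s f)) /\<^sub>R r) \<longlongrightarrow> T 0 f) (at_right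
      0)"
    by (intro right_derivative_integral T_continuous_on f) simp
  then have "((\<lambda>r. integral {0..r} (\<lambda>s. T s f) /\<^sub>R r) \<longlongrightarrow> f) (at_right 0)"
    by (simp add: T_0[OF f])
  then have "eventually (\<lambda>r. dist (integral {0..r} (\<lambda>s. T s f) /\<^sub>R r) f < e \<and> 0 < r) (at_right 0)"
    using e eventually_at_right_less[of "0::real"] by (auto simp: tendsto_iff intro: eventually_conj)
  then obtain r where "dist (integral {0..r} (\<lambda>s. T s f) /\<^sub>R r) f < e" "0 < r"
    by (auto dest: eventually_happens simp: trivial_limit_at_right_real)
  then show ?thesis using gen_average[OF f, of r] by (auto simp: dist_norm)
qed

text \<open>The spectral bound $x^{2n}(1-x^2)\le 1/n$ on $[0,1]$, for the contraction
  $x = e^{-hH}$, without functional calculus.\<close>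

lemma norm_T_diff_le:
  assumes h: "0 < h" and f: "f \<in> V" and n: "0 < n"
  shows "norm (T (real (2 * n) * h) (T (2 * h) f - f)) \<le> norm f / real n"
proof -
  define e where "e = T (2 * h) f - f"
  have e: "e \<in> V" unfolding e_def using h f by (intro L2_on_diff T_in) auto
  \<comment> \<open>\<open>A\<close> and \<open>B\<close> are nonincreasing, and \<open>B\<close> is
    the second difference of \<open>A\<close>, so \<open>A\<close> is convex. Convexity gives
    \<open>A n - A (Suc n) \<le> A 0 / real (Suc n)\<close>; summing \<open>n\<close> second
    differences, each at least \<open>B (2 * n)\<close>, gives
    \<open>real n * B (2 * n) \<le> A n - A (Suc n)\<close>. Together they bound
    \<open>B (2 * n)\<close> by \<open>A 0 / (real n)\<^sup>2\<close>.\<close>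
  define A where "A k = (norm (T (real k * h) f))\<^sup>2" for k :: nat
  define B where "B k = (norm (T (real k * h) e))\<^sup>2" for k :: nat
  have TV: "T (real k * h) g \<in> V" if "g \<in> V" for g k using h that by (intro T_in) auto
  have step: "T (real (Suc k) * h) g = T h (T (real k * h) g)" if "g \<in> V" for k g
    using h that by (subst T_T) (auto simp: algebra_simps)
  have Adec: "A (Suc k) \<le> A k" and Bdec: "B (Suc k) \<le> B k" for k
    unfolding A_def B_def step[OF f] step[OF e] using h TV f e
    by (auto intro!: power_mono T_contraction)
  have Bconv: "B k = A k - 2 * A (Suc k) + A (Suc (Suc k))" for k
  proof -
    define x where "x = T (real k * h) f"
    have x: "x \<in> V" unfolding x_def by (rule TV[OF f])
    have 1: "T (real (Suc k) * h) f = T h x" unfolding x_def by (rule step[OF f])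
    have 2: "T (real (Suc (Suc k)) * h) f = T (2 * h) x"
      unfolding x_def using h f by (subst T_T) (auto simp: algebra_simps)
    have 3: "T (real k * h) e = T (2 * h) x - x"
      unfolding x_def e_def using h f by (simp add: T_diff T_in T_T add.commute)
    \<comment> \<open>Selfadjointness turns the cross term of the squared difference into the middle
      term \<open>A (Suc k)\<close>.\<close>
    have "cinner (T (2 * h) x) x = cinner (T h x) (T h x)"
      using h x T_T[of h h x] T_selfadjoint[of h "T h x" x] by (simp add: T_in)
    then have 4: "Re (cinner (T (2 * h) x) x) = (norm (T h x))\<^sup>2" by (simp add: cinner_self)
    show ?thesis unfolding A_def B_def 1 2 3 norm_diff_sq 4 by (simp add: x_def)
  qed
  have "real (Suc k) * (A k - A (Suc k)) \<le> A 0 - A (Suc k)" for k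
  proof (induction k)
    case (Suc k)
    have "0 \<le> B k" by (simp add: B_def)
    then have "A (Suc k) - A (Suc (Suc k)) \<le> A k - A (Suc k)" unfolding Bconv by simp
    then have "real (Suc k) * (A (Suc k) - A (Suc (Suc k))) \<le> real (Suc k) * (A k - A (Suc k))"
      by (intro mult_left_mono) auto
    with Suc show ?case by (simp add: algebra_simps)
  qed simp
  from this[of n] have An: "real (Suc n) * (A n - A (Suc n)) \<le> A 0"
    by (rule order_trans) (simp add: A_def)
  have "A (n + m) - A (Suc (n + m)) \<le> A n - A (Suc n) - real m * B (n + m)" for m
  proof (induction m)
    case (Suc m)
    have "real m * B (n + Suc m) \<le> real m * B (n + m)"
      using Bdec[of "n + m"] by (intro mult_left_mono) auto
    moreover have "A (n + Suc m) - A (Suc (n + Suc m)) = A (n + m) - A (Suc (n + m)) - B (n + m)"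
      using Bconv[of "n + m"] by simp
    moreover have "B (n + Suc m) \<le> B (n + m)" using Bdec[of "n + m"] by simp
    ultimately show ?case using Suc by (simp add: algebra_simps)
  qed simp
  from this[of n] have "real n * B (n + n) \<le> A n - A (Suc n)"
    using Adec[of "n + n"] by simp
  then have "real n * (real n * B (n + n)) \<le> real n * (A n - A (Suc n))"
    by (intro mult_left_mono) auto
  also have "\<dots> \<le> real (Suc n) * (A n - A (Suc n))"
    using Adec[of n] by (intro mult_right_mono) auto
  also have "\<dots> \<le> A 0" by (rule An)
  finally have "(real n)\<^sup>2 * B (2 * n) \<le> A 0" by (simp add: power2_eq_square mult.assoc mult_2)
  then have "(real n * norm (T (real (2 * n) * h) e))\<^sup>2 \<le> (norm f)\<^sup>2"
    using f by (simp add: A_def B_def power_mult_distrib T_0)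
  then have "real n * norm (T (real (2 * n) * h) e) \<le> norm f" by (rule power2_le_imp_le) simp
  then show ?thesis using n unfolding e_def by (simp add: field_simps)
qed

text \<open>Smoothing, as for an analytic semigroup. With 2h = s / n, \<open>norm_T_diff_le\<close>
  bounds \<open>T s\<close> applied to the increment of \<open>d\<close> over time 2h by
  \<open>norm d / real n\<close>; division by 2h leaves \<open>norm d / s\<close>, uniformly in
  n.\<close>

lemma norm_T_gen_le:
  assumes g: "gen d g" and s: "0 < s"
  shows "norm (T s g) \<le> norm d / s"
proof -
  have d: "d \<in> V" and l: "((\<lambda>t. (T t d - d) /\<^sub>R t) \<longlongrightarrow> g) (at_right 0)"
    using g by (auto simp: gen_def)
  have gV: "g \<in> V" using gen_range[OF g] .
  have "(\<lambda>n. s * inverse (real (Suc n))) \<longlonglongrightarrow> s * 0"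
    by (intro tendsto_intros LIMSEQ_inverse_real_of_nat)
  then have "filterlim (\<lambda>n. s * inverse (real (Suc n))) (at_right 0) sequentially"
    using s by (auto simp: filterlim_at)
  from filterlim_compose[OF l this]
  have lim: "(\<lambda>n. (T (s * inverse (real (Suc n))) d - d) /\<^sub>R (s * inverse (real (Suc n)))) \<longlonglongrightarrow> g"
    (is "?X \<longlonglongrightarrow> g") .
  have XV: "?X n \<in> V" for n using s d by (intro L2_on_scaleR L2_on_diff T_in) auto
  have "norm (T s g) \<le> norm d / s + norm (?X n - g)" for n
  proof -
    let ?h = "s * inverse (real (Suc n)) / 2"
    have "norm (T (real (2 * Suc n) * ?h) (T (2 * ?h) d - d)) \<le> norm d / real (Suc n)"
      by (rule norm_T_diff_le) (use s d in auto)
    moreover have "real (2 * Suc n) * ?h = s" by (simp add: field_simps)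
    moreover have "2 * ?h = s * inverse (real (Suc n))" by simp
    ultimately have 1: "norm (T s (T (s * inverse (real (Suc n))) d - d)) \<le> norm d / real (Suc n)"
        by metis
    have "norm (T s (?X n)) = norm (T s (T (s * inverse (real (Suc n))) d - d)) / (s * inverse (real
        (Suc n)))"
      using s d by (subst T_scaleR) (auto intro!: L2_on_diff T_in simp: divide_inverse mult.commute
          abs_mult)
    also have "\<dots> \<le> (norm d / real (Suc n)) / (s * inverse (real (Suc n)))"
      using s by (intro divide_right_mono 1) auto
    also have "\<dots> = norm d / s" using s by (simp add: divide_inverse mult_ac del: of_nat_Suc)
    finally have 2: "norm (T s (?X n)) \<le> norm d / s" .
    have "norm (T s (?X n - g)) \<le> norm (?X n - g)"
      by (intro T_contraction L2_on_diff XV gV) (use s in simp)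
    moreover have "T s g = T s (?X n) - T s (?X n - g)"
      using s XV[of n] gV by (simp add: T_diff)
    ultimately show ?thesis using 2 norm_triangle_ineq4[of "T s (?X n)" "T s (?X n - g)"] by simp
  qed
  moreover have "(\<lambda>n. norm d / s + norm (?X n - g)) \<longlonglongrightarrow> norm d / s + norm (g - g)"
    by (intro tendsto_intros lim)
  ultimately have "norm (T s g) \<le> norm d / s + norm (g - g)"
    by (intro tendsto_lowerbound[of _ _ sequentially]) auto
  then show ?thesis by simp
qed

lemma gen_T:
  assumes g: "gen d g" and s: "0 \<le> s"
  shows "gen (T s d) (T s g)"
proof -
  have d: "d \<in> V" and l: "((\<lambda>t. (T t d - d) /\<^sub>R t) \<longlongrightarrow> g) (at_right 0)"
    using g by (auto simp: gen_def)
  have gV: "g \<in> V" using gen_range[OF g] .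
  have "((\<lambda>t. norm ((T t d - d) /\<^sub>R t - g)) \<longlongrightarrow> norm (g - g)) (at_right 0)"
    by (intro tendsto_intros l)
  then have z: "((\<lambda>t. norm ((T t d - d) /\<^sub>R t - g)) \<longlongrightarrow> 0) (at_right 0)" by simp
  have "((\<lambda>t. (T t (T s d) - T s d) /\<^sub>R t - T s g) \<longlongrightarrow> 0) (at_right 0)"
  proof (rule Lim_null_comparison[OF _ z])
    show "eventually (\<lambda>t. norm ((T t (T s d) - T s d) /\<^sub>R t - T s g)
        \<le> norm ((T t d - d) /\<^sub>R t - g)) (at_right 0)"
      using eventually_at_right_less[of "0::real"]
    proof eventually_elim
      case (elim t)
      have V: "T t d - d \<in> V" using elim d by (intro L2_on_diff T_in) auto
      have "(T t (T s d) - T s d) /\<^sub>R t - T s g = T s ((T t d - d) /\<^sub>R t - g)"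
        using elim s d gV V by (simp add: T_diff T_scaleR T_in T_T L2_on_scaleR add.commute)
      then show ?case using s V gV by (auto intro!: T_contraction L2_on_diff L2_on_scaleR)
    qed
  qed
  then show ?thesis using d s by (simp add: gen_def T_in LIM_zero_iff)
qed

end

locale compact_dominated_semigroup = dominated_semigroup \<Omega> T
  for \<Omega> :: "'a::euclidean_space set" and T :: "real \<Rightarrow> 'a L2 \<Rightarrow> 'a L2" +
  fixes H :: "('a L2 \<times> 'a L2) set"
  assumes generator: "generator_on (L2_on \<Omega>) T = {(f, - g) | f g. (f, g) \<in> H}"
    and compact_res: "compact_resolvent_on (L2_on \<Omega>) H"
begin

lemma H_iff: "(f, g) \<in> H \<longleftrightarrow> gen f (- g)"
proof -
  have "gen f (- g) \<longleftrightarrow> (f, - g) \<in> generator_on (L2_on \<Omega>) T"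
    by (simp add: gen_def generator_on_def)
  also have "\<dots> \<longleftrightarrow> (f, g) \<in> H" unfolding generator by auto
  finally show ?thesis by simp
qed

lemma eigenspace_iff: "f \<in> eigenspace H \<mu> \<longleftrightarrow> gen f (- \<mu> *\<^sub>R f)"
  by (simp add: eigenspace_def H_iff scaleR_scaleC_L2)

text \<open>If \<open>gen d g\<close>, then \<open>T s d\<close> is the resolvent applied to \<mu>
  times \<open>T s d\<close> plus \<open>T s g\<close>, and \<open>norm_T_gen_le\<close> bounds that
  argument in terms of \<open>norm d\<close>. So the compactness of the resolvent passes to
  \<open>T s\<close> on the domain, and density of the domain extends it to arbitrary sequences in
  the unit ball.\<close>

lemma T_compact:
  fixes v :: "nat \<Rightarrow> 'a L2"
  assumes s: "0 < s" and v: "\<And>n. v n \<in> V" "\<And>n. norm (v n) \<le> 1"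
  shows "\<exists>l r. strict_mono r \<and> (\<lambda>n. T s (v (r n))) \<longlonglongrightarrow> l"
proof -
  obtain \<mu> R where R: "is_resolvent_on V H \<mu> R" and K: "compact (closure (R ` {f \<in> V. norm f \<le> 1}))"
    using compact_res by (auto simp: compact_resolvent_on_def)
  have "\<exists>d g. gen d g \<and> norm (d - v n) < inverse (real (Suc n))" for n
    by (rule gen_dense) (use v in auto)
  then obtain d g where dg: "\<And>n. gen (d n) (g n)" "\<And>n. norm (d n - v n) < inverse (real (Suc n))"
      by metis
  have dV: "d n \<in> V" for n using dg(1)[of n] by (simp add: gen_def)
  have d2: "norm (d n) \<le> 2" for n
  proof -
    have "norm (d n) \<le> norm (d n - v n) + norm (v n)" using norm_triangle_ineq[of "d n - v n" "v n"]
        by simp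
    also have "\<dots> \<le> inverse (real (Suc n)) + 1" using dg(2)[of n] v(2)[of n] by simp
    also have "\<dots> \<le> 2" by (simp add: inverse_le_1_iff)
    finally show ?thesis .
  qed
  \<comment> \<open>\<open>C\<close> bounds the norms of the vectors \<open>f n\<close>, from
    \<open>norm (d n) \<le> 2\<close> and smoothing; division by \<open>C\<close> brings them into
    the unit ball.\<close>
  define C where "C = 2 * cmod \<mu> + 2 / s + 1"
  have C: "0 < C" using s by (simp add: C_def add_nonneg_pos)
  define f where "f n = \<mu> *\<^sub>C T s (d n) + T s (g n)" for n
  have fV: "f n \<in> V" for n
    unfolding f_def using s dV gen_range[OF dg(1)] by (intro L2_on_add L2_on_scaleC T_in) auto
  have fC: "norm (f n) \<le> C" for n
  proof -
    have "norm (f n) \<le> cmod \<mu> * norm (T s (d n)) + norm (T s (g n))"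
      unfolding f_def using norm_triangle_ineq[of "\<mu> *\<^sub>C T s (d n)"] by simp
    also have "\<dots> \<le> cmod \<mu> * 2 + 2 / s"
    proof (intro add_mono mult_left_mono)
      show "norm (T s (d n)) \<le> 2" using T_contraction[of s "d n"] s dV d2[of n]
          by (auto intro: order_trans)
      show "norm (T s (g n)) \<le> 2 / s"
        using norm_T_gen_le[OF dg(1) s, of n] divide_right_mono[OF d2[of n], of s] s by linarith
    qed auto
    finally show ?thesis by (simp add: C_def)
  qed
  have Rf: "T s (d n) = R (f n)" for n
  proof -
    have "gen (T s (d n)) (- (- T s (g n)))" using gen_T[OF dg(1), of s n] s by simp
    then have "(T s (d n), - T s (g n)) \<in> H" by (simp only: H_iff)
    moreover have "\<mu> *\<^sub>C T s (d n) - - T s (g n) = f n" by (simp add: f_def)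
    ultimately show ?thesis using R fV[of n] unfolding is_resolvent_on_def by blast
  qed
  have "R (f n) = of_real C *\<^sub>C R (of_real (1 / C) *\<^sub>C f n)" for n
  proof -
    have "R (of_real (1 / C) *\<^sub>C f n) = of_real (1 / C) *\<^sub>C R (f n)"
      using R fV[of n] by (auto simp: is_resolvent_on_def bounded_operator_on_def)
    then show ?thesis using C by (simp flip: of_real_mult)
  qed
  then have TR: "T s (d n) = C *\<^sub>R R (of_real (1 / C) *\<^sub>C f n)" for n
    by (simp add: Rf scaleR_scaleC_L2)
  have "R (of_real (1 / C) *\<^sub>C f n) \<in> closure (R ` {f \<in> V. norm f \<le> 1})" for n
    using fV[of n] fC[of n] C by (intro subsetD[OF closure_subset] imageI) (auto simp: L2_on_scaleC
        norm_divide)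
  then obtain l r where r: "strict_mono r" and l: "((\<lambda>n. R (of_real (1 / C) *\<^sub>C f n)) \<circ> r) \<longlonglongrightarrow> l"
    using K unfolding compact_def by (metis (no_types, lifting))
  have "(\<lambda>n. C *\<^sub>R R (of_real (1 / C) *\<^sub>C f (r n))) \<longlonglongrightarrow> C *\<^sub>R l"
    using l by (intro tendsto_intros) (simp add: comp_def)
  then have lim1: "(\<lambda>n. T s (d (r n))) \<longlonglongrightarrow> C *\<^sub>R l" by (simp only: TR)
  have "(\<lambda>n. T s (v n) - T s (d n)) \<longlonglongrightarrow> 0"
  proof (rule Lim_null_comparison[OF _ LIMSEQ_inverse_real_of_nat])
    have "norm (T s (v n) - T s (d n)) \<le> inverse (real (Suc n))" for n
    proof -
      have "norm (T s (v n) - T s (d n)) = norm (T s (v n - d n))"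
        using s v dV by (simp add: T_diff)
      also have "\<dots> \<le> norm (v n - d n)" using s v dV by (intro T_contraction L2_on_diff) auto
      also have "\<dots> \<le> inverse (real (Suc n))" using dg(2)[of n] by (simp add: norm_minus_commute)
      finally show ?thesis .
    qed
    then show "eventually (\<lambda>n. norm (T s (v n) - T s (d n)) \<le> inverse (real (Suc n))) sequentially"
      by simp
  qed
  then have "(\<lambda>n. T s (v (r n)) - T s (d (r n))) \<longlonglongrightarrow> 0"
    using LIMSEQ_subseq_LIMSEQ[OF _ r] by (fastforce simp: comp_def)
  from tendsto_add[OF this lim1] have "(\<lambda>n. T s (v (r n))) \<longlonglongrightarrow> C *\<^sub>R l" by simp
  then show ?thesis using r by blast
qed

end

section \<open>The spectral bound and the min-max principle\<close>

context compact_dominated_semigroup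
begin

lemma T_inner_half:
  assumes "0 \<le> t" "f \<in> V"
  shows "cinner (T t f) f = of_real ((norm (T (t / 2) f))\<^sup>2)"
  using T_T[of "t / 2" "t / 2" f] T_selfadjoint[of "t / 2" "T (t / 2) f" f] assms
  by (simp add: T_in cinner_self)

lemma norm_T_normalized:
  assumes "0 \<le> s" "v \<in> V"
  shows "norm (T s (v /\<^sub>R norm v)) = norm (T s v) / norm v"
  unfolding T_scaleR[OF assms] norm_scaleR by (simp add: inverse_eq_divide)

text \<open>On \<open>u\<close> the product (T(r) + c)(T(r) - c) vanishes. As \<open>T r\<close> is
  a positive operator, being the square of \<open>T (r / 2)\<close>, it cannot have the eigenvalue
  -c, so the second factor already kills \<open>u\<close>.\<close>

lemma T_sqrt_eigen:
  assumes r: "0 \<le> r" and c: "0 < c" and u: "u \<in> V" and T: "T (2 * r) u = c\<^sup>2 *\<^sub>R u"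
  shows "T r u = c *\<^sub>R u"
proof -
  define y where "y = T r u - c *\<^sub>R u"
  have y: "y \<in> V" unfolding y_def using r u by (intro L2_on_diff L2_on_scaleR T_in)
  have "T r y = T (2 * r) u - c *\<^sub>R T r u"
    unfolding y_def using r u by (simp add: T_diff T_in L2_on_scaleR T_T T_scaleR)
  then have "T r y = - c *\<^sub>R y"
    unfolding T y_def by (simp add: scaleR_diff_right power2_eq_square)
  then have "Re (cinner (T r y) y) = - c * (norm y)\<^sup>2"
    by (simp add: scaleR_scaleC_L2 cinner_scaleC_left cinner_self flip: of_real_power of_real_mult
        of_real_minus)
  moreover have "0 \<le> Re (cinner (T r y) y)" using T_inner_half[OF r y] by simp
  ultimately have "norm y = 0" using c by (simp add: mult_le_0_iff zero_le_mult_iff)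
  then show ?thesis by (simp add: y_def)
qed

text \<open>One time determines all: square roots carry the eigenvalue equation from
  \<open>t\<close> to \<open>t / 2 ^ n\<close>, powers to multiples of these times, and continuity
  of the orbit to every nonnegative time.\<close>

lemma gen_if_T_eigen:
  assumes t: "0 < t" and u: "u \<in> V" and T: "T t u = exp (- \<mu> * t) *\<^sub>R u"
  shows "gen u (- \<mu> *\<^sub>R u)"
proof (rule gen_if_T_exp[OF u])
  have dy: "T (t / 2 ^ n) u = exp (- \<mu> * (t / 2 ^ n)) *\<^sub>R u" for n
  proof (induction n)
    case (Suc n)
    have "exp (- \<mu> * (t / 2 ^ n)) = (exp (- \<mu> * (t / 2 ^ Suc n)))\<^sup>2"
      by (simp add: power2_eq_square flip: exp_add)
    moreover have "2 * (t / 2 ^ Suc n) = t / 2 ^ n" by simp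
    ultimately have "T (2 * (t / 2 ^ Suc n)) u = (exp (- \<mu> * (t / 2 ^ Suc n)))\<^sup>2 *\<^sub>R u"
      using Suc by simp
    then show ?case by (rule T_sqrt_eigen[OF _ _ u, rotated 2]) (use t in auto)
  qed (use T in simp)
  have mult: "T (real k * (t / 2 ^ n)) u = exp (- \<mu> * (real k * (t / 2 ^ n))) *\<^sub>R u" for k n
  proof (induction k)
    case 0
    show ?case using u by (simp add: T_0)
  next
    case (Suc k)
    have e: "real (Suc k) * (t / 2 ^ n) = t / 2 ^ n + real k * (t / 2 ^ n)"
      by (simp only: of_nat_Suc distrib_right mult_1_left)
    have "T (real (Suc k) * (t / 2 ^ n)) u = T (t / 2 ^ n) (T (real k * (t / 2 ^ n)) u)"
      unfolding e using t u by (intro T_T[symmetric]) auto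
    also have "\<dots> = exp (- \<mu> * (real k * (t / 2 ^ n))) *\<^sub>R exp (- \<mu> * (t / 2 ^ n)) *\<^sub>R u"
      unfolding Suc using t u by (subst T_scaleR) (auto simp: dy)
    also have "\<dots> = exp (- \<mu> * (real (Suc k) * (t / 2 ^ n))) *\<^sub>R u"
      unfolding e distrib_left exp_add by (simp only: scaleR_scaleR mult.commute)
    finally show ?case .
  qed
  fix s :: real assume s: "0 \<le> s"
  \<comment> \<open>\<open>X n\<close> is \<open>s\<close> rounded down to a multiple of
    \<open>t / 2 ^ n\<close>.\<close>
  define X where "X n = real (nat \<lfloor>s / (t / 2 ^ n)\<rfloor>) * (t / 2 ^ n)" for n
  have X: "0 \<le> X n" "X n \<le> s" "s - t / 2 ^ n \<le> X n" for n
  proof -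
    define q where "q = t / 2 ^ n"
    have q: "0 < q" using t by (simp add: q_def)
    have "0 \<le> s / q" using s q by simp
    then have "real (nat \<lfloor>s / q\<rfloor>) = of_int \<lfloor>s / q\<rfloor>" by simp
    then have k: "real (nat \<lfloor>s / q\<rfloor>) \<le> s / q" "s / q - 1 \<le> real (nat \<lfloor>s / q\<rfloor>)" by linarith+
    show "0 \<le> X n" using q by (simp add: X_def flip: q_def)
    show "X n \<le> s" using mult_right_mono[OF k(1), of q] q by (simp add: X_def flip: q_def)
    show "s - t / 2 ^ n \<le> X n" using mult_right_mono[OF k(2), of q] q
      by (simp add: X_def left_diff_distrib flip: q_def)
  qed
  have "(\<lambda>n. s - t * (1 / 2) ^ n) \<longlonglongrightarrow> s - t * 0"
    by (intro tendsto_intros LIMSEQ_power_zero) simp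
  then have Xs: "X \<longlonglongrightarrow> s"
    using X by (intro tendsto_sandwich[of "\<lambda>n. s - t * (1 / 2) ^ n" X sequentially "\<lambda>_. s"])
      (auto simp: power_divide)
  have "(\<lambda>n. T (X n) u) \<longlonglongrightarrow> T s u"
    by (rule continuous_on_tendsto_compose[OF T_continuous_on[OF u] Xs]) (use s X in auto)
  moreover have "(\<lambda>n. T (X n) u) \<longlonglongrightarrow> exp (- \<mu> * s) *\<^sub>R u"
    unfolding X_def mult unfolding X_def[symmetric] by (intro tendsto_intros Xs)
  ultimately show "T s u = exp (- \<mu> * s) *\<^sub>R u" by (rule LIMSEQ_unique)
qed

text \<open>A union of eigenspaces, not their span: orthogonality to either is the same, and each
  element keeps a definite eigenvalue.\<close>

definition low :: "real \<Rightarrow> 'a L2 set" where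
  "low \<Lambda> = (\<Union>\<mu>\<in>{..\<Lambda>}. eigenspace H \<mu>)"

lemma low_V: "u \<in> low \<Lambda> \<Longrightarrow> u \<in> V"
  by (auto simp: low_def eigenspace_iff gen_def)

lemma T_eigenspace: "u \<in> eigenspace H \<mu> \<Longrightarrow> 0 \<le> t \<Longrightarrow> T t u = exp (- \<mu> * t) *\<^sub>R u"
  by (simp add: eigenspace_iff T_eigen)

text \<open>The orthogonal complement \<open>M\<close> of the low eigenspaces is invariant under
  \<open>T\<close>. If the bound failed, the supremum \<open>p\<close> of the norm of
  \<open>T (t / 2)\<close> over unit vectors of \<open>M\<close> would be too large. By compactness
  of \<open>T t\<close> a maximising sequence has a subsequence converging to an eigenvector in
  \<open>M\<close>; its eigenvalue for H lies below \<Lambda>, so it would be orthogonal to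
  itself.\<close>

lemma spectral_bound:
  assumes w: "w \<in> V" and orth: "\<And>u. u \<in> low \<Lambda> \<Longrightarrow> cinner w u = 0" and t: "0 < t"
  shows "(norm (T (t / 2) w))\<^sup>2 \<le> exp (- \<Lambda> * t) * (norm w)\<^sup>2"
proof (rule ccontr)
  assume neg: "\<not> ?thesis"
  define M where "M = {v \<in> V. \<forall>u\<in>low \<Lambda>. cinner v u = 0}"
  have M_scale: "r *\<^sub>R v \<in> M" if "v \<in> M" for r v
    using that by (auto simp: M_def L2_on_scaleR scaleR_scaleC_L2 cinner_scaleC_left L2_on_scaleC)
  have M_T: "T s v \<in> M" if v: "v \<in> M" and s: "0 \<le> s" for v s
  proof -
    have "cinner (T s v) u = 0" if u: "u \<in> low \<Lambda>" for u
    proof -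
      obtain \<mu> where \<mu>: "u \<in> eigenspace H \<mu>" using u by (auto simp: low_def)
      have "cinner (T s v) u = cinner v (T s u)"
        using v s low_V[OF u] by (intro T_selfadjoint) (auto simp: M_def)
      then show ?thesis using v u
        by (simp add: T_eigenspace[OF \<mu> s] scaleR_scaleC_L2 cinner_scaleC_right M_def)
    qed
    then show ?thesis using v s by (auto simp: M_def T_in)
  qed
  have M_V: "v \<in> V" if "v \<in> M" for v using that by (simp add: M_def)
  have wM: "w \<in> M" using w orth by (simp add: M_def)
  have w0: "w \<noteq> 0" using neg t by auto
  let ?S = "T (t / 2)"
  define B where "B = {norm (?S v) | v. v \<in> M \<and> norm v = 1}"
  define p where "p = Sup B"
  have B_bdd: "bdd_above B"
    unfolding B_def bdd_above_def
    using T_contraction[of "t / 2"] t M_V by (intro exI[of _ 1]) fastforce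
  define w' where "w' = w /\<^sub>R norm w"
  have w': "w' \<in> M" "norm w' = 1" using wM w0 by (auto simp: w'_def intro: M_scale)
  have w'B: "norm (?S w') \<in> B" using w' by (auto simp: B_def)
  have w'p: "norm (?S w') \<le> p" unfolding p_def by (rule cSup_upper[OF w'B B_bdd])
  have "norm (?S w') = norm (?S w) / norm w"
    unfolding w'_def using t w by (intro norm_T_normalized) auto
  moreover have "exp (- \<Lambda> * t) < (norm (?S w) / norm w)\<^sup>2"
    using neg w0 by (simp add: power_divide pos_less_divide_eq not_le)
  ultimately have "exp (- \<Lambda> * t) < (norm (?S w'))\<^sup>2" by simp
  also have "\<dots> \<le> p\<^sup>2" using w'p by (intro power_mono) auto
  finally have p2: "exp (- \<Lambda> * t) < p\<^sup>2" .
  have p0: "0 < p"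
  proof -
    have "0 \<le> p" using w'p norm_ge_zero[of "?S w'"] by linarith
    moreover have "p \<noteq> 0" using p2 by (metis exp_gt_zero less_asym' power_zero_numeral)
    ultimately show ?thesis by simp
  qed
  have Sp: "norm (?S v) \<le> p * norm v" if v: "v \<in> M" for v
  proof (cases "v = 0")
    case False
    have "norm (?S (v /\<^sub>R norm v)) \<in> B" using False M_scale[OF v] by (auto simp: B_def)
    then have "norm (?S (v /\<^sub>R norm v)) \<le> p" unfolding p_def by (rule cSup_upper[OF _ B_bdd])
    moreover have "norm (?S (v /\<^sub>R norm v)) = norm (?S v) / norm v"
      using t M_V[OF v] by (intro norm_T_normalized) auto
    ultimately have "norm (?S v) / norm v \<le> p" by simp
    then show ?thesis using False by (simp add: pos_divide_le_eq)
  qed (use t in simp)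
  have "\<exists>v. v \<in> M \<and> norm v = 1 \<and> p - inverse (real (Suc n)) < norm (?S v)" for n
  proof -
    have "p - inverse (real (Suc n)) < Sup B" by (simp add: p_def[symmetric])
    then obtain b where "b \<in> B" "p - inverse (real (Suc n)) < b"
      using less_cSup_iff[of B] w'B B_bdd by auto
    then show ?thesis by (auto simp: B_def)
  qed
  then obtain v where v: "\<And>n. v n \<in> M" "\<And>n. norm (v n) = 1"
    "\<And>n. p - inverse (real (Suc n)) < norm (?S (v n))" by metis
  have Sv_p: "norm (?S (v n)) \<le> p" for n using Sp[OF v(1), of n] v(2) by simp
  have Sv_lim: "(\<lambda>n. norm (?S (v n))) \<longlonglongrightarrow> p"
  proof (rule tendsto_sandwich)
    show "(\<lambda>n. p - inverse (real (Suc n))) \<longlonglongrightarrow> p"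
      using tendsto_diff[OF tendsto_const LIMSEQ_inverse_real_of_nat, of p] by simp
    show "eventually (\<lambda>n. p - inverse (real (Suc n)) \<le> norm (?S (v n))) sequentially"
      using v(3) by (auto intro!: always_eventually less_imp_le)
    show "eventually (\<lambda>n. norm (?S (v n)) \<le> p) sequentially" using Sv_p by simp
  qed simp
  \<comment> \<open>A maximising sequence is asymptotically an eigenvector: \<open>T t\<close> is
    the square of \<open>?S\<close>, so the norm of \<open>T t (v n)\<close> is at most
    \<open>p\<close> times that of \<open>?S (v n)\<close>, and the cross term is
    \<open>p\<^sup>2 * (norm (?S (v n)))\<^sup>2\<close>.\<close>
  have diff_le: "(norm (T t (v n) - p\<^sup>2 *\<^sub>R v n))\<^sup>2 \<le> p\<^sup>2 * (p\<^sup>2 - (norm (?S (v n)))\<^sup>2)" for n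
  proof -
    have vV: "v n \<in> V" using v(1) M_V by simp
    have "T t (v n) = ?S (?S (v n))" using t vV by (simp add: T_T)
    then have "norm (T t (v n)) \<le> p * norm (?S (v n))"
      using Sp[OF M_T[OF v(1)], of "t / 2" n] t by simp
    then have "(norm (T t (v n)))\<^sup>2 \<le> (p * norm (?S (v n)))\<^sup>2" by (intro power_mono) auto
    moreover have "Re (cinner (T t (v n)) (p\<^sup>2 *\<^sub>R v n)) = p\<^sup>2 * (norm (?S (v n)))\<^sup>2"
      using T_inner_half[of t "v n"] t vV
      by (simp add: scaleR_scaleC_L2 cinner_scaleC_right flip: of_real_power of_real_mult)
    ultimately show ?thesis
      unfolding norm_diff_sq by (simp add: v(2) power_mult_distrib algebra_simps power2_eq_square)
  qed
  have "(\<lambda>n. p\<^sup>2 * (p\<^sup>2 - (norm (?S (v n)))\<^sup>2)) \<longlonglongrightarrow> p\<^sup>2 * (p\<^sup>2 - p\<^sup>2)"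
    by (intro tendsto_intros Sv_lim)
  then have "(\<lambda>n. p\<^sup>2 * (p\<^sup>2 - (norm (?S (v n)))\<^sup>2)) \<longlonglongrightarrow> 0" by simp
  then have "(\<lambda>n. (norm (T t (v n) - p\<^sup>2 *\<^sub>R v n))\<^sup>2) \<longlonglongrightarrow> 0"
    by (rule Lim_null_comparison[rotated]) (simp add: diff_le)
  then have "(\<lambda>n. sqrt ((norm (T t (v n) - p\<^sup>2 *\<^sub>R v n))\<^sup>2)) \<longlonglongrightarrow> sqrt 0"
    by (intro tendsto_intros)
  then have d0: "(\<lambda>n. T t (v n) - p\<^sup>2 *\<^sub>R v n) \<longlonglongrightarrow> 0"
    by (simp add: tendsto_norm_zero_iff)
  obtain l r where r: "strict_mono r" and l: "(\<lambda>n. T t (v (r n))) \<longlonglongrightarrow> l"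
    using T_compact[OF t, of v] v M_V by (metis order_refl)
  have d0r: "(\<lambda>n. T t (v (r n)) - p\<^sup>2 *\<^sub>R v (r n)) \<longlonglongrightarrow> 0"
    using LIMSEQ_subseq_LIMSEQ[OF d0 r] by (simp add: comp_def)
  \<comment> \<open>Both \<open>T t (v (r n))\<close> and \<open>p\<^sup>2 *\<^sub>R v (r n)\<close>
    tend to \<open>l\<close>; since \<open>p\<close> is positive, the vectors themselves converge,
    which compactness of \<open>T t\<close> alone would not give.\<close>
  define u where "u = l /\<^sub>R p\<^sup>2"
  have "(\<lambda>n. (T t (v (r n)) - (T t (v (r n)) - p\<^sup>2 *\<^sub>R v (r n))) /\<^sub>R p\<^sup>2) \<longlonglongrightarrow> (l - 0) /\<^sub>R p\<^sup>2"
    by (intro tendsto_intros l d0r)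
  then have vu: "(\<lambda>n. v (r n)) \<longlonglongrightarrow> u" using p0 by (simp add: u_def)
  have uV: "u \<in> V" by (rule L2_on_closed[OF Omega _ vu]) (use v M_V in auto)
  have uorth: "cinner u e = 0" if e: "e \<in> low \<Lambda>" for e
  proof -
    have "(\<lambda>n. cinner (v (r n)) e) \<longlonglongrightarrow> cinner u e" by (intro tendsto_cinner vu tendsto_const)
    moreover have "cinner (v (r n)) e = 0" for n using v(1)[of "r n"] e by (simp add: M_def)
    ultimately show ?thesis by (simp add: LIMSEQ_const_iff)
  qed
  have u1: "norm u = 1"
    using tendsto_norm[OF vu] v(2) by (simp add: LIMSEQ_const_iff)
  have "(\<lambda>n. T t (v (r n)) - T t u) \<longlonglongrightarrow> 0"
  proof (rule Lim_null_comparison)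
    show "eventually (\<lambda>n. norm (T t (v (r n)) - T t u) \<le> norm (v (r n) - u)) sequentially"
    proof (intro always_eventually allI)
      fix n
      have vV: "v (r n) \<in> V" using v(1) M_V by simp
      then have "T t (v (r n)) - T t u = T t (v (r n) - u)" using t uV by (simp add: T_diff)
      then show "norm (T t (v (r n)) - T t u) \<le> norm (v (r n) - u)"
        using t uV vV by (auto intro!: T_contraction L2_on_diff)
    qed
    show "(\<lambda>n. norm (v (r n) - u)) \<longlonglongrightarrow> 0"
      using vu by (simp add: LIM_zero_iff tendsto_norm_zero_iff)
  qed
  then have "(\<lambda>n. T t (v (r n))) \<longlonglongrightarrow> T t u" by (simp add: LIM_zero_iff)
  then have "T t u = l" using l by (rule LIMSEQ_unique)
  then have Tu: "T t u = p\<^sup>2 *\<^sub>R u" using p0 by (simp add: u_def)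
  define \<mu> where "\<mu> = - ln (p\<^sup>2) / t"
  have e\<mu>: "exp (- \<mu> * t) = p\<^sup>2" using t p0 by (simp add: \<mu>_def)
  have "gen u (- \<mu> *\<^sub>R u)" by (rule gen_if_T_eigen[OF t uV]) (simp only: e\<mu> Tu)
  moreover have "\<mu> \<le> \<Lambda>"
  proof -
    have "- \<Lambda> * t < - \<mu> * t" using p2 unfolding e\<mu>[symmetric] by (simp only: exp_less_cancel_iff)
    then show ?thesis using t by simp
  qed
  ultimately have "u \<in> low \<Lambda>" by (auto simp: low_def eigenspace_iff)
  from uorth[OF this] have "norm u = 0" by (simp add: cinner_self)
  then show False using u1 by simp
qed

section \<open>Counting eigenvalues and the min-max principle\<close>

lemma eigenspaces_orthogonal:
  assumes f: "f \<in> eigenspace H \<mu>" and g: "g \<in> eigenspace H \<nu>" and "\<mu> \<noteq> \<nu>"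
  shows "cinner f g = 0"
proof -
  have V: "f \<in> V" "g \<in> V" using f g by (auto simp: eigenspace_iff gen_def)
  have "cinner (T 1 f) g = cinner f (T 1 g)" using V by (intro T_selfadjoint) auto
  then have "of_real (exp (- \<mu>) - exp (- \<nu>)) * cinner f g = 0"
    using T_eigenspace[OF f, of 1] T_eigenspace[OF g, of 1]
    by (simp add: scaleR_scaleC_L2 cinner_scaleC_left cinner_scaleC_right algebra_simps)
  then show ?thesis using assms(3) by (simp flip: of_real_diff)
qed

text \<open>The eigenspace of H is also an eigenspace of the single operator \<open>T 1\<close>,
  where linearity is evident.\<close>

lemma eigenspace_subspace: "complex_L2.subspace (eigenspace H \<mu>)"
proof (rule complex_L2.subspaceI)
  have *: "u \<in> eigenspace H \<mu> \<longleftrightarrow> u \<in> V \<and> T 1 u = exp (- \<mu>) *\<^sub>R u" for u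
    using T_eigenspace[of u \<mu> 1] gen_if_T_eigen[of 1 u \<mu>] by (auto simp: eigenspace_iff gen_def)
  show "0 \<in> eigenspace H \<mu>" by (simp add: * L2_on_zero)
  show "f + g \<in> eigenspace H \<mu>" if "f \<in> eigenspace H \<mu>" "g \<in> eigenspace H \<mu>" for f g
    using that by (simp add: * L2_on_add T_add scaleR_add_right)
  show "c *\<^sub>C f \<in> eigenspace H \<mu>" if "f \<in> eigenspace H \<mu>" for c f
    using that by (simp add: * L2_on_scaleC T_scaleC scaleR_scaleC_L2 mult.commute)
qed

text \<open>Since \<open>low\<close> is a union, every vector of \<open>Q\<close> lies in one
  eigenspace, so \<open>Q\<close> can be sorted by eigenvalue.\<close>

definition low_orthonormal :: "real \<Rightarrow> 'a L2 set \<Rightarrow> bool" where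
  "low_orthonormal \<Lambda> Q \<longleftrightarrow> finite Q \<and> Q \<subseteq> low \<Lambda> \<and> (\<forall>q\<in>Q. norm q = 1) \<and>
     (\<forall>q\<in>Q. \<forall>q'\<in>Q. q \<noteq> q' \<longrightarrow> cinner q q' = 0)"

text \<open>Otherwise every finite system could be extended, giving an infinite orthonormal sequence
  of low eigenvectors. Their images under \<open>T 1\<close> have mutual distance at least
  \<open>exp (- \<Lambda>)\<close>, contrary to compactness.\<close>

lemma low_orthonormal_complete:
  "\<exists>Q. low_orthonormal \<Lambda> Q \<and> (\<forall>u\<in>low \<Lambda>. (\<forall>q\<in>Q. cinner u q = 0) \<longrightarrow> u = 0)"
proof (rule ccontr)
  assume neg: "\<not> ?thesis"
  have "\<exists>e. e \<in> low \<Lambda> \<and> norm e = 1 \<and> (\<forall>q\<in>Q. cinner e q = 0)" if Q: "low_orthonormal \<Lambda> Q" for Q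
  proof -
    obtain u where u: "u \<in> low \<Lambda>" "\<forall>q\<in>Q. cinner u q = 0" "u \<noteq> 0" using neg Q by blast
    have "u /\<^sub>R norm u \<in> low \<Lambda>"
      using u(1) complex_L2.subspace_scale[OF eigenspace_subspace]
      by (auto simp: low_def scaleR_scaleC_L2)
    then show ?thesis using u by (intro exI[of _ "u /\<^sub>R norm u"])
      (auto simp: scaleR_scaleC_L2 cinner_scaleC_left norm_inverse)
  qed
  then obtain pick where pick: "\<And>Q. low_orthonormal \<Lambda> Q \<Longrightarrow> pick Q \<in> low \<Lambda> \<and> norm (pick Q)
      = 1 \<and> (\<forall>q\<in>Q. cinner (pick Q) q = 0)"
    by metis
  define S where "S = rec_nat {} (\<lambda>_ Q. insert (pick Q) Q)"
  have S: "S 0 = {}" "S (Suc n) = insert (pick (S n)) (S n)" for n by (simp_all add: S_def)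
  have inv: "low_orthonormal \<Lambda> (S n)" for n
  proof (induction n)
    case 0
    show ?case by (simp add: S low_orthonormal_def)
  next
    case (Suc n)
    have "cinner q (pick (S n)) = 0" if "q \<in> S n" for q
      using pick[OF Suc] that by (metis cinner_commute complex_cnj_zero)
    then show ?case using Suc pick[OF Suc] by (auto simp: S low_orthonormal_def)
  qed
  define e where "e n = pick (S n)" for n
  have e: "e n \<in> low \<Lambda>" "norm (e n) = 1" for n using pick[OF inv[of n]] by (auto simp: e_def)
  have e_in: "e m \<in> S n" if "m < n" for m n
    using that by (induction n) (auto simp: S e_def less_Suc_eq)
  have e_orth: "cinner (e n) (e m) = 0" if "m < n" for m n
    using pick[OF inv[of n]] e_in[OF that] by (simp add: e_def)
  have "\<exists>\<mu>\<le>\<Lambda>. T 1 (e n) = exp (- \<mu>) *\<^sub>R e n" for n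
    using e(1)[of n] T_eigenspace[of "e n" _ 1] by (fastforce simp: low_def)
  then obtain \<mu> where \<mu>: "\<And>n. \<mu> n \<le> \<Lambda>" "\<And>n. T 1 (e n) = exp (- \<mu> n) *\<^sub>R e n" by metis
  have sep: "exp (- \<Lambda>) \<le> norm (T 1 (e n) - T 1 (e m))" if "m < n" for m n
  proof -
    have "(norm (T 1 (e n) - T 1 (e m)))\<^sup>2 = (exp (- \<mu> n))\<^sup>2 + (exp (- \<mu> m))\<^sup>2"
      unfolding norm_diff_sq \<mu> using e_orth[OF that] e(2)
      by (simp add: scaleR_scaleC_L2 cinner_scaleC_left cinner_scaleC_right power_mult_distrib)
    moreover have "(exp (- \<Lambda>))\<^sup>2 \<le> (exp (- \<mu> n))\<^sup>2" using \<mu>(1) by (intro power_mono) auto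
    ultimately have "(exp (- \<Lambda>))\<^sup>2 \<le> (norm (T 1 (e n) - T 1 (e m)))\<^sup>2"
      by (simp add: add_increasing2)
    then show ?thesis by (rule power2_le_imp_le) simp
  qed
  obtain l r where r: "strict_mono r" and l: "(\<lambda>n. T 1 (e (r n))) \<longlonglongrightarrow> l"
    using T_compact[of 1 e] e low_V by (metis order_refl zero_less_one)
  have "Cauchy (\<lambda>n. T 1 (e (r n)))" using l by (rule LIMSEQ_imp_Cauchy)
  then obtain N where N: "\<And>m n. m \<ge> N \<Longrightarrow> n \<ge> N \<Longrightarrow> norm (T 1 (e (r m)) - T 1 (e (r n))) < exp (- \<Lambda>)"
    using CauchyD[of _ "exp (- \<Lambda>)"] by (metis exp_gt_zero)
  have "r N < r (Suc N)" using r by (simp add: strict_mono_def)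
  from sep[OF this] N[of "Suc N" N] show False by simp
qed

text \<open>The slices \<open>QE \<mu>\<close> partition \<open>Q\<close> and are bases of the
  eigenspaces. This also shows that the index set is finite and the eigenspaces finite-dimensional,
  so that neither \<open>sum\<close> nor \<open>dim\<close> takes its default value 0.\<close>

lemma eigenvalue_count_eq_card:
  assumes Q: "low_orthonormal \<Lambda> Q" and complete: "\<And>u. u \<in> low \<Lambda> \<Longrightarrow> \<forall>q\<in>Q. cinner u q = 0 \<Longrightarrow> u = 0"
  shows "eigenvalue_count H \<Lambda> = card Q"
proof -
  define E where "E = {\<mu>. \<mu> \<le> \<Lambda> \<and> (\<exists>f. eigenfunction H \<mu> f)}"
  define QE where "QE \<mu> = Q \<inter> eigenspace H \<mu>" for \<mu>
  have finQ: "finite Q" using Q by (simp add: low_orthonormal_def)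
  have Q0: "q \<noteq> 0" if "q \<in> Q" for q using Q that by (auto simp: low_orthonormal_def)
  have Q1: "cinner q q = 1" if "q \<in> Q" for q using Q that
      by (auto simp: low_orthonormal_def cinner_self)
  have Qo: "cinner q q' = 0" if "q \<in> Q" "q' \<in> Q" "q \<noteq> q'" for q q'
    using Q that by (auto simp: low_orthonormal_def)
  have disj: "QE \<mu> \<inter> QE \<nu> = {}" if "\<mu> \<noteq> \<nu>" for \<mu> \<nu>
    using eigenspaces_orthogonal[OF _ _ that] Q1 by (fastforce simp: QE_def)
  have QE_nonempty: "QE \<mu> \<noteq> {}" if \<mu>: "\<mu> \<in> E" for \<mu>
  proof -
    obtain f where f: "f \<in> eigenspace H \<mu>" "f \<noteq> 0" "f \<in> low \<Lambda>"
      using \<mu> by (fastforce simp: E_def eigenfunction_def low_def)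
    then obtain q where q: "q \<in> Q" "cinner f q \<noteq> 0" using complete by blast
    obtain \<nu> where \<nu>: "q \<in> eigenspace H \<nu>" using Q q(1) by (auto simp: low_orthonormal_def low_def)
    have "\<mu> = \<nu>" using eigenspaces_orthogonal[OF f(1) \<nu>] q(2) by blast
    then show ?thesis using q \<nu> by (auto simp: QE_def)
  qed
  have QUn: "Q = (\<Union>\<mu>\<in>E. QE \<mu>)"
  proof
    show "Q \<subseteq> (\<Union>\<mu>\<in>E. QE \<mu>)"
    proof
      fix q assume q: "q \<in> Q"
      then obtain \<nu> where \<nu>: "\<nu> \<le> \<Lambda>" "q \<in> eigenspace H \<nu>" using Q
          by (auto simp: low_orthonormal_def low_def)
      then show "q \<in> (\<Union>\<mu>\<in>E. QE \<mu>)" using q Q0[OF q] by (auto simp: E_def QE_def eigenfunction_def)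
    qed
  qed (auto simp: QE_def)
  have finE: "finite E"
  proof (rule inj_on_finite[of QE E "Pow Q"])
    show "inj_on QE E" using disj QE_nonempty by (fastforce simp: inj_on_def)
  qed (use finQ in \<open>auto simp: QE_def\<close>)
  have "complex_L2.dim (eigenspace H \<mu>) = card (QE \<mu>)" if \<mu>: "\<mu> \<in> E" for \<mu>
  proof (rule complex_L2.dim_unique)
    have finQE: "finite (QE \<mu>)" using finQ by (simp add: QE_def)
    have coord: "cinner (\<Sum>q\<in>QE \<mu>. c q *\<^sub>C q) q' = c q'" if q': "q' \<in> QE \<mu>" for c q'
    proof -
      have "cinner (\<Sum>q\<in>QE \<mu>. c q *\<^sub>C q) q' = (\<Sum>q\<in>QE \<mu>. c q * cinner q q')"
        by (simp add: cinner_sum_left cinner_scaleC_left)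
      also have "\<dots> = (\<Sum>q\<in>QE \<mu>. if q = q' then c q else 0)"
        using q' Q1 Qo by (intro sum.cong) (auto simp: QE_def)
      finally show ?thesis using finQE q' by simp
    qed
    show "QE \<mu> \<subseteq> eigenspace H \<mu>" by (simp add: QE_def)
    show "complex_L2.independent (QE \<mu>)"
    proof (rule complex_L2.independent_if_scalars_zero[OF finQE])
      fix c q' assume "(\<Sum>q\<in>QE \<mu>. c q *\<^sub>C q) = 0" "q' \<in> QE \<mu>"
      then show "c q' = 0" using coord[of q' c] by simp
    qed
    show "eigenspace H \<mu> \<subseteq> complex_L2.span (QE \<mu>)"
    proof
      fix f assume f: "f \<in> eigenspace H \<mu>"
      define g where "g = (\<Sum>q\<in>QE \<mu>. cinner f q *\<^sub>C q)"
      have gE: "g \<in> eigenspace H \<mu>" unfolding g_def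
        by (intro complex_L2.subspace_sum eigenspace_subspace complex_L2.subspace_scale)
          (auto simp: QE_def)
      have d: "f - g \<in> eigenspace H \<mu>"
        by (rule complex_L2.subspace_diff[OF eigenspace_subspace f gE])
      have "f - g = 0"
      proof (rule complete)
        show "f - g \<in> low \<Lambda>" using d \<mu> by (auto simp: low_def E_def)
        show "\<forall>q\<in>Q. cinner (f - g) q = 0"
        proof
          fix q assume q: "q \<in> Q"
          show "cinner (f - g) q = 0"
          proof (cases "q \<in> QE \<mu>")
            case True
            then show ?thesis using coord[of q "\<lambda>q. cinner f q"] by (simp add: cinner_diff_left g_def)
          next
            case False
            obtain \<nu> where \<nu>: "q \<in> eigenspace H \<nu>" using Q q by (auto simp: low_orthonormal_def low_def)
            then have "\<mu> \<noteq> \<nu>" using False q by (auto simp: QE_def)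
            then show ?thesis by (rule eigenspaces_orthogonal[OF d \<nu>])
          qed
        qed
      qed
      then have "f = g" by simp
      then show "f \<in> complex_L2.span (QE \<mu>)"
        unfolding g_def by (metis (no_types, lifting) complex_L2.span_sum complex_L2.span_scale
            complex_L2.span_base)
    qed
  qed simp
  then have "eigenvalue_count H \<Lambda> = (\<Sum>\<mu>\<in>E. card (QE \<mu>))"
    unfolding eigenvalue_count_def E_def[symmetric] by (intro sum.cong) auto
  also have "\<dots> = card (\<Union>\<mu>\<in>E. QE \<mu>)"
    using finE finQ disj by (intro card_UN_disjoint[symmetric]) (auto simp: QE_def)
  finally show ?thesis unfolding QUn[symmetric] .
qed

text \<open>Trial functions more numerous than low eigenvalues have a nonzero combination
  \<open>w\<close> orthogonal to \<open>low\<close>. Its energy divided by time is at least about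
  \<Lambda> by \<open>spectral_bound\<close>, but at most \<Lambda> - \<delta> up to the
  off-diagonal terms, and these vanish in the limit because they are of second order in time. The
  margin \<delta> is what makes the limit contradictory.\<close>

lemma card_le_eigenvalue_count:
  fixes v :: "'i \<Rightarrow> 'a L2" and \<tau> :: "nat \<Rightarrow> real"
  assumes F: "finite F" and v: "\<And>i. i \<in> F \<Longrightarrow> v i \<in> V" "\<And>i. i \<in> F \<Longrightarrow> v i \<noteq> 0"
    and \<tau>: "\<And>n. 0 < \<tau> n" "\<tau> \<longlonglongrightarrow> 0"
    and low_energy: "\<And>i. i \<in> F \<Longrightarrow> \<exists>\<delta>>0. \<forall>n. (norm (v i))\<^sup>2 - Re (cinner (T (\<tau> n) (v i)) (v i))
      \<le> \<tau> n * (\<Lambda> - \<delta>) * (norm (v i))\<^sup>2"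
    and orth: "\<And>i j. i \<in> F \<Longrightarrow> j \<in> F \<Longrightarrow> i \<noteq> j \<Longrightarrow> cinner (v i) (v j) = 0"
    and off: "\<And>i j. i \<in> F \<Longrightarrow> j \<in> F \<Longrightarrow> i \<noteq> j \<Longrightarrow> \<exists>C. \<forall>n. cmod (cinner (T (\<tau> n) (v i)) (v j)) \<le> C * (\<tau> n)\<^sup>2"
  shows "card F \<le> eigenvalue_count H \<Lambda>"
proof (rule ccontr)
  assume neg: "\<not> ?thesis"
  obtain Q where Q: "low_orthonormal \<Lambda> Q" "\<And>u. u \<in> low \<Lambda> \<Longrightarrow> \<forall>q\<in>Q. cinner u q = 0 \<Longrightarrow> u = 0"
    using low_orthonormal_complete[of \<Lambda>] by blast
  have "card Q < card F" using neg eigenvalue_count_eq_card[OF Q] by simp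
  from underdetermined_system_solution[OF _ F this, of "\<lambda>i q. cinner (v i) q"] Q(1)
  obtain c where c: "\<exists>i\<in>F. c i \<noteq> 0" "\<And>q. q \<in> Q \<Longrightarrow> (\<Sum>i\<in>F. c i * cinner (v i) q) = 0"
    by (auto simp: low_orthonormal_def)
  define w where "w = (\<Sum>i\<in>F. c i *\<^sub>C v i)"
  have w: "w \<in> V" unfolding w_def using v by (intro L2_on_sum L2_on_scaleC)
  have wQ: "cinner w q = 0" if "q \<in> Q" for q
    using c(2)[OF that] by (simp add: w_def cinner_sum_left cinner_scaleC_left)
  \<comment> \<open>\<open>w\<close> is orthogonal to \<open>Q\<close> only; completeness of
    \<open>Q\<close> shows that every low eigenvector equals its projection \<open>g\<close> onto
    the elements of \<open>Q\<close> in the same eigenspace.\<close>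
  have wlow: "cinner w u = 0" if u: "u \<in> low \<Lambda>" for u
  proof -
    obtain \<mu> where \<mu>: "\<mu> \<le> \<Lambda>" "u \<in> eigenspace H \<mu>" using u by (auto simp: low_def)
    define g where "g = (\<Sum>q\<in>Q \<inter> eigenspace H \<mu>. cinner u q *\<^sub>C q)"
    have d: "u - g \<in> eigenspace H \<mu>" unfolding g_def
      by (intro complex_L2.subspace_diff complex_L2.subspace_sum eigenspace_subspace
          complex_L2.subspace_scale \<mu>) auto
    have "u - g = 0"
    proof (rule Q(2))
      show "u - g \<in> low \<Lambda>" using d \<mu> by (auto simp: low_def)
      show "\<forall>q\<in>Q. cinner (u - g) q = 0"
      proof
        fix q assume q: "q \<in> Q"
        show "cinner (u - g) q = 0"
        proof (cases "q \<in> eigenspace H \<mu>")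
          case True
          have "cinner g q = (\<Sum>q'\<in>Q \<inter> eigenspace H \<mu>. cinner u q' * cinner q' q)"
            by (simp add: g_def cinner_sum_left cinner_scaleC_left)
          also have "\<dots> = (\<Sum>q'\<in>Q \<inter> eigenspace H \<mu>. if q' = q then cinner u q' else 0)"
            using Q(1) q by (intro sum.cong) (auto simp: low_orthonormal_def cinner_self)
          also have "\<dots> = cinner u q" using Q(1) q True by (simp add: low_orthonormal_def)
          finally show ?thesis by (simp add: cinner_diff_left)
        next
          case False
          obtain \<nu> where \<nu>: "q \<in> eigenspace H \<nu>" using Q(1) q
              by (auto simp: low_orthonormal_def low_def)
          then have "\<mu> \<noteq> \<nu>" using False by auto
          then show ?thesis by (rule eigenspaces_orthogonal[OF d \<nu>])
        qed
      qed
    qed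
    moreover have "cinner w g = 0" by (simp add: g_def cinner_sum_right cinner_scaleC_right wQ)
    ultimately show ?thesis by simp
  qed
  have expand: "cinner (\<Sum>i\<in>F. c i *\<^sub>C x i) (\<Sum>j\<in>F. c j *\<^sub>C v j)
      = (\<Sum>i\<in>F. of_real ((cmod (c i))\<^sup>2) * cinner (x i) (v i))
        + (\<Sum>i\<in>F. \<Sum>j\<in>F - {i}. c i * cnj (c j) * cinner (x i) (v j))" for x
  proof -
    have "cinner (\<Sum>i\<in>F. c i *\<^sub>C x i) (\<Sum>j\<in>F. c j *\<^sub>C v j)
        = (\<Sum>i\<in>F. \<Sum>j\<in>F. c i * cnj (c j) * cinner (x i) (v j))"
      unfolding cinner_sum_left cinner_scaleC_left unfolding cinner_sum_right cinner_scaleC_right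
          sum_distrib_left
      by (simp only: mult.assoc)
    also have "\<dots> = (\<Sum>i\<in>F. c i * cnj (c i) * cinner (x i) (v i)
        + (\<Sum>j\<in>F - {i}. c i * cnj (c j) * cinner (x i) (v j)))"
      using F by (intro sum.cong sum.remove) auto
    finally show ?thesis by (simp only: sum.distrib complex_norm_square[symmetric] of_real_power)
  qed
  have "cinner w w = (\<Sum>i\<in>F. of_real ((cmod (c i))\<^sup>2) * cinner (v i) (v i))"
  proof -
    have "(\<Sum>i\<in>F. \<Sum>j\<in>F - {i}. c i * cnj (c j) * cinner (v i) (v j)) = 0"
      using orth by (intro sum.neutral ballI) auto
    then show ?thesis unfolding w_def expand by simp
  qed
  then have wnorm: "(norm w)\<^sup>2 = (\<Sum>i\<in>F. (cmod (c i))\<^sup>2 * (norm (v i))\<^sup>2)"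
    unfolding cinner_self of_real_mult[symmetric] of_real_sum[symmetric] of_real_eq_iff .
  have wpos: "0 < (norm w)\<^sup>2"
  proof -
    obtain i where i: "i \<in> F" "c i \<noteq> 0" using c(1) by auto
    show ?thesis unfolding wnorm by (rule sum_pos2[OF F i(1)]) (use i v in auto)
  qed
  obtain d where d: "\<And>i. i \<in> F \<Longrightarrow> 0 < d i" "\<And>i n. i \<in> F
      \<Longrightarrow> (norm (v i))\<^sup>2 - Re (cinner (T (\<tau> n) (v i)) (v i))
      \<le> \<tau> n * (\<Lambda> - d i) * (norm (v i))\<^sup>2"
    using low_energy by metis
  obtain K where K: "\<And>i j n. i \<in> F \<Longrightarrow> j \<in> F \<Longrightarrow> i \<noteq> j \<Longrightarrow> cmod (cinner (T (\<tau> n) (v i)) (v j))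
      \<le> K i j * (\<tau> n)\<^sup>2"
    using off by metis
  define \<delta> where "\<delta> = Min (d ` F)"
  have F0: "F \<noteq> {}" using c(1) by auto
  have \<delta>: "0 < \<delta>" "\<And>i. i \<in> F \<Longrightarrow> \<delta> \<le> d i" unfolding \<delta>_def using F F0 d(1) by auto
  define C where "C = (\<Sum>i\<in>F. \<Sum>j\<in>F - {i}. cmod (c i) * cmod (c j) * K i j)"
  \<comment> \<open>The spectral bound from above and the trial energies from below, divided by the
    time; the bracket on the right tends to 0.\<close>
  have key: "\<delta> * (norm w)\<^sup>2 \<le> (\<Lambda> + (exp (- \<Lambda> * \<tau> n) - 1) / \<tau> n) * (norm w)\<^sup>2 + C * \<tau> n" for n
  proof -
    let ?t = "\<tau> n"
    have t: "0 < ?t" by (rule \<tau>(1))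
    have "T ?t w = (\<Sum>i\<in>F. c i *\<^sub>C T ?t (v i))"
      unfolding w_def using t v by (simp add: T_sum T_scaleC L2_on_scaleC)
    then have "cinner (T ?t w) w = (\<Sum>i\<in>F. of_real ((cmod (c i))\<^sup>2) * cinner (T ?t (v i)) (v i))
        + (\<Sum>i\<in>F. \<Sum>j\<in>F - {i}. c i * cnj (c j) * cinner (T ?t (v i)) (v j))"
      unfolding w_def expand[of "\<lambda>i. T ?t (v i)", symmetric] by simp
    then have "Re (cinner (T ?t w) w) = (\<Sum>i\<in>F. (cmod (c i))\<^sup>2 * Re (cinner (T ?t (v i)) (v i)))
        + Re (\<Sum>i\<in>F. \<Sum>j\<in>F - {i}. c i * cnj (c j) * cinner (T ?t (v i)) (v j))"
      by (simp del: of_real_power)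
    moreover have "- Re (\<Sum>i\<in>F. \<Sum>j\<in>F - {i}. c i * cnj (c j) * cinner (T ?t (v i)) (v j)) \<le> C * ?t\<^sup>2"
    proof -
      have "cmod (\<Sum>i\<in>F. \<Sum>j\<in>F - {i}. c i * cnj (c j) * cinner (T ?t (v i)) (v j))
          \<le> (\<Sum>i\<in>F. \<Sum>j\<in>F - {i}. cmod (c i) * cmod (c j) * (K i j * ?t\<^sup>2))"
        using K by (intro sum_norm_le) (auto simp: norm_mult intro!: mult_left_mono)
      also have "\<dots> = C * ?t\<^sup>2" by (simp add: C_def sum_distrib_right mult.assoc)
      finally show ?thesis using abs_Re_le_cmod[of "\<Sum>i\<in>F. \<Sum>j\<in>F - {i}. c i * cnj (c j) * cinner (T ?t (v
          i)) (v j)"] by linarith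
    qed
    moreover have "(1 - ?t * (\<Lambda> - \<delta>)) * (norm w)\<^sup>2
        \<le> (\<Sum>i\<in>F. (cmod (c i))\<^sup>2 * Re (cinner (T ?t (v i)) (v i)))"
      unfolding wnorm sum_distrib_left
    proof (rule sum_mono)
      fix i assume i: "i \<in> F"
      have "?t * (\<Lambda> - d i) * (norm (v i))\<^sup>2 \<le> ?t * (\<Lambda> - \<delta>) * (norm (v i))\<^sup>2"
        using \<delta>(2)[OF i] t by (intro mult_right_mono mult_left_mono) auto
      then have "(1 - ?t * (\<Lambda> - \<delta>)) * (norm (v i))\<^sup>2 \<le> Re (cinner (T ?t (v i)) (v i))"
        using d(2)[OF i, of n] by (simp add: left_diff_distrib)
      from mult_left_mono[OF this, of "(cmod (c i))\<^sup>2"]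
      show "(1 - ?t * (\<Lambda> - \<delta>)) * ((cmod (c i))\<^sup>2 * (norm (v i))\<^sup>2)
          \<le> (cmod (c i))\<^sup>2 * Re (cinner (T ?t (v i)) (v i))"
        by (simp add: mult.left_commute)
    qed
    moreover have "Re (cinner (T ?t w) w) \<le> exp (- \<Lambda> * ?t) * (norm w)\<^sup>2"
      using spectral_bound[OF w wlow t] T_inner_half[of ?t w] t w by simp
    ultimately have "(1 - ?t * (\<Lambda> - \<delta>)) * (norm w)\<^sup>2 \<le> exp (- \<Lambda> * ?t) * (norm w)\<^sup>2 + C * ?t\<^sup>2"
        by linarith
    moreover have "?t * ((\<Lambda> + (exp (- \<Lambda> * ?t) - 1) / ?t) * (norm w)\<^sup>2 + C * ?t)
        = (?t * \<Lambda> + (exp (- \<Lambda> * ?t) - 1)) * (norm w)\<^sup>2 + C * ?t\<^sup>2"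
      using t by (simp add: distrib_left distrib_right power2_eq_square mult.assoc[symmetric])
    ultimately have "?t * (\<delta> * (norm w)\<^sup>2) \<le> ?t * ((\<Lambda> + (exp (- \<Lambda> * ?t) - 1) / ?t) * (norm w)\<^sup>2
        + C * ?t)"
      by (simp add: algebra_simps)
    then show ?thesis using t by simp
  qed
  have "((\<lambda>s. exp (- \<Lambda> * s)) has_field_derivative (- \<Lambda>)) (at 0)"
    by (auto intro!: derivative_eq_intros)
  then have "((\<lambda>s. (exp (- \<Lambda> * s) - 1) / s) \<longlongrightarrow> - \<Lambda>) (at 0)"
    by (simp add: has_field_derivative_iff)
  moreover have "filterlim \<tau> (at 0) sequentially"
    using \<tau> by (auto simp: filterlim_at less_imp_neq[symmetric] intro!: always_eventually)
  ultimately have "(\<lambda>n. (exp (- \<Lambda> * \<tau> n) - 1) / \<tau> n) \<longlonglongrightarrow> - \<Lambda>"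
    by (rule filterlim_compose)
  then have "(\<lambda>n. (\<Lambda> + (exp (- \<Lambda> * \<tau> n) - 1) / \<tau> n) * (norm w)\<^sup>2 + C * \<tau> n) \<longlonglongrightarrow> (\<Lambda> + - \<Lambda>) * (norm w)\<^sup>2
      + C * 0"
    by (intro tendsto_intros \<tau>)
  then have "\<delta> * (norm w)\<^sup>2 \<le> (\<Lambda> + - \<Lambda>) * (norm w)\<^sup>2 + C * 0"
    by (rule tendsto_lowerbound) (use key in auto)
  then show False using \<delta>(1) wpos by (simp add: mult_le_0_iff)
qed

text \<open>Energy divided by time does not increase when the time doubles. Hence along the times
  2^-n a value, once reached, is never lost again.\<close>

lemma T_energy_mono:
  assumes t: "0 \<le> t" and f: "f \<in> V"
  shows "(norm f)\<^sup>2 - Re (cinner (T (2 * t) f) f) \<le> 2 * ((norm f)\<^sup>2 - Re (cinner (T t f) f))"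
proof -
  have "0 \<le> (norm (T t f - f))\<^sup>2" by simp
  then show ?thesis using T_inner_half[of "2 * t" f] t f by (simp add: norm_diff_sq)
qed

end

section \<open>Cutoff functions\<close>

text \<open>On [-1, 1] this is cos^2 (\<pi>s / 2), and clamping the argument extends it by 0. Its
  integer translates sum to 1, and where two of them overlap the square of either derivative is
  \<pi>^2 times the product of the two: an algebraic relation on which
  \<open>weighted_bump_gradient\<close> rests.\<close>

definition bump :: "real \<Rightarrow> real" where
  "bump s = (1 + cos (pi * max (-1) (min 1 s))) / 2"

definition dbump :: "real \<Rightarrow> real" where
  "dbump s = - (pi / 2) * sin (pi * max (-1) (min 1 s))"

lemma bump_bounds: "0 \<le> bump s" "bump s \<le> 1"
proof -
  have "0 \<le> (1 + cos c) / 2" for c :: real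
  proof -
    have "0 \<le> 1 + cos c" using cos_ge_minus_one[of c] by linarith
    then show ?thesis by simp
  qed
  moreover have "(1 + cos c) / 2 \<le> 1" for c :: real
    using cos_le_one[of c] by simp
  ultimately show "0 \<le> bump s" "bump s \<le> 1" by (simp_all only: bump_def)
qed

lemma bump_eq_0: "1 \<le> \<bar>s\<bar> \<Longrightarrow> bump s = 0"
  and dbump_eq_0: "1 \<le> \<bar>s\<bar> \<Longrightarrow> dbump s = 0"
proof -
  assume "1 \<le> \<bar>s\<bar>"
  then consider "max (-1) (min 1 s) = 1" | "max (-1) (min 1 s) = -1" by linarith
  then show "bump s = 0" "dbump s = 0" by (cases; simp add: bump_def dbump_def)+
qed

lemma bump_eq: "\<bar>s\<bar> \<le> 1 \<Longrightarrow> bump s = (1 + cos (pi * s)) / 2"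
  and dbump_eq: "\<bar>s\<bar> \<le> 1 \<Longrightarrow> dbump s = - (pi / 2) * sin (pi * s)"
proof -
  assume "\<bar>s\<bar> \<le> 1"
  then have "max (-1) (min 1 s) = s" by linarith
  then show "bump s = (1 + cos (pi * s)) / 2" "dbump s = - (pi / 2) * sin (pi * s)"
    by (simp_all add: bump_def dbump_def)
qed

lemma abs_dbump_le: "\<bar>dbump s\<bar> \<le> 2"
proof -
  have "\<bar>dbump s\<bar> = (pi / 2) * \<bar>sin (pi * max (-1) (min 1 s))\<bar>" by (simp add: dbump_def abs_mult)
  also have "\<dots> \<le> (pi / 2) * 1" by (intro mult_left_mono) auto
  finally show ?thesis using pi_less_4 by simp
qed

lemma continuous_on_bump [continuous_intros]:
  fixes f :: "'a::t2_space \<Rightarrow> real"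
  shows "continuous_on S f \<Longrightarrow> continuous_on S (\<lambda>x. bump (f x))"
  unfolding bump_def
  by (intro continuous_intros continuous_on_cos continuous_on_max continuous_on_min) auto

lemma continuous_on_dbump [continuous_intros]:
  fixes f :: "'a::t2_space \<Rightarrow> real"
  shows "continuous_on S f \<Longrightarrow> continuous_on S (\<lambda>x. dbump (f x))"
  unfolding dbump_def
  by (intro continuous_intros continuous_on_sin continuous_on_max continuous_on_min)

lemma abs_sin_diff_le: "\<bar>sin x - sin y\<bar> \<le> \<bar>x - y\<bar>" for x y :: real
proof -
  have "norm (sin x - sin y) \<le> 1 * norm (x - y)"
    by (rule field_differentiable_bound[of UNIV sin cos])
      (auto intro!: derivative_eq_intros has_field_derivative_at_within)
  then show ?thesis by simp
qed

text \<open>\<open>bump\<close> has a Lipschitz derivative but is not twice differentiable at the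
  ends of its support. The remainder is that of the smooth cosine \<open>g\<close> between the
  clamped arguments, plus the part of the increment lost by clamping; 16 = 8 + 8.\<close>

lemma bump_taylor:
  "\<bar>bump (s + h) - bump s\<bar> \<le> 2 * \<bar>h\<bar>"
  "\<bar>bump (s + h) - bump s - dbump s * h\<bar> \<le> 16 * h\<^sup>2"
proof -
  define cl where "cl = (\<lambda>s::real. max (-1) (min 1 s))"
  define g where "g = (\<lambda>x. (1 + cos (pi * x)) / 2)"
  define g' where "g' = (\<lambda>x. - (pi / 2) * sin (pi * x))"
  have deriv: "(g has_field_derivative g' x) (at x)" for x
    unfolding g_def g'_def by (auto intro!: derivative_eq_intros)
  have cl_lip: "\<bar>cl (s + h) - cl s\<bar> \<le> \<bar>h\<bar>" by (auto simp: cl_def)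
  have lip: "\<bar>g' x - g' y\<bar> \<le> 8 * \<bar>x - y\<bar>" for x y
  proof -
    have "\<bar>g' x - g' y\<bar> = (pi / 2) * \<bar>sin (pi * x) - sin (pi * y)\<bar>"
    proof -
      have "g' x - g' y = - ((pi / 2) * (sin (pi * x) - sin (pi * y)))"
        by (simp add: g'_def algebra_simps)
      then show ?thesis by (simp only: abs_minus_cancel abs_mult) simp
    qed
    also have "\<dots> \<le> (pi / 2) * \<bar>pi * x - pi * y\<bar>" by (intro mult_left_mono abs_sin_diff_le) auto
    also have "\<dots> = (pi * pi / 2) * \<bar>x - y\<bar>" by (simp add: abs_mult flip: right_diff_distrib)
    also have "\<dots> \<le> 8 * \<bar>x - y\<bar>"
      using mult_mono[of pi 4 pi 4] pi_less_4 by (intro mult_right_mono) auto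
    finally show ?thesis .
  qed
  have bd: "\<bar>g' x\<bar> \<le> 2" for x
  proof -
    have "\<bar>g' x\<bar> = (pi / 2) * \<bar>sin (pi * x)\<bar>" by (simp add: g'_def abs_mult)
    also have "\<dots> \<le> (pi / 2) * 1" by (intro mult_left_mono) auto
    finally show ?thesis using pi_less_4 by simp
  qed
  have lipg: "\<bar>g x - g y\<bar> \<le> 2 * \<bar>x - y\<bar>" for x y
    using field_differentiable_bound[of UNIV g g' 2 x y] deriv bd
    by (auto intro: has_field_derivative_at_within)
  have b: "bump s = g (cl s)" "dbump s = g' (cl s)" for s
    by (simp_all add: bump_def dbump_def g_def g'_def cl_def)
  let ?c = "cl s" and ?c' = "cl (s + h)"
  show "\<bar>bump (s + h) - bump s\<bar> \<le> 2 * \<bar>h\<bar>"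
    unfolding b by (rule order_trans[OF lipg]) (use cl_lip in simp)
  have 1: "\<bar>g ?c' - g ?c - g' ?c * (?c' - ?c)\<bar> \<le> 8 * h\<^sup>2"
  proof -
    have "norm ((\<lambda>x. g x - g' ?c * x) ?c' - (\<lambda>x. g x - g' ?c * x) ?c) \<le> (8 * \<bar>h\<bar>) * norm (?c' - ?c)"
    proof (rule field_differentiable_bound[of "closed_segment ?c ?c'" _ "\<lambda>x. g' x - g' ?c"])
      fix x assume x: "x \<in> closed_segment ?c ?c'"
      show "((\<lambda>x. g x - g' ?c * x) has_field_derivative (g' x - g' ?c)) (at x within closed_segment ?c
          ?c')"
        by (auto intro!: derivative_eq_intros has_field_derivative_at_within[OF deriv])
      have "\<bar>x - ?c\<bar> \<le> \<bar>h\<bar>"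
        using x cl_lip by (auto simp: closed_segment_eq_real_ivl split: if_splits)
      then show "norm (g' x - g' ?c) \<le> 8 * \<bar>h\<bar>" using lip[of x ?c] by simp
    qed auto
    also have "\<dots> \<le> (8 * \<bar>h\<bar>) * \<bar>h\<bar>" using cl_lip by (intro mult_left_mono) auto
    finally show ?thesis by (simp add: algebra_simps power2_eq_square)
  qed
  \<comment> \<open>Either the derivative vanishes at \<open>s\<close>, or the clamp acts on neither
    point, or \<open>s + h\<close> has left the support; in the last case the derivative vanishes at
    the clamped end, so by its Lipschitz bound it is of order |h| at \<open>s\<close>.\<close>
  have 2: "\<bar>g' ?c * ((?c' - ?c) - h)\<bar> \<le> 8 * h\<^sup>2"
  proof -
    consider "1 \<le> \<bar>s\<bar>" | "\<bar>s\<bar> < 1" "\<bar>s + h\<bar> \<le> 1" | "\<bar>s\<bar> < 1" "1 < \<bar>s + h\<bar>" by linarith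
    then show ?thesis
    proof cases
      case 1
      then show ?thesis using dbump_eq_0[of s] by (simp add: b)
    next
      case 2
      then have "?c' - ?c = h" by (auto simp: cl_def)
      then show ?thesis by simp
    next
      case 3
      then have "g' ?c' = 0" using dbump_eq_0[of "s + h"] by (simp add: b)
      then have "\<bar>g' ?c\<bar> \<le> 8 * \<bar>h\<bar>" using lip[of ?c ?c'] cl_lip by (simp add: abs_minus_commute[of ?c])
      moreover have "\<bar>(?c' - ?c) - h\<bar> \<le> \<bar>h\<bar>" by (auto simp: cl_def)
      ultimately have "\<bar>g' ?c\<bar> * \<bar>(?c' - ?c) - h\<bar> \<le> (8 * \<bar>h\<bar>) * \<bar>h\<bar>" by (intro mult_mono) auto
      then show ?thesis by (simp add: abs_mult power2_eq_square)
    qed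
  qed
  have "bump (s + h) - bump s - dbump s * h = (g ?c' - g ?c - g' ?c * (?c' - ?c))
      + g' ?c * ((?c' - ?c) - h)"
    by (simp add: b algebra_simps)
  then show "\<bar>bump (s + h) - bump s - dbump s * h\<bar> \<le> 16 * h\<^sup>2"
    using 1 2 by linarith
qed

lemma bump_partition:
  fixes s :: real
  shows "bump (s - of_int \<lfloor>s\<rfloor>) + bump (s - of_int (\<lfloor>s\<rfloor> + 1)) = 1"
    and "k \<noteq> \<lfloor>s\<rfloor> \<Longrightarrow> k \<noteq> \<lfloor>s\<rfloor> + 1 \<Longrightarrow> 1 \<le> \<bar>s - of_int k\<bar>"
proof -
  define f where "f = s - of_int \<lfloor>s\<rfloor>"
  have f: "0 \<le> f" "f \<le> 1" unfolding f_def by linarith+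
  have e: "s - of_int (\<lfloor>s\<rfloor> + 1) = f - 1" by (simp add: f_def)
  have "bump f + bump (f - 1) = 1"
  proof -
    have "cos (pi * (f - 1)) = - cos (pi * f)"
      by (simp add: right_diff_distrib cos_diff)
    then show ?thesis using f by (simp add: bump_eq field_simps)
  qed
  then show "bump (s - of_int \<lfloor>s\<rfloor>) + bump (s - of_int (\<lfloor>s\<rfloor> + 1)) = 1"
    unfolding e unfolding f_def .
  assume "k \<noteq> \<lfloor>s\<rfloor>" "k \<noteq> \<lfloor>s\<rfloor> + 1"
  then consider "k + 1 \<le> \<lfloor>s\<rfloor>" | "\<lfloor>s\<rfloor> + 2 \<le> k" by linarith
  then show "1 \<le> \<bar>s - of_int k\<bar>" by cases linarith+
qed

text \<open>On the overlap both squared derivatives equal \<pi>^2 a b, where a and b are the two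
  bump values, and a quadratic form in a and b has to be nonnegative. For positive weights this
  means (9 U1 - U0)(9 U0 - U1) >= 0, that is, a ratio of at most 9; the constant is 5/3 = (3 + 1/3)
  / 2. The index \<open>k'\<close> is the other of the two overlapping translates.\<close>

lemma weighted_bump_gradient:
  fixes W0 W1 s :: real and k :: int
  assumes W: "0 < W0" "0 < W1"
    and ratio: "k = \<lfloor>s\<rfloor> \<or> k = \<lfloor>s\<rfloor> + 1 \<Longrightarrow> W0 \<le> 9 * W1 \<and> W1 \<le> 9 * W0"
  defines "k' \<equiv> 2 * \<lfloor>s\<rfloor> + 1 - k"
  shows "W0 * (dbump (s - of_int k))\<^sup>2 + W1 * (dbump (s - of_int k'))\<^sup>2
    \<le> 5 / 3 * pi\<^sup>2 * (W0 * (bump (s - of_int k))\<^sup>2 + W1 * (bump (s - of_int k'))\<^sup>2)"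
proof (cases "k = \<lfloor>s\<rfloor> \<or> k = \<lfloor>s\<rfloor> + 1")
  case False
  then have "k' \<noteq> \<lfloor>s\<rfloor>" "k' \<noteq> \<lfloor>s\<rfloor> + 1" by (auto simp: k'_def)
  then have "dbump (s - of_int k) = 0" "dbump (s - of_int k') = 0"
    using False bump_partition(2)[of k s] bump_partition(2)[of k' s] by (auto intro: dbump_eq_0)
  then show ?thesis using W by simp
next
  case True
  define f where "f = s - of_int \<lfloor>s\<rfloor>"
  have f: "0 \<le> f" "f \<le> 1" unfolding f_def by linarith+
  have core: "U0 * (dbump f)\<^sup>2 + U1 * (dbump (f - 1))\<^sup>2 \<le> 5 / 3 * pi\<^sup>2 * (U0 * (bump f)\<^sup>2
      + U1 * (bump (f - 1))\<^sup>2)"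
    if U: "0 < U0" "0 < U1" "U0 \<le> 9 * U1" "U1 \<le> 9 * U0" for U0 U1 :: real
  proof -
    define a where "a = (1 + cos (pi * f)) / 2"
    define b where "b = (1 - cos (pi * f)) / 2"
    have ba: "bump f = a" "bump (f - 1) = b"
      using f by (auto simp: bump_eq a_def b_def right_diff_distrib cos_diff)
    have "4 * (a * b) = 1 - (cos (pi * f))\<^sup>2"
      by (simp add: a_def b_def power2_eq_square field_simps)
    then have "(sin (pi * f))\<^sup>2 = 4 * (a * b)"
      by (simp only: sin_squared_eq)
    then have d: "(dbump f)\<^sup>2 = pi\<^sup>2 * (a * b)" "(dbump (f - 1))\<^sup>2 = pi\<^sup>2 * (a * b)"
      using f by (auto simp: dbump_eq power_mult_distrib power_divide right_diff_distrib sin_diff)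
    have disc: "0 \<le> (9 * U1 - U0) * (9 * U0 - U1)" using U by (intro mult_nonneg_nonneg) auto
    \<comment> \<open>The factor is four times the coefficient of \<open>a\<^sup>2\<close>, as usual
      in completing a square.\<close>
    have "20 / 3 * U0 * (5 / 3 * (U0 * a\<^sup>2 + U1 * b\<^sup>2) - (U0 + U1) * (a * b))
        = (10 / 3 * U0 * a - (U0 + U1) * b)\<^sup>2 + ((9 * U1 - U0) * (9 * U0 - U1)) / 9 * b\<^sup>2"
      by (simp add: power2_eq_square field_simps)
    also have "\<dots> \<ge> 0" using disc by simp
    finally have "0 \<le> 5 / 3 * (U0 * a\<^sup>2 + U1 * b\<^sup>2) - (U0 + U1) * (a * b)"
      using U by (simp add: zero_le_mult_iff)
    then have "pi\<^sup>2 * ((U0 + U1) * (a * b)) \<le> pi\<^sup>2 * (5 / 3 * (U0 * a\<^sup>2 + U1 * b\<^sup>2))"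
      by (intro mult_left_mono) auto
    then show ?thesis unfolding ba d by (simp add: algebra_simps)
  qed
  have e: "s - of_int \<lfloor>s\<rfloor> = f" "s - of_int (\<lfloor>s\<rfloor> + 1) = f - 1" by (auto simp: f_def)
  from True show ?thesis
  proof
    assume k: "k = \<lfloor>s\<rfloor>"
    then have k': "k' = \<lfloor>s\<rfloor> + 1" by (simp add: k'_def)
    show ?thesis unfolding k k' e using core[OF W] ratio True by simp
  next
    assume k: "k = \<lfloor>s\<rfloor> + 1"
    then have k': "k' = \<lfloor>s\<rfloor>" by (simp add: k'_def)
    show ?thesis unfolding k k' e using core[OF W(2,1)] ratio True by (simp add: add.commute)
  qed
qed

text \<open>Induction over the factors. The mixed error is a product of two first-order increments,
  and \<open>PQ\<close> lets it fit into the cross term of the squared sum on the right.\<close>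

lemma prod_taylor:
  fixes a b p h :: "'i \<Rightarrow> real"
  assumes "finite I" and ab: "\<And>i. 0 \<le> a i \<and> a i \<le> 1" "\<And>i. 0 \<le> b i \<and> b i \<le> 1"
    and p: "\<And>i. \<bar>p i\<bar> \<le> P" and lip: "\<And>i. \<bar>b i - a i\<bar> \<le> P * \<bar>h i\<bar>"
    and tay: "\<And>i. \<bar>b i - a i - p i * h i\<bar> \<le> Q * (h i)\<^sup>2" and PQ: "P\<^sup>2 \<le> Q"
  shows "\<bar>prod b I - prod a I - (\<Sum>i\<in>I. p i * h i * prod a (I - {i}))\<bar> \<le> Q * (\<Sum>i\<in>I. \<bar>h i\<bar>)\<^sup>2"
  using assms(1)
proof (induction I rule: finite_induct)
  case (insert x I)
  let ?A = "prod a I" and ?B = "prod b I" and ?S = "\<Sum>i\<in>I. p i * h i * prod a (I - {i})" and ?h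
      = "\<Sum>i\<in>I. \<bar>h i\<bar>"
  have P0: "0 \<le> P" using p[of x] by linarith
  have Q0: "0 \<le> Q" using PQ zero_le_power2[of P] by linarith
  have a1: "0 \<le> prod a J" "prod a J \<le> 1" for J using ab by (auto intro!: prod_nonneg prod_le_1)
  have sum: "(\<Sum>i\<in>insert x I. p i * h i * prod a (insert x I - {i})) = p x * h x * ?A + a x * ?S"
  proof -
    have "(\<Sum>i\<in>I. p i * h i * prod a (insert x I - {i})) = (\<Sum>i\<in>I. a x * (p i * h i * prod a (I - {i})))"
    proof (rule sum.cong)
      fix i assume i: "i \<in> I"
      then have "insert x I - {i} = insert x (I - {i})" using insert.hyps by auto
      then show "p i * h i * prod a (insert x I - {i}) = a x * (p i * h i * prod a (I - {i}))"
        using insert.hyps by simp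
    qed simp
    then show ?thesis using insert.hyps by (simp add: sum_distrib_left)
  qed
  have S: "\<bar>?S\<bar> \<le> P * ?h"
  proof -
    have "\<bar>?S\<bar> \<le> (\<Sum>i\<in>I. \<bar>p i * h i * prod a (I - {i})\<bar>)" by (rule sum_abs)
    also have "\<dots> \<le> (\<Sum>i\<in>I. P * \<bar>h i\<bar> * 1)"
      unfolding abs_mult using p a1 P0 by (intro sum_mono mult_mono) auto
    finally show ?thesis by (simp add: sum_distrib_left)
  qed
  have "\<bar>(b x - a x - p x * h x) * ?A\<bar> \<le> Q * (h x)\<^sup>2 * 1"
    unfolding abs_mult using tay[of x] a1[of I] Q0 by (intro mult_mono) auto
  moreover have "\<bar>b x * (?B - ?A - ?S)\<bar> \<le> 1 * (Q * ?h\<^sup>2)"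
    unfolding abs_mult using ab(2)[of x] insert.IH by (intro mult_mono) auto
  moreover have "\<bar>(b x - a x) * ?S\<bar> \<le> (P * \<bar>h x\<bar>) * (P * ?h)"
    unfolding abs_mult using lip[of x] S P0 by (intro mult_mono) auto
  moreover have "(P * \<bar>h x\<bar>) * (P * ?h) \<le> Q * (2 * (\<bar>h x\<bar> * ?h))"
  proof -
    have "0 \<le> \<bar>h x\<bar> * ?h" by (intro mult_nonneg_nonneg sum_nonneg) auto
    then have "P\<^sup>2 * (\<bar>h x\<bar> * ?h) \<le> Q * (\<bar>h x\<bar> * ?h)" "0 \<le> Q * (\<bar>h x\<bar> * ?h)"
      using PQ Q0 by (auto intro: mult_right_mono)
    then show ?thesis by (simp add: power2_eq_square mult_ac)
  qed
  moreover have "prod b (insert x I) - prod a (insert x I) - (\<Sum>i\<in>insert x I. p i * h i * prod a (insert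
      x I - {i}))
      = (b x - a x - p x * h x) * ?A + b x * (?B - ?A - ?S) + (b x - a x) * ?S"
    unfolding sum using insert.hyps by (simp add: algebra_simps)
  moreover have "Q * (\<Sum>i\<in>insert x I. \<bar>h i\<bar>)\<^sup>2 = Q * (h x)\<^sup>2 + Q * ?h\<^sup>2 + Q * (2 * (\<bar>h x\<bar> * ?h))"
    using insert.hyps by (simp add: power2_sum algebra_simps)
  ultimately show ?case by linarith
qed simp

section \<open>Product cutoffs and their energy at small times\<close>

definition cutoff :: "real \<Rightarrow> ('d::finite \<Rightarrow> int) \<Rightarrow> real ^ 'd \<Rightarrow> real" where
  "cutoff l k x = (\<Prod>i\<in>UNIV. bump (x $ i / l - of_int (k i)))"

definition cutoff_grad :: "real \<Rightarrow> ('d::finite \<Rightarrow> int) \<Rightarrow> real ^ 'd \<Rightarrow> real ^ 'd" where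
  "cutoff_grad l k x = (\<chi> i. dbump (x $ i / l - of_int (k i)) / l * (\<Prod>j\<in>UNIV - {i}. bump (x $ j / l -
      of_int (k j))))"

lemma cutoff_bounds: "0 \<le> cutoff l k x" "cutoff l k x \<le> 1"
  unfolding cutoff_def by (auto intro!: prod_nonneg prod_le_1 bump_bounds)

lemma continuous_on_cutoff: "continuous_on UNIV (cutoff l k)"
  unfolding cutoff_def divide_inverse by (intro continuous_intros)

lemma bounded_measurable_cutoff: "bounded_measurable (cutoff l k)"
  unfolding bounded_measurable_def
  using cutoff_bounds[of l k] continuous_on_cutoff[of l k]
  by (auto intro!: borel_lebesgueI borel_measurable_continuous_onI exI[of _ 1])

lemma norm_cutoff_grad_sq:
  fixes k :: "'d::finite \<Rightarrow> int"
  shows "(norm (cutoff_grad l k x))\<^sup>2 = (\<Sum>i\<in>UNIV. (dbump (x $ i / l - of_int (k i)) / l)\<^sup>2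
      * (\<Prod>j\<in>UNIV - {i}. (bump (x $ j / l - of_int (k j)))\<^sup>2))"
proof -
  have "(norm v)\<^sup>2 = (\<Sum>i\<in>UNIV. (v $ i)\<^sup>2)" for v :: "real ^ 'd"
    by (simp only: power2_norm_eq_inner inner_vec_def) (simp add: power2_eq_square)
  then show ?thesis
    by (simp only: cutoff_grad_def vec_lambda_beta power_mult_distrib prod_power_distrib)
qed

lemma borel_measurable_norm_cutoff_grad [measurable]:
  "(\<lambda>x. (norm (cutoff_grad l k x))\<^sup>2) \<in> borel_measurable lebesgue"
  unfolding norm_cutoff_grad_sq divide_inverse
  by (intro borel_lebesgueI borel_measurable_continuous_onI continuous_intros)

lemma norm_cutoff_grad_le:
  fixes k :: "'d::finite \<Rightarrow> int"
  assumes l: "0 < l"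
  shows "(norm (cutoff_grad l k x))\<^sup>2 \<le> real CARD('d) * (2 / l)\<^sup>2"
proof -
  have "(norm (cutoff_grad l k x))\<^sup>2 \<le> (\<Sum>i\<in>(UNIV::'d set). (2 / l)\<^sup>2 * 1)"
    unfolding norm_cutoff_grad_sq
  proof (intro sum_mono mult_mono)
    fix i :: 'd
    have "\<bar>dbump (x $ i / l - of_int (k i)) / l\<bar> \<le> 2 / l"
      using abs_dbump_le l by (simp add: divide_right_mono)
    then have "\<bar>dbump (x $ i / l - of_int (k i)) / l\<bar>\<^sup>2 \<le> (2 / l)\<^sup>2" by (rule power_mono) simp
    then show "(dbump (x $ i / l - of_int (k i)) / l)\<^sup>2 \<le> (2 / l)\<^sup>2" by (simp only: power2_abs)
    show "(\<Prod>j\<in>UNIV - {i}. (bump (x $ j / l - of_int (k j)))\<^sup>2) \<le> 1"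
      by (intro prod_le_1) (auto simp: power_le_one bump_bounds)
  qed (auto intro!: prod_nonneg)
  then show ?thesis by simp
qed

lemma cutoff_taylor:
  fixes k :: "'d::finite \<Rightarrow> int" and x z :: "real ^ 'd"
  assumes l: "0 < l"
  shows "\<bar>cutoff l k (x + z) - cutoff l k x - cutoff_grad l k x \<bullet> z\<bar>
      \<le> 16 / l\<^sup>2 * (real CARD('d))\<^sup>2 * (norm z)\<^sup>2"
proof -
  let ?a = "\<lambda>i. bump (x $ i / l - of_int (k i))" and ?b = "\<lambda>i. bump ((x + z) $ i / l - of_int (k i))"
  have b: "(x + z) $ i / l - of_int (k i) = (x $ i / l - of_int (k i)) + z $ i / l" for i
    by (simp add: add_divide_distrib)
  have "\<bar>prod ?b UNIV - prod ?a UNIV - (\<Sum>i\<in>UNIV. dbump (x $ i / l - of_int (k i)) * (z $ i / l) * prod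
      ?a (UNIV - {i}))\<bar>
      \<le> 16 * (\<Sum>i\<in>UNIV. \<bar>z $ i / l\<bar>)\<^sup>2"
  proof (rule prod_taylor[where P = 2])
    fix i
    show "\<bar>?b i - ?a i\<bar> \<le> 2 * \<bar>z $ i / l\<bar>" unfolding b by (rule bump_taylor)
    show "\<bar>?b i - ?a i - dbump (x $ i / l - of_int (k i)) * (z $ i / l)\<bar> \<le> 16 * (z $ i / l)\<^sup>2"
      unfolding b by (rule bump_taylor)
  qed (auto simp: bump_bounds abs_dbump_le)
  moreover have "(\<Sum>i\<in>UNIV. dbump (x $ i / l - of_int (k i)) * (z $ i / l) * prod ?a (UNIV - {i}))
      = cutoff_grad l k x \<bullet> z"
    by (simp add: inner_vec_def cutoff_grad_def mult_ac)
  moreover have "16 * (\<Sum>i\<in>UNIV. \<bar>z $ i / l\<bar>)\<^sup>2 \<le> 16 / l\<^sup>2 * (real CARD('d))\<^sup>2 * (norm z)\<^sup>2"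
  proof -
    have "(\<Sum>i\<in>UNIV. \<bar>z $ i / l\<bar>) \<le> (\<Sum>i\<in>(UNIV::'d set). norm z / l)"
      using l component_le_norm_cart[of z] by (intro sum_mono) (simp add: divide_right_mono)
    also have "\<dots> = real CARD('d) * (norm z / l)" by simp
    finally have "(\<Sum>i\<in>UNIV. \<bar>z $ i / l\<bar>)\<^sup>2 \<le> (real CARD('d) * (norm z / l))\<^sup>2"
      by (rule power_mono) (simp add: sum_nonneg)
    then show ?thesis by (simp add: power_mult_distrib power_divide mult_ac)
  qed
  ultimately show ?thesis by (simp add: cutoff_def)
qed

text \<open>First-order Taylor expansion of the cutoff. The linear part has the sharp second moment,
  the remainder involves fourth moments and is of order \<open>t\<^sup>2\<close>. The factor
  \<open>1 + \<theta>\<close> pays for the cross term; \<open>C\<close> and \<open>t0\<close> do not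
  depend on \<open>x\<close>.\<close>

lemma heat_energy_cutoff_le:
  fixes k :: "'d::finite \<Rightarrow> int"
  assumes l: "0 < l" and \<theta>: "0 < \<theta>"
  shows "\<exists>C t0. 0 < t0 \<and> (\<forall>t x. 0 < t \<and> t \<le> t0 \<longrightarrow>
    (\<integral>\<^sup>+y. ennreal (heat_kernel t (x - y) * (cutoff l k y - cutoff l k x)\<^sup>2) \<partial>lebesgue)
      \<le> ennreal (2 * (1 + \<theta>) * t * (norm (cutoff_grad l k x))\<^sup>2 + C * t\<^sup>2)) \<and> 0 \<le> C"
proof -
  let ?d = "real CARD('d)"
  define G where "G = ?d * (2 / l)\<^sup>2"
  define K where "K = 16 / l\<^sup>2 * ?d\<^sup>2"
  define C where "C = 2 * (1 + \<theta>) * G\<^sup>2 + (1 + 1 / \<theta>) * K\<^sup>2 * (144 * ?d ^ 3)"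
  have G: "0 < G" using l by (simp add: G_def)
  have C0: "0 \<le> C" using \<theta> by (simp add: C_def)
  have "(\<integral>\<^sup>+y. ennreal (heat_kernel t (x - y) * (cutoff l k y - cutoff l k x)\<^sup>2) \<partial>lebesgue)
      \<le> ennreal (2 * (1 + \<theta>) * t * (norm (cutoff_grad l k x))\<^sup>2 + C * t\<^sup>2)"
    if t: "0 < t" "t \<le> 1 / G" for t and x :: "real ^ 'd"
  proof -
    let ?g = "cutoff_grad l k x"
    have [measurable]: "cutoff l k \<in> borel_measurable borel"
      by (intro borel_measurable_continuous_onI continuous_on_cutoff)
    have "(\<integral>\<^sup>+y. ennreal (heat_kernel t (x - y) * (cutoff l k y - cutoff l k x)\<^sup>2) \<partial>lebesgue)
        = (\<integral>\<^sup>+y. (\<lambda>z. ennreal (heat_kernel t z * (cutoff l k (x - z) - cutoff l k x)\<^sup>2)) (x - y)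
            \<partial>lebesgue)"
      by simp
    also have "\<dots> = (\<integral>\<^sup>+z. ennreal (heat_kernel t z * (cutoff l k (x - z) - cutoff l k x)\<^sup>2) \<partial>lebesgue)"
      by (rule nn_integral_lebesgue_reflect) measurable
    also have "\<dots> \<le> (\<integral>\<^sup>+z. ennreal (1 + \<theta>) * ennreal (heat_kernel t z * (?g \<bullet> z)\<^sup>2)
        + ennreal ((1 + 1 / \<theta>) * K\<^sup>2) * ennreal (heat_kernel t z * norm z ^ 4) \<partial>lebesgue)"
    proof (intro nn_integral_mono)
      fix z :: "real ^ 'd"
      define R where "R = cutoff l k (x - z) - cutoff l k x - ?g \<bullet> (- z)"
      define a where "a = ?g \<bullet> (- z)"
      have "\<bar>R\<bar> \<le> K * (norm z)\<^sup>2"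
        using cutoff_taylor[OF l, of k x "- z"] by (simp add: R_def K_def)
      then have "\<bar>R\<bar>\<^sup>2 \<le> (K * (norm z)\<^sup>2)\<^sup>2" by (rule power_mono) simp
      then have R2: "R\<^sup>2 \<le> K\<^sup>2 * norm z ^ 4" by (simp add: power_mult_distrib)
      \<comment> \<open>Expanded, this bounds the cross term 2aR by \<theta> a^2 + R^2 /
        \<theta>.\<close>
      have "0 \<le> (\<theta> * a - R)\<^sup>2 / \<theta>" using \<theta> by simp
      then have "(a + R)\<^sup>2 \<le> (1 + \<theta>) * a\<^sup>2 + (1 + 1 / \<theta>) * R\<^sup>2"
        using \<theta> by (simp add: power2_eq_square field_simps)
      also have "\<dots> \<le> (1 + \<theta>) * a\<^sup>2 + (1 + 1 / \<theta>) * (K\<^sup>2 * norm z ^ 4)"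
        using \<theta> by (intro add_left_mono mult_left_mono R2) auto
      finally have "(cutoff l k (x - z) - cutoff l k x)\<^sup>2 \<le> (1 + \<theta>) * (?g \<bullet> z)\<^sup>2 + (1
          + 1 / \<theta>) * (K\<^sup>2 * norm z ^ 4)"
        by (simp add: a_def R_def)
      from mult_left_mono[OF this heat_kernel_nonneg[of t z]]
      have "heat_kernel t z * (cutoff l k (x - z) - cutoff l k x)\<^sup>2
          \<le> (1 + \<theta>) * (heat_kernel t z * (?g \<bullet> z)\<^sup>2) + (1
              + 1 / \<theta>) * K\<^sup>2 * (heat_kernel t z * norm z ^ 4)"
        by (simp add: algebra_simps)
      then have "ennreal (heat_kernel t z * (cutoff l k (x - z) - cutoff l k x)\<^sup>2)
        \<le> ennreal ((1 + \<theta>) * (heat_kernel t z * (?g \<bullet> z)\<^sup>2) + (1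
            + 1 / \<theta>) * K\<^sup>2 * (heat_kernel t z * norm z ^ 4))"
        by (rule ennreal_leI)
      also have "\<dots> = ennreal ((1 + \<theta>) * (heat_kernel t z * (?g \<bullet> z)\<^sup>2)) + ennreal ((1
          + 1 / \<theta>) * K\<^sup>2 * (heat_kernel t z * norm z ^ 4))"
        using \<theta> by (intro ennreal_plus mult_nonneg_nonneg heat_kernel_nonneg) auto
      also have "\<dots> = ennreal (1 + \<theta>) * ennreal (heat_kernel t z * (?g \<bullet> z)\<^sup>2)
          + ennreal ((1 + 1 / \<theta>) * K\<^sup>2) * ennreal (heat_kernel t z * norm z ^ 4)"
        using \<theta> by (intro arg_cong2[where f
            = "(+)"] ennreal_mult mult_nonneg_nonneg heat_kernel_nonneg) auto
      finally show "ennreal (heat_kernel t z * (cutoff l k (x - z) - cutoff l k x)\<^sup>2)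
        \<le> ennreal (1 + \<theta>) * ennreal (heat_kernel t z * (?g \<bullet> z)\<^sup>2)
          + ennreal ((1 + 1 / \<theta>) * K\<^sup>2) * ennreal (heat_kernel t z * norm z ^ 4)" .
    qed
    also have "\<dots> = ennreal (1 + \<theta>) * (\<integral>\<^sup>+z. ennreal (heat_kernel t z * (?g \<bullet> z)\<^sup>2) \<partial>lebesgue)
        + ennreal ((1 + 1 / \<theta>) * K\<^sup>2) * (\<integral>\<^sup>+z. ennreal (heat_kernel t z * norm (z :: real ^ 'd) ^ 4)
            \<partial>lebesgue)"
      unfolding nn_integral_completion
      by (subst nn_integral_add, measurable, subst nn_integral_cmult, measurable, subst
          nn_integral_cmult) auto
    also have "\<dots> \<le> ennreal (1 + \<theta>) * ennreal (2 * (exp (t * (norm ?g)\<^sup>2) - 1))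
        + ennreal ((1 + 1 / \<theta>) * K\<^sup>2) * ennreal (144 * ?d ^ 3 * t\<^sup>2)"
      using nn_integral_heat_kernel_inner_sq[OF t(1), of ?g]
        nn_integral_heat_kernel_norm_pow4[OF t(1), where 'a = "real ^ 'd"]
      by (intro add_mono mult_left_mono) auto
    also have "\<dots> = ennreal ((1 + \<theta>) * (2 * (exp (t * (norm ?g)\<^sup>2) - 1)) + (1
        + 1 / \<theta>) * K\<^sup>2 * (144 * ?d ^ 3 * t\<^sup>2))"
      using \<theta> t by (subst ennreal_mult[symmetric], simp, simp, subst ennreal_mult[symmetric], simp,
          simp,
          subst ennreal_plus[symmetric]) auto
    also have "\<dots> \<le> ennreal (2 * (1 + \<theta>) * t * (norm ?g)\<^sup>2 + C * t\<^sup>2)"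
    proof (rule ennreal_leI)
      let ?y = "t * (norm ?g)\<^sup>2"
      have gG: "(norm ?g)\<^sup>2 \<le> G" using norm_cutoff_grad_le[OF l] by (simp add: G_def)
      have yG: "?y \<le> t * G" using gG t by (intro mult_left_mono) auto
      also have "t * G \<le> 1" using t G by (simp add: field_simps)
      finally have y1: "?y \<le> 1" .
      \<comment> \<open>The restriction \<open>t \<le> 1 / G\<close> serves this quadratic bound of
        the exponential, available for arguments in [0, 1].\<close>
      have "exp ?y \<le> 1 + ?y + ?y\<^sup>2" using y1 t by (intro exp_bound) auto
      also have "?y\<^sup>2 \<le> (t * G)\<^sup>2" using yG t by (intro power_mono) auto
      finally have "exp ?y - 1 \<le> ?y + t\<^sup>2 * G\<^sup>2" by (simp add: power_mult_distrib)
      then have "(1 + \<theta>) * (2 * (exp ?y - 1)) \<le> (1 + \<theta>) * (2 * (?y + t\<^sup>2 * G\<^sup>2))"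
        using \<theta> by (intro mult_left_mono) auto
      then show "(1 + \<theta>) * (2 * (exp ?y - 1)) + (1 + 1 / \<theta>) * K\<^sup>2 * (144 * ?d ^ 3 * t\<^sup>2)
          \<le> 2 * (1 + \<theta>) * t * (norm ?g)\<^sup>2 + C * t\<^sup>2"
        by (simp add: C_def algebra_simps)
    qed
    finally show ?thesis .
  qed
  then show ?thesis using G C0 by (intro exI[of _ C] exI[of _ "1 / G"]) auto
qed

section \<open>Exponentially decaying weights on the lattice\<close>

lemma nn_integral_count_space_bound:
  fixes f :: "'b::countable \<Rightarrow> ennreal"
  assumes "\<And>F. finite F \<Longrightarrow> sum f F \<le> c"
  shows "(\<integral>\<^sup>+k. f k \<partial>count_space UNIV) \<le> c"
proof -
  define A where "A n = {k :: 'b. to_nat k < n}" for n :: nat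
  have A: "finite (A n)" for n :: nat
    by (rule finite_imageD[of to_nat]) (auto simp: A_def inj_on_def intro: finite_subset[of _ "{..<n}"])
  have f: "f k = (SUP n. f k * indicator (A n) k)" for k
  proof (rule antisym)
      have "f k = f k * indicator (A (Suc (to_nat k))) k" by (simp add: A_def)
      also have "\<dots> \<le> (SUP n. f k * indicator (A n) k)" by (rule SUP_upper) simp
      finally show "f k \<le> (SUP n. f k * indicator (A n) k)" .
      show "(SUP n. f k * indicator (A n) k) \<le> f k"
        by (rule SUP_least) (auto simp: indicator_def)
  qed
  have "(\<integral>\<^sup>+k. f k \<partial>count_space UNIV) = (\<integral>\<^sup>+k. (SUP n. f k * indicator (A n) k) \<partial>count_space UNIV)"
    by (rule nn_integral_cong) (rule f)
  also have "\<dots> = (SUP n. \<integral>\<^sup>+k. f k * indicator (A n) k \<partial>count_space UNIV)"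
    by (rule nn_integral_monotone_convergence_SUP) (auto simp: incseq_def le_fun_def A_def
        indicator_def)
  also have "\<dots> \<le> c"
  proof (rule SUP_least)
    fix n
    have "(\<integral>\<^sup>+k. f k * indicator (A n) k \<partial>count_space UNIV) = (\<Sum>k\<in>A n. f k * indicator (A n) k)"
      by (rule nn_integral_count_space') (use A in auto)
    also have "\<dots> = sum f (A n)" by (intro sum.cong) auto
    also have "\<dots> \<le> c" by (rule assms[OF A])
    finally show "(\<integral>\<^sup>+k. f k * indicator (A n) k \<partial>count_space UNIV) \<le> c" .
  qed
  finally show ?thesis .
qed

text \<open>This is 9 to the power minus the l1-distance: a unit step in one coordinate changes it
  by at most the factor 9 that \<open>weighted_bump_gradient\<close> admits.\<close>

definition decay :: "('d::finite \<Rightarrow> int) \<Rightarrow> ('d \<Rightarrow> int) \<Rightarrow> real" where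
  "decay j k = (\<Prod>i\<in>UNIV. (1 / 9) ^ nat \<bar>k i - j i\<bar>)"

lemma decay_nonneg: "0 \<le> decay j k"
  unfolding decay_def by (intro prod_nonneg) auto

lemma decay_self [simp]: "decay j j = 1"
  by (simp add: decay_def)

lemma decay_step:
  assumes "\<bar>a - k i\<bar> \<le> 1"
  shows "decay j (k(i := a)) \<le> 9 * decay j k"
proof -
  have "(1 / 9 :: real) ^ nat \<bar>a - j i\<bar> * (1 / 9) \<le> (1 / 9) ^ nat \<bar>k i - j i\<bar>"
  proof -
    have "nat \<bar>k i - j i\<bar> \<le> Suc (nat \<bar>a - j i\<bar>)" using assms by linarith
    then have "(1 / 9 :: real) ^ Suc (nat \<bar>a - j i\<bar>) \<le> (1 / 9) ^ nat \<bar>k i - j i\<bar>"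
      by (intro power_decreasing) auto
    then show ?thesis by simp
  qed
  then have 1: "(1 / 9 :: real) ^ nat \<bar>a - j i\<bar> \<le> 9 * (1 / 9) ^ nat \<bar>k i - j i\<bar>" by simp
  let ?P = "\<Prod>m\<in>UNIV - {i}. (1 / 9 :: real) ^ nat \<bar>k m - j m\<bar>"
  have "decay j (k(i := a)) = (1 / 9) ^ nat \<bar>a - j i\<bar> * ?P"
    unfolding decay_def by (subst prod.remove[of UNIV i]) auto
  also have "\<dots> \<le> (9 * (1 / 9) ^ nat \<bar>k i - j i\<bar>) * ?P"
    by (intro mult_right_mono 1 prod_nonneg) auto
  also have "\<dots> = 9 * decay j k"
    unfolding decay_def by (subst prod.remove[of UNIV i]) auto
  finally show ?thesis .
qed

text \<open>5/4 = 1 + 2 * (1/9 + 1/81 + ...). The induction is carried by the exact value of the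
  partial sum.\<close>

lemma sum_decay_int: "(\<Sum>a\<in>{j - int R..j + int R}. (1 / 9 :: real) ^ nat \<bar>a - j\<bar>) \<le> 5 / 4"
proof -
  have "(\<Sum>a\<in>{j - int R..j + int R}. (1 / 9 :: real) ^ nat \<bar>a - j\<bar>) = 5 / 4 - (1 / 4) * (1 / 9) ^ R"
  proof (induction R)
    case (Suc R)
    have "{j - int (Suc R)..j + int (Suc R)} = insert (j - int (Suc R)) (insert (j
        + int (Suc R)) {j - int R..j + int R})"
      by auto
    moreover have "nat \<bar>j - int (Suc R) - j\<bar> = Suc R" "nat \<bar>j + int (Suc R) - j\<bar> = Suc R" by simp_all
    moreover have "j - int (Suc R) \<notin> insert (j + int (Suc R)) {j - int R..j + int R}"
      "j + int (Suc R) \<notin> {j - int R..j + int R}" by auto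
    ultimately have "(\<Sum>a\<in>{j - int (Suc R)..j + int (Suc R)}. (1 / 9 :: real) ^ nat \<bar>a - j\<bar>)
        = (1 / 9) ^ Suc R + ((1 / 9) ^ Suc R + (\<Sum>a\<in>{j - int R..j
            + int R}. (1 / 9 :: real) ^ nat \<bar>a - j\<bar>))"
      by (simp only: sum.insert finite_insert finite_atLeastAtMost_int not_False_eq_True simp_thms)
    then show ?case unfolding Suc by simp
  qed simp
  then show ?thesis by simp
qed

text \<open>Over a box that contains the finite set, the sum factorises into one-dimensional
  sums.\<close>

lemma sum_decay_le:
  fixes j :: "'d::finite \<Rightarrow> int"
  assumes "finite F"
  shows "(\<Sum>k\<in>F. decay j k) \<le> (5 / 4) ^ CARD('d)"
proof -
  obtain R :: nat where R: "\<And>k i. k \<in> F \<Longrightarrow> \<bar>k i - j i\<bar> \<le> int R"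
  proof -
    let ?S = "(\<lambda>(k, i). nat \<bar>k i - j i\<bar>) ` (F \<times> UNIV)"
    have fin: "finite ?S" using assms by simp
    have "\<bar>k i - j i\<bar> \<le> int (Max ?S)" if "k \<in> F" for k i
      using Max_ge[OF fin, of "nat \<bar>k i - j i\<bar>"] that by (force simp: nat_le_iff)
    then show ?thesis using that by blast
  qed
  have sub: "F \<subseteq> PiE UNIV (\<lambda>i. {j i - int R..j i + int R})"
  proof
    fix k assume "k \<in> F"
    then have "j i - int R \<le> k i \<and> k i \<le> j i + int R" for i
      using R[of k i] by linarith
    then show "k \<in> PiE UNIV (\<lambda>i. {j i - int R..j i + int R})" by (simp add: PiE_iff)
  qed
  have "(\<Sum>k\<in>F. decay j k) \<le> (\<Sum>k\<in>PiE UNIV (\<lambda>i. {j i - int R..j i + int R}). decay j k)"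
    using sub by (intro sum_mono2) (auto intro: finite_PiE decay_nonneg)
  also have "\<dots> = (\<Prod>i\<in>UNIV. \<Sum>a\<in>{j i - int R..j i + int R}. (1 / 9) ^ nat \<bar>a - j i\<bar>)"
    unfolding decay_def by (rule prod_sum_PiE[symmetric]) auto
  also have "\<dots> \<le> (\<Prod>i\<in>(UNIV::'d set). 5 / 4)"
    by (intro prod_mono conjI sum_decay_int sum_nonneg) auto
  finally show ?thesis by simp
qed

lemma cutoff_eq_0:
  assumes "1 \<le> \<bar>x $ i / l - of_int (k i)\<bar>"
  shows "cutoff l k x = 0"
  unfolding cutoff_def using bump_eq_0[OF assms] by (intro prod_zero) auto

text \<open>At a given point at most two bumps per coordinate are alive, so the sum is finite and
  factorises into the one-dimensional partitions of unity.\<close>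

lemma nn_integral_cutoff:
  fixes x :: "real ^ 'd"
  shows "(\<integral>\<^sup>+k. ennreal (cutoff l k x) \<partial>count_space UNIV) = 1"
proof -
  define m where "m i = \<lfloor>x $ i / l\<rfloor>" for i
  let ?A = "\<lambda>i. {m i, m i + 1}"
  have "(\<integral>\<^sup>+k. ennreal (cutoff l k x) \<partial>count_space UNIV) = (\<Sum>k\<in>PiE UNIV ?A. ennreal (cutoff l k x))"
  proof (rule nn_integral_count_space')
    fix k assume "k \<notin> PiE UNIV ?A"
    then obtain i where "k i \<noteq> m i" "k i \<noteq> m i + 1" by (auto simp: PiE_def)
    then have "cutoff l k x = 0"
      using bump_partition(2)[of "k i" "x $ i / l"] by (intro cutoff_eq_0) (auto simp: m_def)
    then show "ennreal (cutoff l k x) = 0" by simp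
  qed (auto intro: finite_PiE)
  also have "\<dots> = ennreal (\<Sum>k\<in>PiE UNIV ?A. cutoff l k x)"
    by (simp add: cutoff_bounds sum_ennreal)
  also have "(\<Sum>k\<in>PiE UNIV ?A. cutoff l k x) = (\<Prod>i\<in>UNIV. \<Sum>a\<in>?A i. bump (x $ i / l - of_int a))"
    unfolding cutoff_def by (rule prod_sum_PiE[symmetric]) auto
  also have "\<dots> = 1"
    using bump_partition(1) by (intro prod.neutral) (auto simp: m_def)
  finally show ?thesis by simp
qed

text \<open>Gradients are compared with cutoffs one coordinate at a time: the two cells that share a
  point in direction \<open>i\<close> are exchanged by the flip \<open>k i \<mapsto> 2 \<lfloor>x i / l\<rfloor> + 1 - k i\<close>, and their
  weights differ at most by the factor \<open>9\<close>.\<close>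

lemma weighted_cutoff_gradient_le:
  fixes x :: "real ^ 'd" and W :: "('d \<Rightarrow> int) \<Rightarrow> real"
  assumes l: "0 < l" and W: "\<And>k. 0 < W k"
    and step: "\<And>k i a. \<bar>a - k i\<bar> \<le> 1 \<Longrightarrow> W k \<le> 9 * W (k(i := a))"
  shows "(\<integral>\<^sup>+k. ennreal (W k * (norm (cutoff_grad l k x))\<^sup>2) \<partial>count_space UNIV)
    \<le> ennreal (5 / 3 * pi\<^sup>2 * real CARD('d) / l\<^sup>2) * (\<integral>\<^sup>+k. ennreal (W k * (cutoff l k x)\<^sup>2)
        \<partial>count_space UNIV)"
proof -
  define P where "P i k = (\<Prod>j\<in>UNIV - {i}. (bump (x $ j / l - of_int (k j)))\<^sup>2)"
      for i and k :: "'d \<Rightarrow> int"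
  define g where "g i k = (dbump (x $ i / l - of_int (k i)) / l)\<^sup>2 * P i k" for i and k :: "'d \<Rightarrow> int"
  have P0: "0 \<le> P i k" for i k unfolding P_def by (intro prod_nonneg) auto
  have g0: "0 \<le> g i k" for i k unfolding g_def using P0 by simp
  have cutP: "(cutoff l k x)\<^sup>2 = (bump (x $ i / l - of_int (k i)))\<^sup>2 * P i k" for i k
    unfolding cutoff_def P_def prod_power_distrib[symmetric] power_mult_distrib[symmetric]
    by (subst prod.remove[of UNIV i]) auto
  let ?C = "5 / 3 * pi\<^sup>2 / l\<^sup>2"
  let ?X = "\<integral>\<^sup>+k. ennreal (W k * (cutoff l k x)\<^sup>2) \<partial>count_space UNIV"
  have coord: "(\<integral>\<^sup>+k. ennreal (W k * g i k) \<partial>count_space UNIV) \<le> ennreal ?C * ?X" for i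
  proof -
    define f where "f k = k(i := 2 * \<lfloor>x $ i / l\<rfloor> + 1 - k i)" for k :: "'d \<Rightarrow> int"
    have ff: "f (f k) = k" for k by (auto simp: f_def)
    have bij: "bij_betw f UNIV UNIV"
      by (rule bij_betw_byWitness[of _ f]) (auto simp: ff)
    have flip: "(\<integral>\<^sup>+k. h (f k) \<partial>count_space UNIV) = (\<integral>\<^sup>+k. h k \<partial>count_space UNIV)"
        for h :: "_ \<Rightarrow> ennreal"
      by (rule nn_integral_bij_count_space[OF bij])
    have Pf: "P i (f k) = P i k" for k
      unfolding P_def by (intro prod.cong) (auto simp: f_def)
    have pair: "W k * g i k + W (f k) * g i (f k) \<le> ?C * (W k * (cutoff l k x)\<^sup>2
        + W (f k) * (cutoff l (f k) x)\<^sup>2)" for k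
    proof -
      let ?s = "x $ i / l"
      let ?k' = "2 * \<lfloor>?s\<rfloor> + 1 - k i"
      define D0 D1 B0 B1 where DB: "D0 = (dbump (?s - of_int (k i)))\<^sup>2" "D1
          = (dbump (?s - of_int ?k'))\<^sup>2"
        "B0 = (bump (?s - of_int (k i)))\<^sup>2" "B1 = (bump (?s - of_int ?k'))\<^sup>2"
      have "W k * D0 + W (f k) * D1 \<le> 5 / 3 * pi\<^sup>2 * (W k * B0 + W (f k) * B1)"
        unfolding DB
      proof (rule weighted_bump_gradient)
        \<comment> \<open>The ratio of the weights is asked for only at the two overlapping
          translates; there the flip changes one coordinate by exactly one, so \<open>step\<close>
          applies in both directions.\<close>
        assume "k i = \<lfloor>?s\<rfloor> \<or> k i = \<lfloor>?s\<rfloor> + 1"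
        then have "\<bar>?k' - k i\<bar> \<le> 1" by auto
        then have "W k \<le> 9 * W (f k)" "W (f k) \<le> 9 * W ((f k)(i := k i))"
          using step[of ?k' k i] step[of "k i" "f k" i] by (auto simp: f_def abs_minus_commute)
        moreover have "(f k)(i := k i) = k" by (auto simp: f_def)
        ultimately show "W k \<le> 9 * W (f k) \<and> W (f k) \<le> 9 * W k" by simp
      qed (use W in auto)
      then have "(W k * D0 + W (f k) * D1) * (P i k / l\<^sup>2) \<le> (5 / 3 * pi\<^sup>2 * (W k * B0
          + W (f k) * B1)) * (P i k / l\<^sup>2)"
        by (rule mult_right_mono) (use P0 in simp)
      moreover have "f k i = ?k'" by (simp add: f_def)
      then have e: "g i k = D0 / l\<^sup>2 * P i k" "g i (f k) = D1 / l\<^sup>2 * P i k"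
        "(cutoff l k x)\<^sup>2 = B0 * P i k" "(cutoff l (f k) x)\<^sup>2 = B1 * P i k"
        by (simp_all only: g_def DB power_divide Pf cutP[of _ i])
      have "W k * g i k + W (f k) * g i (f k) = (W k * D0 + W (f k) * D1) * (P i k / l\<^sup>2)"
        "?C * (W k * (cutoff l k x)\<^sup>2 + W (f k) * (cutoff l (f k) x)\<^sup>2)
          = (5 / 3 * pi\<^sup>2 * (W k * B0 + W (f k) * B1)) * (P i k / l\<^sup>2)"
        unfolding e using l by (simp_all add: field_simps)
      ultimately show ?thesis by (simp only:)
    qed
    \<comment> \<open>Symmetrisation: the sum over \<open>k\<close> equals the sum over
      \<open>f k\<close>, so twice the sum is controlled term by term through
      \<open>pair\<close>.\<close>
    have "2 * (\<integral>\<^sup>+k. ennreal (W k * g i k) \<partial>count_space UNIV)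
        = (\<integral>\<^sup>+k. ennreal (W k * g i k) \<partial>count_space UNIV)
            + (\<integral>\<^sup>+k. ennreal (W (f k) * g i (f k)) \<partial>count_space UNIV)"
      unfolding flip[of "\<lambda>k. ennreal (W k * g i k)"] by (simp add: mult_2)
    also have "\<dots> = (\<integral>\<^sup>+k. ennreal (W k * g i k + W (f k) * g i (f k)) \<partial>count_space UNIV)"
      using W g0 by (subst nn_integral_add[symmetric]) (auto intro!: nn_integral_cong simp: less_imp_le)
    also have "\<dots> \<le> (\<integral>\<^sup>+k. ennreal (?C * (W k * (cutoff l k x)\<^sup>2
        + W (f k) * (cutoff l (f k) x)\<^sup>2)) \<partial>count_space UNIV)"
      by (intro nn_integral_mono ennreal_leI pair)
    also have "\<dots> = (\<integral>\<^sup>+k. ennreal ?C * (ennreal (W k * (cutoff l k x)\<^sup>2)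
        + ennreal (W (f k) * (cutoff l (f k) x)\<^sup>2)) \<partial>count_space UNIV)"
    proof (rule nn_integral_cong)
      fix k
      have n: "0 \<le> W k * (cutoff l k x)\<^sup>2" "0 \<le> W (f k) * (cutoff l (f k) x)\<^sup>2"
        using W[of k] W[of "f k"] by (auto simp: less_imp_le)
      show "ennreal (?C * (W k * (cutoff l k x)\<^sup>2 + W (f k) * (cutoff l (f k) x)\<^sup>2))
        = ennreal ?C * (ennreal (W k * (cutoff l k x)\<^sup>2) + ennreal (W (f k) * (cutoff l (f k) x)\<^sup>2))"
        unfolding ennreal_plus[OF n, symmetric] by (rule ennreal_mult) (use n in auto)
    qed
    also have "\<dots> = ennreal ?C * (?X + (\<integral>\<^sup>+k. ennreal (W (f k) * (cutoff l (f k) x)\<^sup>2) \<partial>count_space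
        UNIV))"
      by (simp add: nn_integral_cmult nn_integral_add)
    also have "\<dots> = 2 * (ennreal ?C * ?X)"
      unfolding flip[of "\<lambda>k. ennreal (W k * (cutoff l k x)\<^sup>2)"] by (simp add: mult_2 distrib_left)
    finally show ?thesis by (simp add: ennreal_mult_le_mult_iff)
  qed
  have "(\<integral>\<^sup>+k. ennreal (W k * (norm (cutoff_grad l k x))\<^sup>2) \<partial>count_space UNIV)
      = (\<integral>\<^sup>+k. (\<Sum>i\<in>UNIV. ennreal (W k * g i k)) \<partial>count_space UNIV)"
    using W g0 unfolding norm_cutoff_grad_sq g_def[symmetric] P_def[symmetric]
    by (intro nn_integral_cong) (simp add: sum_ennreal less_imp_le sum_distrib_left)
  also have "\<dots> = (\<Sum>i\<in>UNIV. \<integral>\<^sup>+k. ennreal (W k * g i k) \<partial>count_space UNIV)"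
    by (rule nn_integral_sum) simp
  also have "\<dots> \<le> (\<Sum>i\<in>(UNIV::'d set). ennreal ?C * ?X)" by (intro sum_mono coord)
  also have "\<dots> = of_nat CARD('d) * (ennreal ?C * ?X)" by simp
  also have "\<dots> = ennreal (5 / 3 * pi\<^sup>2 * real CARD('d) / l\<^sup>2) * ?X"
    by (simp add: mult.assoc[symmetric] ennreal_of_nat_eq_real_of_nat flip: ennreal_mult)
      (simp add: mult_ac)
  finally show ?thesis .
qed

lemma emeasure_cutoff_support:
  fixes k :: "'d::finite \<Rightarrow> int"
  assumes l: "0 < l"
  defines "B \<equiv> cbox (\<chi> i. l * of_int (k i) - l) (\<chi> i. l * of_int (k i) + l) :: (real ^ 'd) set"
  shows "emeasure lebesgue B = ennreal ((2 * l) ^ CARD('d))" and "x \<notin> B \<Longrightarrow> cutoff l k x = 0"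
proof -
  let ?a = "(\<chi> i. l * of_int (k i) - l) :: real ^ 'd" and ?b = "(\<chi> i. l * of_int (k i)
      + l) :: real ^ 'd"
  have B: "?a \<bullet> b \<le> ?b \<bullet> b" "(?b - ?a) \<bullet> b = 2 * l" if "b \<in> Basis" for b
    using that l by (auto simp: Basis_vec_def inner_axis)
  show "emeasure lebesgue B = ennreal ((2 * l) ^ CARD('d))"
    unfolding B_def using B by (simp add: emeasure_lborel_cbox)
  assume "x \<notin> B"
  then obtain i where "x $ i < l * of_int (k i) - l \<or> l * of_int (k i) + l < x $ i"
    by (auto simp: B_def mem_box_cart not_le)
  then have "1 \<le> \<bar>x $ i / l - of_int (k i)\<bar>"
  proof
    assume "x $ i < l * of_int (k i) - l"
    then have "x $ i / l < of_int (k i) - 1" using l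
        by (simp only: pos_divide_less_eq) (simp add: algebra_simps)
    then show ?thesis by simp
  next
    assume "l * of_int (k i) + l < x $ i"
    then have "of_int (k i) + 1 < x $ i / l" using l
        by (simp only: pos_less_divide_eq) (simp add: algebra_simps)
    then show ?thesis by simp
  qed
  then show "cutoff l k x = 0" by (rule cutoff_eq_0)
qed

section \<open>Localisation of an eigenfunction\<close>

lemma pow4_convolution:
  fixes x y :: "'a::euclidean_space"
  assumes t: "0 < t"
  shows "(\<integral>\<^sup>+y. ennreal (heat_kernel t (x - y) * norm (x - y) ^ 4) \<partial>lebesgue)
      \<le> ennreal (144 * real DIM('a) ^ 3 * t\<^sup>2)"
    and "(\<integral>\<^sup>+x. ennreal (heat_kernel t (x - y) * norm (x - y) ^ 4) \<partial>lebesgue)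
        \<le> ennreal (144 * real DIM('a) ^ 3 * t\<^sup>2)"
proof -
  have m: "(\<lambda>z::'a. ennreal (heat_kernel t z * norm z ^ 4)) \<in> borel_measurable borel" by measurable
  show "(\<integral>\<^sup>+y. ennreal (heat_kernel t (x - y) * norm (x - y) ^ 4) \<partial>lebesgue)
      \<le> ennreal (144 * real DIM('a) ^ 3 * t\<^sup>2)"
    using nn_integral_lebesgue_reflect[OF m, of x] nn_integral_heat_kernel_norm_pow4[OF t, where 'a
        = 'a] by simp
  show "(\<integral>\<^sup>+x. ennreal (heat_kernel t (x - y) * norm (x - y) ^ 4) \<partial>lebesgue)
      \<le> ennreal (144 * real DIM('a) ^ 3 * t\<^sup>2)"
    using nn_integral_lebesgue_shift[OF m, of "- y"] nn_integral_heat_kernel_norm_pow4[OF t, where 'a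
        = 'a] by simp
qed

text \<open>The choice is \<sigma> = B / n. Cauchy-Schwarz is used in this additive form with a
  parameter, which suits sums in the extended reals.\<close>

lemma sq_le_if_AM_GM:
  fixes n :: real
  assumes "\<And>\<sigma>. 0 < \<sigma> \<Longrightarrow> 2 * n \<le> \<sigma> * A + B / \<sigma>" "0 \<le> n" "0 < B" "0 \<le> A"
  shows "n\<^sup>2 \<le> A * B"
proof (cases "n = 0")
  case False
  then have n: "0 < n" using assms by simp
  have "2 * n \<le> B / n * A + B / (B / n)" using n assms by (intro assms) simp
  then have "n \<le> B / n * A" using n assms by simp
  then show ?thesis using n by (simp add: field_simps power2_eq_square)
qed (use assms in simp)

text \<open>\<open>l_large\<close> says that the constant of
  \<open>weighted_cutoff_gradient_le\<close> is at most 4/5 of \<open>\<epsilon> * lam\<close>: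
  gradient terms can be absorbed, and a fifth remains.\<close>

locale eigen_localisation = compact_dominated_semigroup \<Omega> T H
  for \<Omega> :: "(real ^ 'd) set" and T :: "real \<Rightarrow> (real ^ 'd) L2 \<Rightarrow> (real ^ 'd) L2"
    and H :: "((real ^ 'd) L2 \<times> (real ^ 'd) L2) set" +
  fixes \<phi> :: "(real ^ 'd) L2" and lam \<epsilon> l :: real
  assumes eig: "\<phi> \<in> eigenspace H lam" and nonzero: "\<phi> \<noteq> 0" and eps: "0 < \<epsilon>" and l: "0 < l"
    and l_large: "5 / 3 * pi\<^sup>2 * real CARD('d) / l\<^sup>2 \<le> 4 / 5 * (\<epsilon> * lam)"
begin

definition part :: "('d \<Rightarrow> int) \<Rightarrow> (real ^ 'd) L2" where
  "part k = mult_L2 (cutoff l k) \<phi>"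

definition mass :: "('d \<Rightarrow> int) \<Rightarrow> real" where
  "mass k = (norm (part k))\<^sup>2"

definition gradient_mass :: "('d \<Rightarrow> int) \<Rightarrow> real" where
  "gradient_mass k = (LINT x|lebesgue. (norm (cutoff_grad l k x))\<^sup>2 * (cmod (rep_L2 \<phi> x))\<^sup>2)"

definition energy :: "real \<Rightarrow> ('d \<Rightarrow> int) \<Rightarrow> real" where
  "energy t k = (norm (part k))\<^sup>2 - Re (cinner (T t (part k)) (part k))"

text \<open>Encodes that the form at \<open>part k\<close> is strictly below (1 + \<epsilon>) lam
  times the squared norm. Energy over time does not decrease along the dyadic times, so strictness
  becomes a margin \<delta> valid at all of them, and an infinite form value simply counts as not
  resonant.\<close>

definition resonant :: "('d \<Rightarrow> int) \<Rightarrow> bool" where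
  "resonant k \<longleftrightarrow> part k \<noteq> 0 \<and>
    (\<exists>\<delta>>0. \<forall>n. energy ((1 / 2) ^ n) k \<le> (1 / 2) ^ n * ((1 + \<epsilon>) * lam - \<delta>) * mass k)"

lemma phi_V: "\<phi> \<in> V"
  using eig by (simp add: eigenspace_iff gen_def)

lemma lam_pos: "0 < lam"
  using eigen_pos[OF _ nonzero] eig by (simp add: eigenspace_iff)

lemma part_V: "part k \<in> V"
  unfolding part_def by (intro L2_on_mult bounded_measurable_cutoff phi_V)

lemma rep_part_AE: "AE x in lebesgue. rep_L2 (part k) x = of_real (cutoff l k x) * rep_L2 \<phi> x"
  unfolding part_def by (intro rep_mult_AE bounded_measurable_cutoff)

lemma cmod_part_AE: "AE x in lebesgue. cmod (rep_L2 (part k) x) = cutoff l k x * cmod (rep_L2 \<phi> x)"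
  using rep_part_AE[of k] by eventually_elim (simp add: norm_mult cutoff_bounds)

lemma cutoff_measurable [measurable]: "cutoff l k \<in> borel_measurable lebesgue"
  using bounded_measurable_cutoff[of l k] by (simp add: bounded_measurable_def)

lemma nn_integral_mass:
  "(\<integral>\<^sup>+x. ennreal ((cutoff l k x)\<^sup>2) * ennreal ((cmod (rep_L2 \<phi> x))\<^sup>2) \<partial>lebesgue) = ennreal (mass k)"
  unfolding mass_def nn_integral_rep_sq[symmetric]
  by (rule nn_integral_cong_AE)
    (use cmod_part_AE[of k] in \<open>eventually_elim, simp add: power_mult_distrib ennreal_mult\<close>)

lemma integrable_gradient_mass:
  "integrable lebesgue (\<lambda>x. (norm (cutoff_grad l k x))\<^sup>2 * (cmod (rep_L2 \<phi> x))\<^sup>2)"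
proof (rule Bochner_Integration.integrable_bound)
  show "integrable lebesgue (\<lambda>x. real CARD('d) * (2 / l)\<^sup>2 * (cmod (rep_L2 \<phi> x))\<^sup>2)"
    using integrable_cmod_rep_sq[of \<phi>] by simp
  show "AE x in lebesgue. norm ((norm (cutoff_grad l k x))\<^sup>2 * (cmod (rep_L2 \<phi> x))\<^sup>2)
      \<le> norm (real CARD('d) * (2 / l)\<^sup>2 * (cmod (rep_L2 \<phi> x))\<^sup>2)"
    using norm_cutoff_grad_le[OF l, of k] by (intro AE_I2) (simp add: mult_right_mono)
qed measurable

lemma gradient_mass_nonneg: "0 \<le> gradient_mass k"
  unfolding gradient_mass_def by simp

lemma nn_integral_gradient_mass:
  "(\<integral>\<^sup>+x. ennreal ((norm (cutoff_grad l k x))\<^sup>2) * ennreal ((cmod (rep_L2 \<phi> x))\<^sup>2) \<partial>lebesgue)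
      = ennreal (gradient_mass k)"
  unfolding gradient_mass_def
  by (subst nn_integral_eq_integral[symmetric, OF integrable_gradient_mass]) (auto simp: ennreal_mult)

text \<open>\<open>IMS_bound\<close> for the eigenfunction: the product of \<open>T t \<phi>\<close>
  with the twice cut-off \<phi> is \<open>exp (- lam * t) * mass k\<close>, and the error is the
  heat energy of the cutoff. Divided by \<open>t\<close>, it is the localisation formula up to
  \<theta> and O(t).\<close>

lemma energy_le:
  assumes \<theta>: "0 < \<theta>"
  shows "\<exists>C t0. 0 < t0 \<and> (\<forall>t. 0 < t \<and> t \<le> t0 \<longrightarrow>
    energy t k \<le> t * (lam * mass k + (1 + \<theta>) * gradient_mass k + C * t))"
proof -
  obtain C t0 where t0: "0 < t0" and C: "0 \<le> C" and G: "\<And>t x. 0 < t \<Longrightarrow> t \<le> t0 \<Longrightarrow>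
    (\<integral>\<^sup>+y. ennreal (heat_kernel t (x - y) * (cutoff l k y - cutoff l k x)\<^sup>2) \<partial>lebesgue)
      \<le> ennreal (2 * (1 + \<theta>) * t * (norm (cutoff_grad l k x))\<^sup>2 + C * t\<^sup>2)"
    using heat_energy_cutoff_le[OF l \<theta>, of k] by blast
  have "energy t k \<le> t * (lam * mass k + (1 + \<theta>) * gradient_mass k + (C * (norm \<phi>)\<^sup>2 / 2) * t)"
    if t: "0 < t" "t \<le> t0" for t
  proof -
    let ?p = "\<lambda>x. ennreal ((cmod (rep_L2 \<phi> x))\<^sup>2)"
    let ?m2 = "mult_L2 (\<lambda>x. (cutoff l k x)\<^sup>2) \<phi>"
    have b2: "bounded_measurable (\<lambda>x. (cutoff l k x)\<^sup>2)"
      using bounded_measurable_power2[OF bounded_measurable_cutoff[of l k], of 0] by simp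
    have "(\<integral>\<^sup>+x. ?p x * (\<integral>\<^sup>+y. ennreal (heat_kernel t (x - y) * (cutoff l k y - cutoff l k x)\<^sup>2)
        \<partial>lebesgue) \<partial>lebesgue)
        \<le> (\<integral>\<^sup>+x. ?p x * ennreal (2 * (1 + \<theta>) * t * (norm (cutoff_grad l k x))\<^sup>2 + C * t\<^sup>2) \<partial>lebesgue)"
      by (intro nn_integral_mono mult_left_mono G t) simp
    also have "\<dots> = (\<integral>\<^sup>+x. ennreal (2 * (1 + \<theta>) * t) * (ennreal ((norm (cutoff_grad l k x))\<^sup>2) * ?p x)
        + ennreal (C * t\<^sup>2) * ?p x \<partial>lebesgue)"
    proof (rule nn_integral_cong)
      fix x
      have "ennreal (2 * (1 + \<theta>) * t * (norm (cutoff_grad l k x))\<^sup>2 + C * t\<^sup>2)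
          = ennreal (2 * (1 + \<theta>) * t) * ennreal ((norm (cutoff_grad l k x))\<^sup>2) + ennreal (C * t\<^sup>2)"
        using \<theta> t C by (subst ennreal_plus) (auto intro!: ennreal_mult)
      then show "?p x * ennreal (2 * (1 + \<theta>) * t * (norm (cutoff_grad l k x))\<^sup>2 + C * t\<^sup>2)
          = ennreal (2 * (1 + \<theta>) * t) * (ennreal ((norm (cutoff_grad l k x))\<^sup>2) * ?p x)
              + ennreal (C * t\<^sup>2) * ?p x"
        by (simp only: distrib_left distrib_right mult.assoc mult.commute mult.left_commute)
    qed
    also have "\<dots> = ennreal (2 * (1 + \<theta>) * t) * ennreal (gradient_mass k)
        + ennreal (C * t\<^sup>2) * ennreal ((norm \<phi>)\<^sup>2)"
      unfolding nn_integral_gradient_mass[symmetric] nn_integral_rep_sq[symmetric]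
      by (simp add: nn_integral_add nn_integral_cmult)
    also have "\<dots> = ennreal (2 * (1 + \<theta>) * t * gradient_mass k + C * t\<^sup>2 * (norm \<phi>)\<^sup>2)"
    proof -
      have n: "0 \<le> 2 * (1 + \<theta>) * t" "0 \<le> gradient_mass k" "0 \<le> C * t\<^sup>2" "0 \<le> (norm \<phi>)\<^sup>2"
        using \<theta> t C gradient_mass_nonneg by auto
      show ?thesis
        unfolding ennreal_mult[OF n(1,2), symmetric] ennreal_mult[OF n(3,4), symmetric]
        by (rule ennreal_plus[symmetric]) (intro mult_nonneg_nonneg n)+
    qed
    finally have "ennreal (2 * \<bar>Re (cinner (T t \<phi>) ?m2) - Re (cinner (T t (part k)) (part k))\<bar>)
        \<le> ennreal (2 * (1 + \<theta>) * t * gradient_mass k + C * t\<^sup>2 * (norm \<phi>)\<^sup>2)"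
      using IMS_bound[OF t(1) phi_V bounded_measurable_cutoff[of l k]] unfolding part_def
      by (rule order_trans[rotated])
    then have "2 * \<bar>Re (cinner (T t \<phi>) ?m2) - Re (cinner (T t (part k)) (part k))\<bar>
        \<le> 2 * (1 + \<theta>) * t * gradient_mass k + C * t\<^sup>2 * (norm \<phi>)\<^sup>2"
      using \<theta> t C gradient_mass_nonneg[of k] by (subst (asm) ennreal_le_iff) auto
    also have "\<dots> = 2 * ((1 + \<theta>) * t * gradient_mass k + C * t\<^sup>2 * (norm \<phi>)\<^sup>2 / 2)"
      by (simp add: distrib_left mult.assoc)
    finally have "\<bar>Re (cinner (T t \<phi>) ?m2) - Re (cinner (T t (part k)) (part k))\<bar>
        \<le> (1 + \<theta>) * t * gradient_mass k + C * t\<^sup>2 * (norm \<phi>)\<^sup>2 / 2" by (rule mult_left_le_imp_le) simp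
    then have 1: "Re (cinner (T t \<phi>) ?m2) - Re (cinner (T t (part k)) (part k))
        \<le> (1 + \<theta>) * t * gradient_mass k + C * t\<^sup>2 * (norm \<phi>)\<^sup>2 / 2"
            by (rule order_trans[OF abs_ge_self])
    have "cinner \<phi> ?m2 = cinner (part k) (part k)"
      unfolding cinner_eq
    proof (rule integral_cong_AE)
      show "AE x in lebesgue. rep_L2 \<phi> x * cnj (rep_L2 ?m2 x)
          = rep_L2 (part k) x * cnj (rep_L2 (part k) x)"
        using rep_part_AE[of k] rep_mult_AE[OF b2, of \<phi>]
      proof eventually_elim
        case (elim x)
        show ?case unfolding elim by (simp add: power2_eq_square)
      qed
    qed (auto intro!: borel_measurable_integrable integrable_rep_mult_cnj)
    then have "Re (cinner \<phi> ?m2) = mass k" by (simp add: cinner_self mass_def)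
    moreover have "T t \<phi> = exp (- lam * t) *\<^sub>R \<phi>" using T_eigenspace[OF eig, of t] t by simp
    ultimately have 2: "Re (cinner (T t \<phi>) ?m2) = exp (- lam * t) * mass k"
      by (simp add: scaleR_scaleC_L2 cinner_scaleC_left)
    have "1 + (- lam * t) \<le> exp (- lam * t)" by (rule exp_ge_add_one_self)
    then have "(1 + (- lam * t)) * mass k \<le> exp (- lam * t) * mass k"
      by (rule mult_right_mono) (simp add: mass_def)
    then have "energy t k \<le> t * lam * mass k + (1 + \<theta>) * t * gradient_mass k + C * t\<^sup>2 * (norm \<phi>)\<^sup>2 / 2"
      using 1 unfolding 2 energy_def mass_def[symmetric] by (simp add: algebra_simps)
    then show ?thesis by (simp add: algebra_simps power2_eq_square)
  qed
  then show ?thesis using t0 by blast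
qed

text \<open>For every margin \<delta> non-resonance supplies one dyadic time at which the energy is
  large, and by \<open>T_energy_mono\<close> it stays large at all smaller dyadic times. Against
  \<open>energy_le\<close> in the limit, lam times the mass cancels and only the gradient is left;
  then \<delta> tends to 0. The same \<delta> plays the part of \<theta>.\<close>

lemma nonresonant_mass_le:
  assumes "\<not> resonant k"
  shows "\<epsilon> * lam * mass k \<le> gradient_mass k"
proof (cases "part k = 0")
  case True
  then show ?thesis using gradient_mass_nonneg by (simp add: mass_def)
next
  case False
  let ?M = "mass k" and ?D = "gradient_mass k" and ?\<tau> = "\<lambda>n::nat. (1 / 2 :: real) ^ n"
  have M0: "0 \<le> ?M" by (simp add: mass_def)
  have main: "((1 + \<epsilon>) * lam - \<delta>) * ?M \<le> lam * ?M + (1 + \<delta>) * ?D" if \<delta>: "0 < \<delta>" for \<delta>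
  proof -
    obtain n where n: "?\<tau> n * ((1 + \<epsilon>) * lam - \<delta>) * ?M < energy (?\<tau> n) k"
      using assms False \<delta> by (auto simp: resonant_def not_le)
    have later: "?\<tau> (n + m) * ((1 + \<epsilon>) * lam - \<delta>) * ?M < energy (?\<tau> (n + m)) k" for m
    proof (induction m)
      case (Suc m)
      have "energy (2 * ?\<tau> (n + Suc m)) k \<le> 2 * energy (?\<tau> (n + Suc m)) k"
        unfolding energy_def by (rule T_energy_mono) (auto intro: part_V)
      moreover have "2 * ?\<tau> (n + Suc m) = ?\<tau> (n + m)" by simp
      ultimately have "?\<tau> (n + m) * ((1 + \<epsilon>) * lam - \<delta>) * ?M < 2 * energy (?\<tau> (n + Suc m)) k"
        using Suc by simp
      then show ?case by simp
    qed (use n in simp)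
    obtain C t0 where t0: "0 < t0" and C: "\<And>t. 0 < t \<Longrightarrow> t \<le> t0 \<Longrightarrow>
      energy t k \<le> t * (lam * ?M + (1 + \<delta>) * ?D + C * t)"
      using energy_le[OF \<delta>, of k] by blast
    have \<tau>0: "?\<tau> \<longlonglongrightarrow> 0" by (rule LIMSEQ_power_zero) simp
    have "(\<lambda>m. lam * ?M + (1 + \<delta>) * ?D + C * ?\<tau> (n + m)) \<longlonglongrightarrow> lam * ?M + (1 + \<delta>) * ?D + C * 0"
      using LIMSEQ_ignore_initial_segment[OF \<tau>0, of n] by (intro tendsto_intros) (simp add: add.commute)
    moreover have "eventually (\<lambda>m. ((1 + \<epsilon>) * lam - \<delta>) * ?M \<le> lam * ?M + (1 + \<delta>) * ?D + C * ?\<tau> (n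
        + m)) sequentially"
    proof -
      have "eventually (\<lambda>m. ?\<tau> (m + n) < t0) sequentially"
        using order_tendstoD(2)[OF LIMSEQ_ignore_initial_segment[OF \<tau>0, of n] t0] .
      then show ?thesis
      proof eventually_elim
        case (elim m)
        have "?\<tau> (n + m) * (((1 + \<epsilon>) * lam - \<delta>) * ?M) \<le> energy (?\<tau> (n + m)) k"
          using later[of m] by (simp only: mult.assoc less_imp_le)
        also have "\<dots> \<le> ?\<tau> (n + m) * (lam * ?M + (1 + \<delta>) * ?D + C * ?\<tau> (n + m))"
          using elim by (intro C) (simp_all only: add.commute less_imp_le zero_less_power half_gt_zero
              zero_less_one)
        finally show ?case by (rule mult_left_le_imp_le) simp
      qed
    qed
    ultimately have "((1 + \<epsilon>) * lam - \<delta>) * ?M \<le> lam * ?M + (1 + \<delta>) * ?D + C * 0"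
      by (rule tendsto_lowerbound) simp
    then show ?thesis by simp
  qed
  show ?thesis
  proof (rule field_le_epsilon)
    fix e :: real assume e: "0 < e"
    \<comment> \<open>Chosen so that \<delta> times the mass and \<delta> times the gradient mass
      together stay below \<open>e\<close>.\<close>
    define \<delta> where "\<delta> = e / (?M + ?D + 1)"
    have p: "0 < ?M + ?D + 1" using M0 gradient_mass_nonneg[of k] by linarith
    have "0 < \<delta>" using e p by (simp add: \<delta>_def)
    from main[OF this] have "\<epsilon> * lam * ?M \<le> ?D + \<delta> * (?M + ?D)" by (simp add: algebra_simps)
    also have "\<delta> * (?M + ?D) \<le> \<delta> * (?M + ?D + 1)" using \<open>0 < \<delta>\<close> by (intro mult_left_mono) auto
    also have "\<dots> = e" using p by (simp add: \<delta>_def)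
    finally show "\<epsilon> * lam * ?M \<le> ?D + e" by simp
  qed
qed

text \<open>In direction \<open>i\<close> the centres are at least 3l apart and each support reaches
  l to either side, which leaves a gap of l.\<close>

lemma separated_distance:
  assumes "\<bar>k i - k' i\<bar> \<ge> 3" "cutoff l k x \<noteq> 0" "cutoff l k' y \<noteq> 0"
  shows "l \<le> norm (x - y)"
proof -
  have "\<bar>x $ i / l - of_int (k i)\<bar> < 1" "\<bar>y $ i / l - of_int (k' i)\<bar> < 1"
    using cutoff_eq_0[of x i l k] cutoff_eq_0[of y i l k'] assms(2,3) by force+
  moreover have "3 \<le> \<bar>real_of_int (k i) - of_int (k' i)\<bar>" using assms(1) by linarith
  ultimately have "1 \<le> \<bar>x $ i / l - y $ i / l\<bar>" by linarith
  also have "\<dots> = \<bar>(x - y) $ i\<bar> / l" using l by (simp add: abs_divide flip: diff_divide_distrib)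
  finally have "l \<le> \<bar>(x - y) $ i\<bar>" using l by (simp add: field_simps)
  also have "\<dots> \<le> norm (x - y)" by (rule component_le_norm_cart)
  finally show ?thesis .
qed

text \<open>Where both parts are nonzero, |x - y| >= l, so the heat kernel may be multiplied by (|x
  - y| / l)^4; its fourth moment then gives the order \<open>t\<^sup>2\<close>, negligible against
  \<open>t\<close>. The 72 is half of 144, from the factor 2 in the Schur test.\<close>

lemma separated_parts:
  assumes sep: "\<bar>k i - k' i\<bar> \<ge> 3"
  shows "cinner (part k) (part k') = 0"
    and "0 < t \<Longrightarrow> cmod (cinner (T t (part k)) (part k')) \<le> 72 * real CARD('d) ^ 3 / l ^ 4 * (mass k
        + mass k') * t\<^sup>2"
proof -
  have "cinner (part k) (part k') = (LINT x|(lebesgue :: (real ^ 'd) measure). 0)"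
    unfolding cinner_eq
  proof (rule integral_cong_AE)
    show "AE x in lebesgue. rep_L2 (part k) x * cnj (rep_L2 (part k') x) = 0"
      using rep_part_AE[of k] rep_part_AE[of k']
    proof eventually_elim
      case (elim x)
      have "cutoff l k x = 0 \<or> cutoff l k' x = 0"
        using separated_distance[of k i k' x x, OF sep] l by force
      then show ?case using elim by auto
    qed
  qed (auto intro!: borel_measurable_integrable integrable_rep_mult_cnj)
  then show "cinner (part k) (part k') = 0" by simp
  assume t: "0 < t"
  let ?f = "\<lambda>y. cmod (rep_L2 (part k) y)" and ?g = "\<lambda>x. cmod (rep_L2 (part k') x)"
  let ?w = "\<lambda>x y. ennreal (heat_kernel t (x - y) * norm (x - y :: real ^ 'd) ^ 4)"
  let ?I = "ennreal (144 * real CARD('d) ^ 3 * t\<^sup>2)"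
  have pw: "ennreal (heat_kernel t (x - y)) * ennreal (?f y * ?g x)
      \<le> ennreal (1 / l ^ 4) * (?w x y * ennreal (?f y * ?g x))"
    if f: "?f y = cutoff l k y * cmod (rep_L2 \<phi> y)" and g: "?g x = cutoff l k' x * cmod (rep_L2 \<phi> x)"
        for x y
  proof (cases "?f y * ?g x = 0")
    case False
    then have "cutoff l k y \<noteq> 0" "cutoff l k' x \<noteq> 0" using f g by auto
    then have "l \<le> norm (x - y)" using separated_distance[of k i k' y x, OF sep]
        by (simp add: norm_minus_commute)
    then have "l ^ 4 \<le> norm (x - y) ^ 4" using l by (intro power_mono) auto
    then have "1 \<le> 1 / l ^ 4 * norm (x - y) ^ 4" using l by simp
    then have "heat_kernel t (x - y) * 1 \<le> heat_kernel t (x - y) * (1 / l ^ 4 * norm (x - y) ^ 4)"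
      by (intro mult_left_mono heat_kernel_nonneg)
    then have "heat_kernel t (x - y) * (?f y * ?g x)
        \<le> (heat_kernel t (x - y) * (1 / l ^ 4 * norm (x - y) ^ 4)) * (?f y * ?g x)"
      by (intro mult_right_mono) auto
    then have "ennreal (heat_kernel t (x - y) * (?f y * ?g x))
        \<le> ennreal (1 / l ^ 4 * ((heat_kernel t (x - y) * norm (x - y) ^ 4) * (?f y * ?g x)))"
      by (intro ennreal_leI) (simp add: mult_ac)
    moreover have n: "0 \<le> 1 / l ^ 4" "0 \<le> heat_kernel t (x - y) * norm (x - y) ^ 4" "0 \<le> ?f y * ?g x"
      using l heat_kernel_nonneg[of t "x - y"] by auto
    ultimately show ?thesis
      unfolding ennreal_mult[OF n(2,3), symmetric] ennreal_mult[OF n(1) mult_nonneg_nonneg[OF n(2,3)],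
          symmetric]
      by (simp only: ennreal_mult[OF heat_kernel_nonneg n(3), symmetric])
  next
    case True
    then show ?thesis by (simp only: ennreal_0 mult_zero_right order_refl)
  qed
  have wm: "(\<lambda>p. ?w (fst p) (snd p)) \<in> borel_measurable (lebesgue \<Otimes>\<^sub>M lebesgue)"
    by (rule measurable_lebesgue_pair_diff[of "\<lambda>z. ennreal (heat_kernel t z * norm z ^ 4)"]) measurable
  have "ennreal (cmod (cinner (T t (part k)) (part k')))
      \<le> (\<integral>\<^sup>+x. \<integral>\<^sup>+y. ennreal (heat_kernel t (x - y)) * ennreal (?f y * ?g x) \<partial>lebesgue \<partial>lebesgue)"
    by (rule cmod_cinner_T_le[OF t part_V])
  also have "\<dots> \<le> (\<integral>\<^sup>+x. ennreal (1 / l ^ 4) * (\<integral>\<^sup>+y. ?w x y * ennreal (?f y * ?g x) \<partial>lebesgue)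
      \<partial>lebesgue)"
  proof (rule nn_integral_mono_AE)
    show "AE x in lebesgue. (\<integral>\<^sup>+y. ennreal (heat_kernel t (x - y)) * ennreal (?f y * ?g x) \<partial>lebesgue)
        \<le> ennreal (1 / l ^ 4) * (\<integral>\<^sup>+y. ?w x y * ennreal (?f y * ?g x) \<partial>lebesgue)"
      using cmod_part_AE[of k']
    proof eventually_elim
      case (elim x)
      have [measurable]: "(\<lambda>y. ?w x y) \<in> borel_measurable lebesgue"
        by (rule measurable_lebesgue_diff[of "\<lambda>z. ennreal (heat_kernel t z * norm z ^ 4)"]) measurable
      have "(\<integral>\<^sup>+y. ennreal (heat_kernel t (x - y)) * ennreal (?f y * ?g x) \<partial>lebesgue)
          \<le> (\<integral>\<^sup>+y. ennreal (1 / l ^ 4) * (?w x y * ennreal (?f y * ?g x)) \<partial>lebesgue)"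
      proof (rule nn_integral_mono_AE)
        show "AE y in lebesgue. ennreal (heat_kernel t (x - y)) * ennreal (?f y * ?g x)
            \<le> ennreal (1 / l ^ 4) * (?w x y * ennreal (?f y * ?g x))"
          using cmod_part_AE[of k] by eventually_elim (rule pw[OF _ elim])
      qed
      also have "\<dots> = ennreal (1 / l ^ 4) * (\<integral>\<^sup>+y. ?w x y * ennreal (?f y * ?g x) \<partial>lebesgue)"
        by (rule nn_integral_cmult) measurable
      finally show ?case .
    qed
  qed
  also have "\<dots> = ennreal (1 / l ^ 4) * (\<integral>\<^sup>+x. \<integral>\<^sup>+y. ?w x y * ennreal (?f y * ?g x) \<partial>lebesgue \<partial>lebesgue)"
  proof (rule nn_integral_cmult)
    have [measurable]: "(\<lambda>(x, y). ?w x y) \<in> borel_measurable (lebesgue \<Otimes>\<^sub>M lebesgue)"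
      using wm by (simp add: case_prod_beta')
    show "(\<lambda>x. \<integral>\<^sup>+y. ?w x y * ennreal (?f y * ?g x) \<partial>lebesgue) \<in> borel_measurable lebesgue"
      by measurable
  qed
  finally have le1: "ennreal (cmod (cinner (T t (part k)) (part k')))
      \<le> ennreal (1 / l ^ 4) * (\<integral>\<^sup>+x. \<integral>\<^sup>+y. ?w x y * ennreal (?f y * ?g x) \<partial>lebesgue \<partial>lebesgue)" (is "_
          \<le> _ * ?J") .
  have "2 * ?J \<le> (\<integral>\<^sup>+y. ennreal ((?f y)\<^sup>2) * (\<integral>\<^sup>+x. ?w x y \<partial>lebesgue) \<partial>lebesgue)
      + (\<integral>\<^sup>+x. ennreal ((?g x)\<^sup>2) * (\<integral>\<^sup>+y. ?w x y \<partial>lebesgue) \<partial>lebesgue)"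
    by (rule nn_integral_weighted_product_le[OF _ _ wm]) measurable
  also have "\<dots> \<le> (\<integral>\<^sup>+y. ennreal ((?f y)\<^sup>2) * ?I \<partial>lebesgue) + (\<integral>\<^sup>+x. ennreal ((?g x)\<^sup>2) * ?I \<partial>lebesgue)"
    using pow4_convolution[OF t, where 'a = "real ^ 'd"]
    by (intro add_mono nn_integral_mono mult_left_mono) auto
  also have "\<dots> = ennreal (mass k) * ?I + ennreal (mass k') * ?I"
    by (simp add: nn_integral_multc nn_integral_rep_sq mass_def)
  also have "\<dots> = ennreal ((mass k + mass k') * (144 * real CARD('d) ^ 3 * t\<^sup>2))"
  proof -
    have n: "0 \<le> mass k" "0 \<le> mass k'" "0 \<le> 144 * real CARD('d) ^ 3 * t\<^sup>2" by (auto simp: mass_def)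
    show ?thesis
      unfolding distrib_right[symmetric] ennreal_plus[OF n(1,2), symmetric]
      by (rule ennreal_mult[symmetric]) (use n in auto)
  qed
  finally have J: "2 * ?J \<le> ennreal ((mass k + mass k') * (144 * real CARD('d) ^ 3 * t\<^sup>2))" .
  have "ennreal (2 * cmod (cinner (T t (part k)) (part k')))
      = 2 * ennreal (cmod (cinner (T t (part k)) (part k')))"
    by (simp add: ennreal_mult)
  also have "\<dots> \<le> 2 * (ennreal (1 / l ^ 4) * ?J)" by (intro mult_left_mono le1) simp
  also have "\<dots> = ennreal (1 / l ^ 4) * (2 * ?J)" by (simp only: mult.left_commute)
  also have "\<dots> \<le> ennreal (1 / l ^ 4) * ennreal ((mass k + mass k') * (144 * real CARD('d) ^ 3 * t\<^sup>2))"
    by (intro mult_left_mono J) simp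
  also have "\<dots> = ennreal (1 / l ^ 4 * ((mass k + mass k') * (144 * real CARD('d) ^ 3 * t\<^sup>2)))"
    using l by (intro ennreal_mult[symmetric]) (auto simp: mass_def)
  finally have "2 * cmod (cinner (T t (part k)) (part k')) \<le> 1 / l ^ 4 * ((mass k
      + mass k') * (144 * real CARD('d) ^ 3 * t\<^sup>2))"
    using l by (subst (asm) ennreal_le_iff) (auto simp: mass_def)
  also have "\<dots> = 2 * (72 * real CARD('d) ^ 3 / l ^ 4 * (mass k + mass k') * t\<^sup>2)" by simp
  finally show "cmod (cinner (T t (part k)) (part k')) \<le> 72 * real CARD('d) ^ 3 / l ^ 4 * (mass k
      + mass k') * t\<^sup>2"
    by simp
qed

section \<open>Counting resonant cells and weighting by the distance to them\<close>

abbreviation N :: nat where "N \<equiv> eigenvalue_count H ((1 + \<epsilon>) * lam)"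

text \<open>Distinct indices of one colour differ by a nonzero multiple of 3 in some coordinate, so
  their parts are separated and can serve as trial functions in the min-max principle.\<close>

lemma card_resonant_colour_le:
  assumes F: "finite F" and res: "\<And>k. k \<in> F \<Longrightarrow> resonant k"
    and colour: "\<And>k k' i. k \<in> F \<Longrightarrow> k' \<in> F \<Longrightarrow> k i mod 3 = k' i mod 3"
  shows "card F \<le> N"
proof (rule card_le_eigenvalue_count[OF F, of part "\<lambda>n. (1 / 2) ^ n"])
  have sep: "\<exists>i. \<bar>k i - k' i\<bar> \<ge> 3" if k: "k \<in> F" "k' \<in> F" "k \<noteq> k'" for k k'
  proof -
    obtain i where i: "k i \<noteq> k' i" using k(3) by (auto simp: fun_eq_iff)
    have "3 dvd k i - k' i" using colour[OF k(1,2), of i] by (simp add: mod_eq_dvd_iff)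
    then have "\<bar>k i - k' i\<bar> \<ge> 3" using i by (metis dvd_imp_le_int eq_iff_diff_eq_0 abs_numeral)
    then show ?thesis by blast
  qed
  show "cinner (part k) (part k') = 0" if "k \<in> F" "k' \<in> F" "k \<noteq> k'" for k k'
    using sep[OF that] separated_parts(1) by blast
  show "\<exists>C. \<forall>n. cmod (cinner (T ((1 / 2) ^ n) (part k)) (part k')) \<le> C * ((1 / 2) ^ n)\<^sup>2"
    if "k \<in> F" "k' \<in> F" "k \<noteq> k'" for k k'
    using sep[OF that] separated_parts(2) by (meson zero_less_power half_gt_zero zero_less_one)
  show "\<exists>\<delta>>0. \<forall>n. (norm (part k))\<^sup>2 - Re (cinner (T ((1 / 2) ^ n) (part k)) (part k))
      \<le> (1 / 2) ^ n * ((1 + \<epsilon>) * lam - \<delta>) * (norm (part k))\<^sup>2" if "k \<in> F" for k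
    using res[OF that] by (simp add: resonant_def energy_def mass_def)
qed (use res in \<open>auto simp: part_V resonant_def intro: LIMSEQ_power_zero\<close>)

text \<open>There are 3^d residue classes modulo 3. A bound that is uniform over finite subsets also
  shows that the whole set is finite.\<close>

lemma finite_card_resonant: "finite {k. resonant k} \<and> card {k. resonant k} \<le> 3 ^ CARD('d) * N"
proof (rule finite_if_finite_subsets_card_bdd)
  fix F assume F: "F \<subseteq> {k. resonant k}" "finite F"
  define col where "col k = (\<lambda>i. k i mod 3)" for k :: "'d \<Rightarrow> int"
  let ?P = "PiE (UNIV :: 'd set) (\<lambda>_. {0..<3 :: int})"
  have finP: "finite ?P" by (intro finite_PiE) auto
  have sub: "col ` F \<subseteq> ?P" by (auto simp: col_def PiE_iff)
  have "card F = card (\<Union>c\<in>col ` F. {k \<in> F. col k = c})" by (rule arg_cong[where f = card]) auto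
  also have "\<dots> \<le> (\<Sum>c\<in>col ` F. card {k \<in> F. col k = c})" using F by (intro card_UN_le) auto
  also have "\<dots> \<le> (\<Sum>c\<in>col ` F. N)"
  proof (intro sum_mono card_resonant_colour_le)
    fix c k k' i assume "k \<in> {k \<in> F. col k = c}" "k' \<in> {k \<in> F. col k = c}"
    then have "col k i = col k' i" by simp
    then show "k i mod 3 = k' i mod 3" by (simp add: col_def)
  qed (use F in auto)
  also have "\<dots> = card (col ` F) * N" by simp
  also have "\<dots> \<le> card ?P * N" by (intro mult_right_mono card_mono finP sub) auto
  also have "card ?P = 3 ^ CARD('d)" by (simp add: card_PiE)
  finally show "card F \<le> 3 ^ CARD('d) * N" .
qed

text \<open>This decays away from the resonant cells; its reciprocal, regularised by \<delta>, is
  the growing weight. As a sum it inherits the step factor 9 and the summability of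
  \<open>decay\<close> term by term.\<close>

definition weight :: "('d \<Rightarrow> int) \<Rightarrow> real" where
  "weight k = (\<Sum>j | resonant j. decay j k)"

lemma weight_nonneg: "0 \<le> weight k"
  unfolding weight_def by (intro sum_nonneg decay_nonneg)

lemma weight_step: "\<bar>a - k i\<bar> \<le> 1 \<Longrightarrow> weight (k(i := a)) \<le> 9 * weight k"
  unfolding weight_def sum_distrib_left by (intro sum_mono decay_step)

lemma weight_resonant: "resonant k \<Longrightarrow> 1 \<le> weight k"
  unfolding weight_def using finite_card_resonant decay_nonneg[of _ k]
  by (subst decay_self[of k, symmetric], intro member_le_sum) auto

text \<open>15/4 = 3 * 5/4: the colours times the lattice sum, in each coordinate.\<close>

lemma sum_weight_le:
  assumes "finite F"
  shows "sum weight F \<le> (15 / 4) ^ CARD('d) * real N"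
proof -
  have "sum weight F = (\<Sum>j | resonant j. \<Sum>k\<in>F. decay j k)"
    unfolding weight_def by (rule sum.swap)
  also have "\<dots> \<le> (\<Sum>j | resonant j. (5 / 4) ^ CARD('d))"
    by (intro sum_mono sum_decay_le assms)
  also have "\<dots> = real (card {k. resonant k}) * (5 / 4) ^ CARD('d)" by simp
  also have "\<dots> \<le> real (3 ^ CARD('d) * N) * (5 / 4) ^ CARD('d)"
    using finite_card_resonant by (intro mult_right_mono) (auto simp del: of_nat_mult of_nat_power)
  also have "\<dots> = (15 / 4) ^ CARD('d) * real N"
    by (simp add: mult_ac flip: power_mult_distrib)
  finally show ?thesis .
qed

text \<open>The cutoffs lie in [0, 1] and sum to 1, so their squares sum to at most 1.\<close>

lemma sum_mass_le: "(\<integral>\<^sup>+k. ennreal (mass k) \<partial>count_space UNIV) \<le> ennreal ((norm \<phi>)\<^sup>2)"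
proof -
  have "(\<integral>\<^sup>+k. ennreal (mass k) \<partial>count_space UNIV)
      = (\<integral>\<^sup>+x. (\<integral>\<^sup>+k. ennreal ((cutoff l k x)\<^sup>2) * ennreal ((cmod (rep_L2 \<phi> x))\<^sup>2) \<partial>count_space UNIV)
          \<partial>lebesgue)"
    unfolding nn_integral_mass[symmetric]
    by (rule nn_integral_count_space_nn_integral[symmetric]) auto
  also have "\<dots> \<le> (\<integral>\<^sup>+x. ennreal ((cmod (rep_L2 \<phi> x))\<^sup>2) \<partial>lebesgue)"
  proof (rule nn_integral_mono)
    fix x :: "real ^ 'd"
    have "(\<integral>\<^sup>+k. ennreal ((cutoff l k x)\<^sup>2) * ennreal ((cmod (rep_L2 \<phi> x))\<^sup>2) \<partial>count_space UNIV)
        \<le> (\<integral>\<^sup>+k. ennreal (cutoff l k x) * ennreal ((cmod (rep_L2 \<phi> x))\<^sup>2) \<partial>count_space UNIV)"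
      by (intro nn_integral_mono mult_right_mono ennreal_leI)
        (auto simp: power2_eq_square mult_left_le cutoff_bounds)
    also have "\<dots> = ennreal ((cmod (rep_L2 \<phi> x))\<^sup>2)"
      by (simp add: nn_integral_multc nn_integral_cutoff)
    finally show "(\<integral>\<^sup>+k. ennreal ((cutoff l k x)\<^sup>2) * ennreal ((cmod (rep_L2 \<phi> x))\<^sup>2) \<partial>count_space UNIV)
      \<le> ennreal ((cmod (rep_L2 \<phi> x))\<^sup>2)" .
  qed
  finally show ?thesis by (simp add: nn_integral_rep_sq)
qed

text \<open>The parameter \<open>\<delta>\<close> keeps the weights bounded, which makes the sum finite so that
  it can be absorbed.\<close>

lemma weighted_mass_le:
  assumes \<delta>: "0 < \<delta>"
  shows "(\<integral>\<^sup>+k. ennreal (mass k / (\<delta> + weight k)) \<partial>count_space UNIV) \<le> ennreal (5 * (norm \<phi>)\<^sup>2)"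
proof -
  define W where "W k = 1 / (\<delta> + weight k)" for k
  have dw: "0 < \<delta> + weight k" for k using \<delta> weight_nonneg[of k] by linarith
  have W: "0 < W k" for k using dw by (simp add: W_def)
  have Wstep: "W k \<le> 9 * W (k(i := a))" if "\<bar>a - k i\<bar> \<le> 1" for k i a
  proof -
    have "\<delta> + weight (k(i := a)) \<le> 9 * (\<delta> + weight k)" using weight_step[of a k i, OF that] \<delta> by simp
    then show ?thesis using dw[of k] dw[of "k(i := a)"] by (simp add: W_def field_simps)
  qed
  have m0: "0 \<le> mass k" for k by (simp add: mass_def)
  define X where "X = (\<integral>\<^sup>+k. ennreal (W k * mass k) \<partial>count_space UNIV)"
  let ?p = "\<lambda>x. ennreal ((cmod (rep_L2 \<phi> x))\<^sup>2)"
  have el: "0 < \<epsilon> * lam" using eps lam_pos by simp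
  \<comment> \<open>Finiteness of \<open>X\<close>, by the crude bound \<open>1 / \<delta>\<close>
    on the weights; without it nothing could be subtracted from both sides of
    \<open>main\<close>.\<close>
  have "X \<le> (\<integral>\<^sup>+k. ennreal (1 / \<delta>) * ennreal (mass k) \<partial>count_space UNIV)"
    unfolding X_def
  proof (rule nn_integral_mono)
    fix k
    have "W k \<le> 1 / \<delta>" using \<delta> weight_nonneg[of k] by (simp add: W_def frac_le)
    then have "W k * mass k \<le> 1 / \<delta> * mass k" by (intro mult_right_mono m0)
    then show "ennreal (W k * mass k) \<le> ennreal (1 / \<delta>) * ennreal (mass k)"
      using \<delta> m0[of k] by (simp add: ennreal_leI flip: ennreal_mult)
  qed
  also have "\<dots> = ennreal (1 / \<delta>) * (\<integral>\<^sup>+k. ennreal (mass k) \<partial>count_space UNIV)"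
    by (rule nn_integral_cmult) simp
  also have "\<dots> \<le> ennreal (1 / \<delta>) * ennreal ((norm \<phi>)\<^sup>2)"
    by (intro mult_left_mono sum_mass_le) simp
  also have "\<dots> < top" by (simp add: ennreal_mult_less_top)
  finally have Xfin: "X < top" .
  have grad: "(\<integral>\<^sup>+k. ennreal (W k * gradient_mass k) \<partial>count_space UNIV)
      \<le> ennreal (4 / 5 * (\<epsilon> * lam)) * X"
  proof -
    have "(\<integral>\<^sup>+k. ennreal (W k * gradient_mass k) \<partial>count_space UNIV)
        = (\<integral>\<^sup>+k. (\<integral>\<^sup>+x. ennreal (W k * (norm (cutoff_grad l k x))\<^sup>2) * ?p x \<partial>lebesgue) \<partial>count_space
            UNIV)"
    proof (rule nn_integral_cong)
      fix k
      have "ennreal (W k * gradient_mass k) = ennreal (W k) * ennreal (gradient_mass k)"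
        using W[of k] gradient_mass_nonneg by (simp add: ennreal_mult)
      also have "\<dots> = (\<integral>\<^sup>+x. ennreal (W k) * (ennreal ((norm (cutoff_grad l k x))\<^sup>2) * ?p x) \<partial>lebesgue)"
        unfolding nn_integral_gradient_mass[symmetric] by (rule nn_integral_cmult[symmetric]) measurable
      also have "\<dots> = (\<integral>\<^sup>+x. ennreal (W k * (norm (cutoff_grad l k x))\<^sup>2) * ?p x \<partial>lebesgue)"
        using W[of k] by (simp add: ennreal_mult mult.assoc)
      finally show "ennreal (W k * gradient_mass k)
          = (\<integral>\<^sup>+x. ennreal (W k * (norm (cutoff_grad l k x))\<^sup>2) * ?p x \<partial>lebesgue)" .
    qed
    also have "\<dots> = (\<integral>\<^sup>+x. (\<integral>\<^sup>+k. ennreal (W k * (norm (cutoff_grad l k x))\<^sup>2) * ?p x \<partial>count_space UNIV)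
        \<partial>lebesgue)"
      by (rule nn_integral_count_space_nn_integral[symmetric]) auto
    also have "\<dots> = (\<integral>\<^sup>+x. (\<integral>\<^sup>+k. ennreal (W k * (norm (cutoff_grad l k x))\<^sup>2) \<partial>count_space UNIV) * ?p x
        \<partial>lebesgue)"
      by (simp add: nn_integral_multc)
    also have "\<dots> \<le> (\<integral>\<^sup>+x. (ennreal (4 / 5 * (\<epsilon> * lam)) * (\<integral>\<^sup>+k. ennreal (W k * (cutoff l k x)\<^sup>2)
        \<partial>count_space UNIV)) * ?p x \<partial>lebesgue)"
    proof (intro nn_integral_mono mult_right_mono)
      fix x :: "real ^ 'd"
      have "(\<integral>\<^sup>+k. ennreal (W k * (norm (cutoff_grad l k x))\<^sup>2) \<partial>count_space UNIV)
          \<le> ennreal (5 / 3 * pi\<^sup>2 * real CARD('d) / l\<^sup>2) * (\<integral>\<^sup>+k. ennreal (W k * (cutoff l k x)\<^sup>2)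
              \<partial>count_space UNIV)"
        by (rule weighted_cutoff_gradient_le[OF l W Wstep])
      also have "\<dots> \<le> ennreal (4 / 5 * (\<epsilon> * lam)) * (\<integral>\<^sup>+k. ennreal (W k * (cutoff l k x)\<^sup>2) \<partial>count_space
          UNIV)"
        by (intro mult_right_mono ennreal_leI l_large) simp
      finally show "(\<integral>\<^sup>+k. ennreal (W k * (norm (cutoff_grad l k x))\<^sup>2) \<partial>count_space UNIV)
          \<le> ennreal (4 / 5 * (\<epsilon> * lam)) * (\<integral>\<^sup>+k. ennreal (W k * (cutoff l k x)\<^sup>2) \<partial>count_space UNIV)" .
    qed simp
    also have "\<dots> = (\<integral>\<^sup>+x. (\<integral>\<^sup>+k. ennreal (4 / 5 * (\<epsilon> * lam)) * (ennreal (W k * (cutoff l k x)\<^sup>2) * ?p x)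
        \<partial>count_space UNIV) \<partial>lebesgue)"
      by (simp add: nn_integral_multc nn_integral_cmult mult.assoc)
    also have "\<dots> = (\<integral>\<^sup>+k. (\<integral>\<^sup>+x. ennreal (4 / 5 * (\<epsilon> * lam)) * (ennreal (W k * (cutoff l k x)\<^sup>2) * ?p x)
        \<partial>lebesgue) \<partial>count_space UNIV)"
      by (rule nn_integral_count_space_nn_integral) auto
    also have "\<dots> = (\<integral>\<^sup>+k. ennreal (4 / 5 * (\<epsilon> * lam)) * ennreal (W k * mass k) \<partial>count_space UNIV)"
    proof (rule nn_integral_cong)
      fix k
      have "(\<integral>\<^sup>+x. ennreal (4 / 5 * (\<epsilon> * lam)) * (ennreal (W k * (cutoff l k x)\<^sup>2) * ?p x) \<partial>lebesgue)
          = (\<integral>\<^sup>+x. (ennreal (4 / 5 * (\<epsilon> * lam)) * ennreal (W k)) * (ennreal ((cutoff l k x)\<^sup>2) * ?p x)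
              \<partial>lebesgue)"
        using W[of k] by (intro nn_integral_cong) (simp add: ennreal_mult mult.assoc)
      also have "\<dots> = (ennreal (4 / 5 * (\<epsilon> * lam)) * ennreal (W k)) * ennreal (mass k)"
        unfolding nn_integral_mass[symmetric] by (rule nn_integral_cmult) measurable
      also have "\<dots> = ennreal (4 / 5 * (\<epsilon> * lam)) * ennreal (W k * mass k)"
        using W[of k] m0[of k] by (simp add: ennreal_mult mult.assoc)
      finally show "(\<integral>\<^sup>+x. ennreal (4 / 5 * (\<epsilon> * lam)) * (ennreal (W k * (cutoff l k x)\<^sup>2) * ?p x)
          \<partial>lebesgue)
          = ennreal (4 / 5 * (\<epsilon> * lam)) * ennreal (W k * mass k)" .
    qed
    also have "\<dots> = ennreal (4 / 5 * (\<epsilon> * lam)) * X"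
      unfolding X_def by (rule nn_integral_cmult) simp
    finally show ?thesis .
  qed
  have "ennreal (\<epsilon> * lam) * X = (\<integral>\<^sup>+k. ennreal (\<epsilon> * lam) * ennreal (W k * mass k) \<partial>count_space UNIV)"
    unfolding X_def by (rule nn_integral_cmult[symmetric]) simp
  also have "\<dots> \<le> (\<integral>\<^sup>+k. ennreal (\<epsilon> * lam) * ennreal (mass k)
      + ennreal (W k * gradient_mass k) \<partial>count_space UNIV)"
  proof (rule nn_integral_mono)
    fix k
    \<comment> \<open>On resonant cells the weight \<open>W k\<close> is at most 1 and the plain
      mass suffices; on the others \<open>nonresonant_mass_le\<close> trades mass for gradient. Both
      bounds are added, since each is nonnegative.\<close>
    have "\<epsilon> * lam * (W k * mass k) \<le> \<epsilon> * lam * mass k + W k * gradient_mass k"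
    proof (cases "resonant k")
      case True
      then have "W k \<le> 1" using weight_resonant[OF True] \<delta> by (simp add: W_def divide_le_eq)
      then have "W k * mass k \<le> 1 * mass k" by (intro mult_right_mono m0)
      then have "\<epsilon> * lam * (W k * mass k) \<le> \<epsilon> * lam * mass k" using el by (simp add: mult_left_mono)
      moreover have "0 \<le> W k * gradient_mass k" using W[of k] gradient_mass_nonneg[of k] by simp
      ultimately show ?thesis by linarith
    next
      case False
      have "W k * (\<epsilon> * lam * mass k) \<le> W k * gradient_mass k"
        using nonresonant_mass_le[OF False] W[of k] by (intro mult_left_mono) auto
      moreover have "0 \<le> \<epsilon> * lam * mass k" using el m0[of k] by simp
      moreover have "W k * (\<epsilon> * lam * mass k) = \<epsilon> * lam * (W k * mass k)" by simp
      ultimately show ?thesis by linarith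
    qed
    then have "ennreal (\<epsilon> * lam * (W k * mass k)) \<le> ennreal (\<epsilon> * lam * mass k + W k * gradient_mass k)"
      by (rule ennreal_leI)
    moreover have n: "0 \<le> \<epsilon> * lam" "0 \<le> W k * mass k" "0 \<le> W k * gradient_mass k" "0 \<le> \<epsilon> * lam * mass k"
      using el W[of k] m0[of k] gradient_mass_nonneg[of k] by auto
    ultimately show "ennreal (\<epsilon> * lam) * ennreal (W k * mass k) \<le> ennreal (\<epsilon> * lam) * ennreal (mass k)
        + ennreal (W k * gradient_mass k)"
      unfolding ennreal_mult[OF n(1,2), symmetric] ennreal_mult[OF n(1) m0, symmetric]
        ennreal_plus[OF n(4,3), symmetric] by simp
  qed
  also have "\<dots> = ennreal (\<epsilon> * lam) * (\<integral>\<^sup>+k. ennreal (mass k) \<partial>count_space UNIV)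
      + (\<integral>\<^sup>+k. ennreal (W k * gradient_mass k) \<partial>count_space UNIV)"
    by (simp add: nn_integral_add nn_integral_cmult)
  also have "\<dots> \<le> ennreal (\<epsilon> * lam) * ennreal ((norm \<phi>)\<^sup>2) + ennreal (4 / 5 * (\<epsilon> * lam)) * X"
    by (intro add_mono mult_left_mono sum_mass_le grad) simp
  finally have main: "ennreal (\<epsilon> * lam) * X \<le> ennreal (\<epsilon> * lam) * ennreal ((norm \<phi>)\<^sup>2)
      + ennreal (4 / 5 * (\<epsilon> * lam)) * X" .
  define r where "r = enn2real X"
  have Xr: "X = ennreal r" and r0: "0 \<le> r" using Xfin by (auto simp: r_def)
  have "ennreal (\<epsilon> * lam * r) \<le> ennreal (\<epsilon> * lam * (norm \<phi>)\<^sup>2 + 4 / 5 * (\<epsilon> * lam) * r)"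
  proof -
    have n: "0 \<le> \<epsilon> * lam" "0 \<le> (norm \<phi>)\<^sup>2" "0 \<le> 4 / 5 * (\<epsilon> * lam)" using el by auto
    show ?thesis
      using main unfolding Xr ennreal_mult[OF n(1) r0, symmetric] ennreal_mult[OF n(1,2), symmetric]
        ennreal_mult[OF n(3) r0, symmetric]
        ennreal_plus[OF mult_nonneg_nonneg[OF n(1,2)] mult_nonneg_nonneg[OF n(3) r0], symmetric] .
  qed
  then have "\<epsilon> * lam * r \<le> \<epsilon> * lam * (norm \<phi>)\<^sup>2 + 4 / 5 * (\<epsilon> * lam) * r"
    using el r0 by (subst (asm) ennreal_le_iff) auto
  \<comment> \<open>Absorbing 4/5 of the left side leaves a fifth, hence the factor 5.\<close>
  then have "\<epsilon> * lam * r \<le> \<epsilon> * lam * (5 * (norm \<phi>)\<^sup>2)" by (simp add: algebra_simps)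
  then have "r \<le> 5 * (norm \<phi>)\<^sup>2" using el by (rule mult_left_le_imp_le)
  then have "X \<le> ennreal (5 * (norm \<phi>)\<^sup>2)" unfolding Xr by (rule ennreal_leI)
  then show ?thesis by (simp add: X_def W_def)
qed

section \<open>The L1 bound\<close>

definition L1_norm :: ennreal where
  "L1_norm = (\<integral>\<^sup>+x. ennreal (cmod (rep_L2 \<phi> x)) \<partial>lebesgue)"

text \<open>In each cell 2c <= s + c^2 / s on the box that carries the cutoff. With \<open>s\<close>
  proportional to \<open>\<delta> + weight k\<close>, the first terms add up to the box volume times
  the total weight, the second ones to the weighted masses. The parameter \<sigma> is left free for
  the later optimisation.\<close>

lemma L1_norm_le:
  assumes \<sigma>: "0 < \<sigma>"
  shows "2 * L1_norm \<le> ennreal (\<sigma> * ((2 * l) ^ CARD('d) * ((15 / 4) ^ CARD('d) * real N))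
      + 5 * (norm \<phi>)\<^sup>2 / \<sigma>)"
    (is "_ \<le> ennreal ?R")
proof -
  define a where "a k = (\<integral>\<^sup>+x. ennreal (cutoff l k x) * ennreal (cmod (rep_L2 \<phi> x)) \<partial>lebesgue)" for k
  define v where "v = (2 * l) ^ CARD('d)"
  have v0: "0 \<le> v" using l by (simp add: v_def)
  have single: "2 * a k \<le> ennreal (\<sigma> * (\<delta> + weight k) * v + mass k / (\<delta> + weight k) / \<sigma>)" if \<delta>: "0 < \<delta>"
      for k \<delta>
  proof -
    define s where "s = \<sigma> * (\<delta> + weight k)"
    have s: "0 < s" using \<sigma> \<delta> weight_nonneg[of k] by (simp add: s_def add_pos_nonneg)
    define B :: "(real ^ 'd) set" where "B = cbox (\<chi> i. l * of_int (k i) - l) (\<chi> i. l * of_int (k i)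
        + l)"
    have B: "emeasure lebesgue B = ennreal v" "\<And>x. x \<notin> B \<Longrightarrow> cutoff l k x = 0"
      using emeasure_cutoff_support[OF l, where k = k] by (auto simp: B_def v_def)
    have [measurable]: "B \<in> sets lebesgue" by (simp add: B_def)
    have "2 * a k = (\<integral>\<^sup>+x. 2 * (ennreal (cutoff l k x) * ennreal (cmod (rep_L2 \<phi> x))) \<partial>lebesgue)"
      unfolding a_def by (rule nn_integral_cmult[symmetric]) measurable
    also have "\<dots> \<le> (\<integral>\<^sup>+x. ennreal s * indicator B x
        + ennreal (1 / s) * (ennreal ((cutoff l k x)\<^sup>2) * ennreal ((cmod (rep_L2 \<phi> x))\<^sup>2)) \<partial>lebesgue)"
    proof (rule nn_integral_mono)
      fix x
      show "2 * (ennreal (cutoff l k x) * ennreal (cmod (rep_L2 \<phi> x)))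
        \<le> ennreal s * indicator B x + ennreal (1 / s) * (ennreal ((cutoff l k x)\<^sup>2) * ennreal ((cmod
            (rep_L2 \<phi> x))\<^sup>2))"
      proof (cases "x \<in> B")
        case True
        let ?c = "cutoff l k x * cmod (rep_L2 \<phi> x)"
        have c0: "0 \<le> ?c" by (simp add: cutoff_bounds)
        have "0 \<le> (s - ?c)\<^sup>2 / s" using s by simp
        then have "2 * ?c \<le> s + 1 / s * ?c\<^sup>2" using s by (simp add: power2_eq_square field_simps)
        then have "ennreal (2 * ?c) \<le> ennreal (s + 1 / s * ?c\<^sup>2)" by (rule ennreal_leI)
        also have "\<dots> = ennreal s + ennreal (1 / s) * ennreal (?c\<^sup>2)"
        proof -
          have n: "0 \<le> s" "0 \<le> 1 / s" "0 \<le> ?c\<^sup>2" using s by auto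
          show ?thesis
            unfolding ennreal_mult[OF n(2,3), symmetric]
            by (rule ennreal_plus[OF n(1) mult_nonneg_nonneg[OF n(2,3)]])
        qed
        also have "ennreal (?c\<^sup>2) = ennreal ((cutoff l k x)\<^sup>2) * ennreal ((cmod (rep_L2 \<phi> x))\<^sup>2)"
          by (simp add: power_mult_distrib ennreal_mult)
        also have "ennreal (2 * ?c) = 2 * (ennreal (cutoff l k x) * ennreal (cmod (rep_L2 \<phi> x)))"
          by (simp add: ennreal_mult cutoff_bounds)
        finally show ?thesis using True by simp
      qed (simp add: B(2))
    qed
    also have "\<dots> = ennreal s * ennreal v + ennreal (1 / s) * ennreal (mass k)"
      unfolding nn_integral_mass[symmetric] B(1)[symmetric]
      by (simp add: nn_integral_add nn_integral_cmult)
    also have "\<dots> = ennreal (s * v + mass k / s)"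
    proof -
      have n: "0 \<le> s" "0 \<le> 1 / s" "0 \<le> mass k" using s by (auto simp: mass_def)
      show ?thesis
        unfolding ennreal_mult[OF n(1) v0, symmetric] ennreal_mult[OF n(2,3), symmetric]
          ennreal_plus[OF mult_nonneg_nonneg[OF n(1) v0] mult_nonneg_nonneg[OF n(2,3)], symmetric]
              by simp
    qed
    also have "mass k / s = mass k / (\<delta> + weight k) / \<sigma>" by (simp add: s_def)
    finally show ?thesis by (simp add: s_def)
  qed
  have fin: "sum (\<lambda>k. 2 * a k) F \<le> ennreal ?R" if F: "finite F" for F
  proof -
    have \<delta>_bound: "sum (\<lambda>k. 2 * a k) F \<le> ennreal (\<sigma> * (v * ((15 / 4) ^ CARD('d) * real N))
        + 5 * (norm \<phi>)\<^sup>2 / \<sigma> + \<delta> * (\<sigma> * v * real (card F)))"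
      if \<delta>: "0 < \<delta>" for \<delta>
    proof -
      have dw: "0 < \<delta> + weight k" for k using \<delta> weight_nonneg[of k] by linarith
      have m0: "0 \<le> mass k / (\<delta> + weight k)" for k using dw[of k] by (simp add: mass_def)
      have "ennreal (\<Sum>k\<in>F. mass k / (\<delta> + weight k)) = (\<Sum>k\<in>F. ennreal (mass k / (\<delta> + weight k)))"
        using m0 by (simp add: sum_ennreal)
      also have "\<dots> = (\<integral>\<^sup>+k. ennreal (mass k / (\<delta> + weight k)) \<partial>count_space F)"
        by (rule nn_integral_count_space_finite[symmetric, OF F])
      also have "\<dots> \<le> (\<integral>\<^sup>+k. ennreal (mass k / (\<delta> + weight k)) \<partial>count_space UNIV)"
        by (subst nn_integral_count_space_indicator) (auto intro!: nn_integral_mono simp: indicator_def)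
      also have "\<dots> \<le> ennreal (5 * (norm \<phi>)\<^sup>2)" by (rule weighted_mass_le[OF \<delta>])
      finally have m: "(\<Sum>k\<in>F. mass k / (\<delta> + weight k)) \<le> 5 * (norm \<phi>)\<^sup>2"
        by (subst (asm) ennreal_le_iff) auto
      have "sum (\<lambda>k. 2 * a k) F \<le> (\<Sum>k\<in>F. ennreal (\<sigma> * (\<delta> + weight k) * v + mass k / (\<delta>
          + weight k) / \<sigma>))"
        by (intro sum_mono single \<delta>)
      also have "\<dots> = ennreal (\<Sum>k\<in>F. \<sigma> * (\<delta> + weight k) * v + mass k / (\<delta> + weight k) / \<sigma>)"
        using \<sigma> \<delta> v0 dw m0 by (intro sum_ennreal add_nonneg_nonneg mult_nonneg_nonneg divide_nonneg_pos)
          (auto simp: less_imp_le mass_def weight_nonneg)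
      also have "(\<Sum>k\<in>F. \<sigma> * (\<delta> + weight k) * v + mass k / (\<delta> + weight k) / \<sigma>)
          = \<sigma> * v * sum weight F + \<delta> * (\<sigma> * v * real (card F)) + (\<Sum>k\<in>F. mass k / (\<delta> + weight k)) / \<sigma>"
        by (simp add: sum.distrib sum_distrib_left sum_distrib_right sum_divide_distrib algebra_simps)
      also have "\<dots> \<le> \<sigma> * v * ((15 / 4) ^ CARD('d) * real N) + \<delta> * (\<sigma> * v * real (card F))
          + 5 * (norm \<phi>)\<^sup>2 / \<sigma>"
        using \<sigma> \<delta> v0 by (intro add_mono mult_left_mono divide_right_mono sum_weight_le F m) auto
      finally show ?thesis by (simp add: ennreal_leI algebra_simps)
    qed
    \<comment> \<open>The regularisation costs \<delta> times the number of cells in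
      \<open>F\<close>, so \<delta> tends to 0 while \<open>F\<close> is still a fixed finite set;
      only afterwards does \<open>F\<close> exhaust the lattice.\<close>
    show ?thesis
    proof (rule tendsto_lowerbound)
      have "((\<lambda>\<delta>. \<sigma> * (v * ((15 / 4) ^ CARD('d) * real N)) + 5 * (norm \<phi>)\<^sup>2 / \<sigma>
          + \<delta> * (\<sigma> * v * real (card F)))
          \<longlongrightarrow> \<sigma> * (v * ((15 / 4) ^ CARD('d) * real N)) + 5 * (norm \<phi>)\<^sup>2 / \<sigma>
              + 0 * (\<sigma> * v * real (card F))) (at_right 0)"
        by (intro tendsto_intros)
      then show "((\<lambda>\<delta>. ennreal (\<sigma> * (v * ((15 / 4) ^ CARD('d) * real N)) + 5 * (norm \<phi>)\<^sup>2 / \<sigma>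
          + \<delta> * (\<sigma> * v * real (card F))))
          \<longlongrightarrow> ennreal ?R) (at_right 0)"
        unfolding v_def by (intro tendsto_ennrealI) simp
      show "eventually (\<lambda>\<delta>. sum (\<lambda>k. 2 * a k) F
          \<le> ennreal (\<sigma> * (v * ((15 / 4) ^ CARD('d) * real N)) + 5 * (norm \<phi>)\<^sup>2 / \<sigma>
              + \<delta> * (\<sigma> * v * real (card F)))) (at_right 0)"
        using eventually_at_right_less[of "0::real"] by eventually_elim (rule \<delta>_bound)
    qed simp
  qed
  have "2 * L1_norm = 2 * (\<integral>\<^sup>+x. (\<integral>\<^sup>+k. ennreal (cutoff l k x) * ennreal (cmod (rep_L2 \<phi> x))
      \<partial>count_space UNIV) \<partial>lebesgue)"
    by (simp add: L1_norm_def nn_integral_multc nn_integral_cutoff)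
  also have "\<dots> = 2 * (\<integral>\<^sup>+k. a k \<partial>count_space UNIV)"
    unfolding a_def by (subst nn_integral_count_space_nn_integral) auto
  also have "\<dots> = (\<integral>\<^sup>+k. 2 * a k \<partial>count_space UNIV)"
    by (rule nn_integral_cmult[symmetric]) simp
  also have "\<dots> \<le> ennreal ?R" by (rule nn_integral_count_space_bound[OF fin])
  finally show ?thesis .
qed

lemma L1_norm_sq_le: "L1_norm < top \<and> (enn2real L1_norm)\<^sup>2
    \<le> (2 * l) ^ CARD('d) * ((15 / 4) ^ CARD('d) * real N) * (5 * (norm \<phi>)\<^sup>2)"
proof
  have "2 * L1_norm < top" by (rule le_less_trans[OF L1_norm_le[OF zero_less_one]]) simp
  then show fin: "L1_norm < top" by (simp add: less_top[symmetric] ennreal_mult_eq_top_iff)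
  define n where "n = enn2real L1_norm"
  have n: "L1_norm = ennreal n" "0 \<le> n" using fin by (auto simp: n_def)
  have A0: "0 \<le> (2 * l) ^ CARD('d) * ((15 / 4) ^ CARD('d) * real N)" using l by simp
  show "(enn2real L1_norm)\<^sup>2 \<le> (2 * l) ^ CARD('d) * ((15 / 4) ^ CARD('d) * real N) * (5 * (norm \<phi>)\<^sup>2)"
    unfolding n_def[symmetric]
  proof (rule sq_le_if_AM_GM)
    fix \<sigma> :: real assume \<sigma>: "0 < \<sigma>"
    have "ennreal (2 * n) \<le> ennreal (\<sigma> * ((2 * l) ^ CARD('d) * ((15 / 4) ^ CARD('d) * real N))
        + 5 * (norm \<phi>)\<^sup>2 / \<sigma>)"
      using L1_norm_le[OF \<sigma>] n by (simp add: ennreal_mult)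
    then show "2 * n \<le> \<sigma> * ((2 * l) ^ CARD('d) * ((15 / 4) ^ CARD('d) * real N)) + 5 * (norm \<phi>)\<^sup>2 / \<sigma>"
      using \<sigma> A0 by (subst (asm) ennreal_le_iff) auto
  qed (use n A0 nonzero in auto)
qed

end

theorem corollary1p3:
  fixes \<Omega> :: "(real ^ 'd) set"
    and T :: "real \<Rightarrow> (real ^ 'd) L2 \<Rightarrow> (real ^ 'd) L2"
    and H :: "((real ^ 'd) L2 \<times> (real ^ 'd) L2) set"
    and \<phi> :: "(real ^ 'd) L2"
    and lam :: real
  assumes "\<Omega> \<in> sets lebesgue"
    and "C0_semigroup_on (L2_on \<Omega>) T"
    and "selfadjoint_semigroup_on (L2_on \<Omega>) T"
    and "positivity_preserving_on (L2_on \<Omega>) T"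
    and "generator_on (L2_on \<Omega>) T = {(f, - g) | f g. (f, g) \<in> H}"
    and "dominated_by_heat_semigroup_on (L2_on \<Omega>) T"
    and "compact_resolvent_on (L2_on \<Omega>) H"
    and "eigenfunction H lam \<phi>"
  shows "integrable (lebesgue_on \<Omega>) (rep_L2 \<phi>) \<and>
    (\<forall>\<epsilon>>0.
      let d = CARD('d);
          c = 35 ^ (d + 1) * real d powr (real d / 2);
          C = \<epsilon> powr (- (1 / 2)) * ln (3 + 3 / \<epsilon>)
      in (LINT x|lebesgue_on \<Omega>. cmod (rep_L2 \<phi> x))\<^sup>2
           \<le> c * C ^ d * lam powr (- (real d / 2))
               * real (eigenvalue_count H ((1 + \<epsilon>) * lam)) * (norm \<phi>)\<^sup>2)"
proof -
  interpret compact_dominated_semigroup \<Omega> T H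
    by unfold_locales (use assms in auto)
  have eig: "\<phi> \<in> eigenspace H lam" and nz: "\<phi> \<noteq> 0" using assms(8) by (auto simp: eigenfunction_def)
  have lam: "0 < lam" using eigen_pos[OF _ nz] eig by (simp add: eigenspace_iff)
  define d where "d = CARD('d)"
  have d: "0 < d" by (simp add: d_def)
  define I where "I = (\<integral>\<^sup>+x. ennreal (cmod (rep_L2 \<phi> x)) \<partial>lebesgue)"
  have main: "I < top \<and> (enn2real I)\<^sup>2 \<le> 5 * (35 ^ d * (real d powr (real d / 2) * (\<epsilon> powr (- (1 / 2)))
      ^ d * lam powr (- (real d / 2))))
      * real (eigenvalue_count H ((1 + \<epsilon>) * lam)) * (norm \<phi>)\<^sup>2" if \<epsilon>: "0 < \<epsilon>" for \<epsilon>
  proof -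
    define q where "q = real d / (\<epsilon> * lam)"
    have q: "0 < q" using d \<epsilon> lam by (simp add: q_def)
    \<comment> \<open>The constant 14/3 turns \<open>2 * l * (15 / 4)\<close> into
      \<open>35 * sqrt q\<close>, and with \<pi> <= 22/7 it is still large enough for the
      absorption: 5/3 \<pi>^2 <= 4/5 * 196/9, where 196/9 is its square.\<close>
    define l where "l = 14 / 3 * sqrt q"
    have l: "0 < l" "l\<^sup>2 = 196 / 9 * q" using q by (auto simp: l_def power_mult_distrib power_divide)
    have "5 / 3 * pi\<^sup>2 * real d / l\<^sup>2 \<le> 4 / 5 * (\<epsilon> * lam)"
    proof -
      have "pi \<le> 22 / 7" using pi_approx by simp
      then have "pi * pi \<le> 22 / 7 * (22 / 7)" by (intro mult_mono) auto
      then have p: "5 / 3 * pi\<^sup>2 \<le> 4 / 5 * (196 / 9)" by (simp add: power2_eq_square)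
      have "5 / 3 * pi\<^sup>2 * real d / l\<^sup>2 = 5 / 3 * pi\<^sup>2 * ((\<epsilon> * lam) / (196 / 9))"
        unfolding l(2) q_def using d \<epsilon> lam by (simp add: field_simps)
      also have "\<dots> \<le> (4 / 5 * (196 / 9)) * ((\<epsilon> * lam) / (196 / 9))"
        using \<epsilon> lam by (intro mult_right_mono p) auto
      finally show ?thesis by simp
    qed
    then have l_large: "5 / 3 * pi\<^sup>2 * real CARD('d) / l\<^sup>2 \<le> 4 / 5 * (\<epsilon> * lam)"
      by (simp only: d_def)
    have loc: "eigen_localisation \<Omega> T H \<phi> lam \<epsilon> l"
      by (intro eigen_localisation.intro eigen_localisation_axioms.intro
          compact_dominated_semigroup_axioms
          eig nz \<epsilon> l(1) l_large)
    note bound = eigen_localisation.L1_norm_sq_le[OF loc, unfolded eigen_localisation.L1_norm_def[OF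
        loc], folded I_def d_def]
    have "(2 * l) ^ d * (15 / 4) ^ d = (2 * l * (15 / 4)) ^ d"
      by (rule power_mult_distrib[symmetric])
    also have "2 * l * (15 / 4) = 35 * sqrt q"
      by (simp add: l_def)
    also have "(35 * sqrt q) ^ d = 35 ^ d * (real d powr (real d / 2) * (\<epsilon> powr (- (1 / 2))) ^ d * lam
        powr (- (real d / 2)))"
    proof -
      have "sqrt q = q powr (1 / 2)" using q by (simp add: powr_half_sqrt)
      then have "sqrt q ^ d = (q powr (1 / 2)) powr real d"
        using q by (subst powr_realpow) auto
      also have "\<dots> = q powr (real d / 2)" by (simp add: powr_powr)
      also have "\<dots> = real d powr (real d / 2) * (\<epsilon> powr (- (real d / 2)) * lam powr (- (real d / 2)))"
      proof -
        have "q powr (real d / 2) = real d powr (real d / 2) / (\<epsilon> powr (real d / 2) * lam powr (real d /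
            2))"
          unfolding q_def using d \<epsilon> lam by (simp add: powr_divide powr_mult)
        then show ?thesis by (simp only: powr_minus divide_inverse inverse_mult_distrib)
      qed
      also have "\<epsilon> powr (- (real d / 2)) = (\<epsilon> powr (- (1 / 2))) ^ d"
      proof -
        have "(\<epsilon> powr (- (1 / 2))) ^ d = (\<epsilon> powr (- (1 / 2))) powr real d"
          using \<epsilon> by (subst powr_realpow) auto
        then show ?thesis by (simp add: powr_powr)
      qed
      finally show ?thesis by (simp add: power_mult_distrib mult.assoc)
    qed
    finally have eq: "(2 * l) ^ d * ((15 / 4) ^ d * real (eigenvalue_count H ((1
        + \<epsilon>) * lam))) * (5 * (norm \<phi>)\<^sup>2)
        = 5 * (35 ^ d * (real d powr (real d / 2) * (\<epsilon> powr (- (1 / 2))) ^ d * lam powr (- (real d /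
            2))))
          * real (eigenvalue_count H ((1 + \<epsilon>) * lam)) * (norm \<phi>)\<^sup>2"
      by (simp only: mult.assoc[symmetric])
    show ?thesis using bound unfolding eq .
  qed
  \<comment> \<open>Finiteness of the L1 norm does not involve \<epsilon>, so any value
    serves.\<close>
  have If: "I < top" using main[of 1] by simp
  have int: "integrable lebesgue (rep_L2 \<phi>)"
    using If by (intro integrableI_bounded) (auto simp: I_def)
  have intO: "integrable (lebesgue_on \<Omega>) (rep_L2 \<phi>)"
    using integrable_mult_indicator[OF assms(1) int] assms(1)
    by (simp add: integrable_restrict_space)
  have LI: "(LINT x|lebesgue_on \<Omega>. cmod (rep_L2 \<phi> x)) \<le> enn2real I"
  proof -
    have "(LINT x|lebesgue_on \<Omega>. cmod (rep_L2 \<phi> x))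
        = (LINT x|lebesgue. indicator \<Omega> x *\<^sub>R cmod (rep_L2 \<phi> x))"
      using assms(1) by (simp add: integral_restrict_space)
    also have "\<dots> \<le> (LINT x|lebesgue. cmod (rep_L2 \<phi> x))"
      using int integrable_mult_indicator[OF assms(1) integrable_norm[OF int]]
      by (intro integral_mono) (auto simp: indicator_def)
    also have "\<dots> = enn2real I"
      unfolding I_def by (rule integral_eq_nn_integral) auto
    finally show ?thesis .
  qed
  have "(LINT x|lebesgue_on \<Omega>. cmod (rep_L2 \<phi> x))\<^sup>2
      \<le> (35 ^ (d + 1) * real d powr (real d / 2)) * (\<epsilon> powr (- (1 / 2)) * ln (3
          + 3 / \<epsilon>)) ^ d * lam powr (- (real d / 2))
         * real (eigenvalue_count H ((1 + \<epsilon>) * lam)) * (norm \<phi>)\<^sup>2" if \<epsilon>: "0 < \<epsilon>" for \<epsilon>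
  proof -
    let ?N = "real (eigenvalue_count H ((1 + \<epsilon>) * lam))"
    let ?P = "real d powr (real d / 2) * (\<epsilon> powr (- (1 / 2))) ^ d * lam powr (- (real d / 2))"
    \<comment> \<open>As e <= 3, the logarithm is at least 1 and its power can be inserted on the
      larger side.\<close>
    have "exp 1 \<le> 3 + 3 / \<epsilon>" using exp_le \<epsilon> by (intro order_trans[OF exp_le]) simp
    then have "1 \<le> ln (3 + 3 / \<epsilon>)" using \<epsilon> by (subst ln_ge_iff) (auto intro: add_pos_pos)
    then have L: "1 \<le> ln (3 + 3 / \<epsilon>) ^ d" by (rule one_le_power)
    have "(LINT x|lebesgue_on \<Omega>. cmod (rep_L2 \<phi> x))\<^sup>2 \<le> (enn2real I)\<^sup>2"
      by (intro power_mono LI) simp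
    also have "\<dots> \<le> 5 * (35 ^ d * ?P) * ?N * (norm \<phi>)\<^sup>2" using main[OF \<epsilon>] by blast
    also have "\<dots> \<le> (35 * (35 ^ d * ?P) * ln (3 + 3 / \<epsilon>) ^ d) * ?N * (norm \<phi>)\<^sup>2"
    proof (intro mult_right_mono)
      have P: "0 \<le> 35 ^ d * ?P" by simp
      \<comment> \<open>The factor 5 of the weighted mass bound is enlarged to the last 35 of
        \<open>35 ^ (d + 1)\<close>.\<close>
      have "5 * (35 ^ d * ?P) \<le> 35 * (35 ^ d * ?P) * 1" using P by simp
      also have "\<dots> \<le> 35 * (35 ^ d * ?P) * ln (3 + 3 / \<epsilon>) ^ d" using P L by (intro mult_left_mono) auto
      finally show "5 * (35 ^ d * ?P) \<le> 35 * (35 ^ d * ?P) * ln (3 + 3 / \<epsilon>) ^ d" .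
    qed auto
    finally show ?thesis by (simp add: power_mult_distrib mult_ac)
  qed
  then show ?thesis using intO by (simp add: Let_def d_def)
qed

end
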